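(* Let $d\ge2$, $p\ge q>0$, $pq>1$, and let $\alpha=\frac{2(p+1)}{pq-1}$, $\beta=\frac{2(q+1)}{pq-1}$. Let $(u,v)$, $u,v\in C^2(\mathbb{R}^d)$, be a nonnegative solution of $$-\Delta u=|v|^{p-1}v,\qquad -\Delta v=|u|^{q-1}u\qquad\text{in }\mathbb{R}^d$$ which is stable outside a compact set. Then the family $(u_R,v_R)_{R\ge1}$ given by $$(u_R,v_R)(x)=(R^\alpha u(Rx),R^\beta v(Rx)),\qquad x\in\mathbb{R}^d,$$ is relatively compact in $L^{q+1}_{loc}(\mathbb{R}^d\setminus\{0\})\times L^{p+1}_{loc}(\mathbb{R}^d\setminus\{0\})$.
   Context: Stability outside a compact set: there exist a compact set $K\subset\mathbb{R}^d$ and two positive functions $\phi,\psi\in C^2(\mathbb{R}^d\setminus K)$ such that $-\Delta\phi\ge p|v|^{p-1}\psi$ and $-\Delta\psi\ge q|u|^{q-1}\phi$ in $\mathbb{R}^d\setminus K$. *)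

theory Defs
  imports "HOL-Analysis.Analysis"
begin

subsection \<open>Twice continuously differentiable functions and the Laplacian\<close>

definition partial_deriv :: "'a::euclidean_space \<Rightarrow> ('a \<Rightarrow> real) \<Rightarrow> 'a \<Rightarrow> real"
  where "partial_deriv b f x = frechet_derivative f (at x) b"

(* Intended for open S, where "differentiable_on" agrees with differentiability at each point;
   the values of f outside S are then irrelevant. *)
definition C2_on :: "'a::euclidean_space set \<Rightarrow> ('a \<Rightarrow> real) \<Rightarrow> bool"
  where "C2_on S f \<longleftrightarrow>
    f differentiable_on S \<and>
    (\<forall>b\<in>Basis. partial_deriv b f differentiable_on S) \<and>
    (\<forall>b\<in>Basis. \<forall>c\<in>Basis. continuous_on S (partial_deriv c (partial_deriv b f)))"

definition laplacian :: "('a::euclidean_space \<Rightarrow> real) \<Rightarrow> 'a \<Rightarrow> real"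
  where "laplacian f x = (\<Sum>b\<in>Basis. partial_deriv b (partial_deriv b f) x)"


subsection \<open>Solutions of the Lane-Emden system and stability\<close>

(* |t|^s.  HOL has 0 powr 0 = 0, whereas |t|^0 = 1 is wanted for every t.  For t = 0 and s < 0
   the value is 0; below this occurs only in the stability condition with q < 1 at a zero of u,
   where it makes that condition weaker than under any other convention.  (A nonnegative solution
   with a zero is trivial, by the strong maximum principle.) *)
definition abs_powr :: "real \<Rightarrow> real \<Rightarrow> real"
  where "abs_powr t s = (if s = 0 then 1 else \<bar>t\<bar> powr s)"

definition lane_emden_solution ::
    "real \<Rightarrow> real \<Rightarrow> ('a::euclidean_space \<Rightarrow> real) \<Rightarrow> ('a \<Rightarrow> real) \<Rightarrow> bool"
  where "lane_emden_solution p q u v \<longleftrightarrow>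
    C2_on UNIV u \<and> C2_on UNIV v \<and>
    (\<forall>x. - laplacian u x = abs_powr (v x) (p - 1) * v x) \<and>
    (\<forall>x. - laplacian v x = abs_powr (u x) (q - 1) * u x)"

definition stable_outside_compact ::
    "real \<Rightarrow> real \<Rightarrow> ('a::euclidean_space \<Rightarrow> real) \<Rightarrow> ('a \<Rightarrow> real) \<Rightarrow> bool"
  where "stable_outside_compact p q u v \<longleftrightarrow>
    (\<exists>K \<phi> \<psi>. compact K \<and> C2_on (- K) \<phi> \<and> C2_on (- K) \<psi> \<and>
      (\<forall>x\<in>- K. \<phi> x > 0 \<and> \<psi> x > 0 \<and>
        - laplacian \<phi> x \<ge> p * abs_powr (v x) (p - 1) * \<psi> x \<and>
        - laplacian \<psi> x \<ge> q * abs_powr (u x) (q - 1) * \<phi> x))"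


subsection \<open>The space of locally \<open>r\<close>-integrable functions\<close>

definition Lloc_fun :: "'a::euclidean_space set \<Rightarrow> real \<Rightarrow> ('a \<Rightarrow> real) set"
  where "Lloc_fun \<Omega> r = {f \<in> borel_measurable (lebesgue_on \<Omega>).
    \<forall>K. compact K \<and> K \<subseteq> \<Omega> \<longrightarrow> integrable (lebesgue_on K) (\<lambda>x. \<bar>f x\<bar> powr r)}"

definition Lloc_rel :: "'a::euclidean_space set \<Rightarrow> real \<Rightarrow> (('a \<Rightarrow> real) \<times> ('a \<Rightarrow> real)) set"
  where "Lloc_rel \<Omega> r = {(f, g). f \<in> Lloc_fun \<Omega> r \<and> g \<in> Lloc_fun \<Omega> r \<and>
    (AE x in lebesgue_on \<Omega>. f x = g x)}"

definition Lloc_class :: "'a::euclidean_space set \<Rightarrow> real \<Rightarrow> ('a \<Rightarrow> real) \<Rightarrow> ('a \<Rightarrow> real) set"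
  where "Lloc_class \<Omega> r f = Lloc_rel \<Omega> r `` {f}"

definition L_seminorm :: "'a::euclidean_space set \<Rightarrow> real \<Rightarrow> ('a \<Rightarrow> real) \<Rightarrow> real"
  where "L_seminorm K r f = (\<integral>x. \<bar>f x\<bar> powr r \<partial>lebesgue_on K) powr (1 / r)"

definition Lloc_ball ::
    "'a::euclidean_space set \<Rightarrow> real \<Rightarrow> ('a \<Rightarrow> real) \<Rightarrow> 'a set \<Rightarrow> real \<Rightarrow> ('a \<Rightarrow> real) set set"
  where "Lloc_ball \<Omega> r f K \<epsilon> =
    Lloc_class \<Omega> r ` {g \<in> Lloc_fun \<Omega> r. L_seminorm K r (\<lambda>x. g x - f x) < \<epsilon>}"

(* The points are almost-everywhere classes; the topology is generated by the seminorms
   of L^r(K), K a compact subset of \<Omega>. *)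
definition Lloc :: "'a::euclidean_space set \<Rightarrow> real \<Rightarrow> ('a \<Rightarrow> real) set topology"
  where "Lloc \<Omega> r = topology_generated_by
    {Lloc_ball \<Omega> r f K \<epsilon> | f K \<epsilon>. f \<in> Lloc_fun \<Omega> r \<and> compact K \<and> K \<subseteq> \<Omega> \<and> 0 < \<epsilon>}"

lemma equiv_Lloc_rel: "equiv (Lloc_fun \<Omega> r) (Lloc_rel \<Omega> r)"
proof (rule equivI)
  show "Lloc_rel \<Omega> r \<subseteq> Lloc_fun \<Omega> r \<times> Lloc_fun \<Omega> r"
    by (auto simp: Lloc_rel_def)
  show "refl_on (Lloc_fun \<Omega> r) (Lloc_rel \<Omega> r)"
    by (auto simp: Lloc_rel_def refl_on_def)
  show "sym (Lloc_rel \<Omega> r)"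
    by (auto simp: Lloc_rel_def sym_def elim!: eventually_mono)
  show "trans (Lloc_rel \<Omega> r)"
  proof (rule transI)
    fix f g h assume fg: "(f, g) \<in> Lloc_rel \<Omega> r" and gh: "(g, h) \<in> Lloc_rel \<Omega> r"
    have "AE x in lebesgue_on \<Omega>. f x = g x" "AE x in lebesgue_on \<Omega>. g x = h x"
      using fg gh by (auto simp: Lloc_rel_def)
    then have "AE x in lebesgue_on \<Omega>. f x = h x"
      by (rule eventually_elim2) (rule trans)
    then show "(f, h) \<in> Lloc_rel \<Omega> r"
      using fg gh by (simp add: Lloc_rel_def)
  qed
qed

lemma topspace_Lloc: "topspace (Lloc \<Omega> r) = Lloc_fun \<Omega> r // Lloc_rel \<Omega> r"
proof -
  have quot: "Lloc_fun \<Omega> r // Lloc_rel \<Omega> r = Lloc_class \<Omega> r ` Lloc_fun \<Omega> r"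
    by (auto simp: quotient_def Lloc_class_def)
  have "Lloc_class \<Omega> r f \<in> Lloc_ball \<Omega> r f {} 1" if "f \<in> Lloc_fun \<Omega> r" for f
    unfolding Lloc_ball_def using that by (auto simp: L_seminorm_def)
  then have "Lloc_class \<Omega> r ` Lloc_fun \<Omega> r \<subseteq> topspace (Lloc \<Omega> r)"
    unfolding Lloc_def topology_generated_by_topspace
    by (intro image_subsetI UnionI) (auto intro!: exI[of _ "{}"] exI[of _ "1::real"])
  moreover have "Lloc_ball \<Omega> r f K \<epsilon> \<subseteq> Lloc_class \<Omega> r ` Lloc_fun \<Omega> r" for f K \<epsilon>
    by (auto simp: Lloc_ball_def)
  then have "topspace (Lloc \<Omega> r) \<subseteq> Lloc_class \<Omega> r ` Lloc_fun \<Omega> r"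
    unfolding Lloc_def topology_generated_by_topspace by blast
  ultimately show ?thesis
    unfolding quot by (rule subset_antisym[rotated])
qed


subsection \<open>Relative compactness\<close>

(* The inclusion is needed since closure_of ignores points outside the space. *)
definition relatively_compact_in :: "'a topology \<Rightarrow> 'a set \<Rightarrow> bool"
  where "relatively_compact_in X S \<longleftrightarrow> S \<subseteq> topspace X \<and> compactin X (X closure_of S)"

end

theory Submission
  imports Defs
begin

text \<open>
  If \<open>v - C (u + \<epsilon>)\<^sup>\<sigma>\<close>, \<open>\<sigma> = (q + 1) / (p + 1)\<close>, is positive somewhere, it is a subsolution of
  \<open>\<Delta>w = c w\<^sup>1\<^sup>+\<^sup>e\<close> there, which the Keller--Osserman estimate forbids on the whole space; hence
  \<open>v\<^sup>p\<^sup>+\<^sup>1 \<le> C u\<^sup>q\<^sup>+\<^sup>1\<close>, and it suffices to control \<open>u\<close>.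
  A Picone-type argument turns the supersolution \<open>(\<phi>, \<psi>)\<close> into the inequality
  \<open>p \<integral>v\<^sup>p\<^sup>-\<^sup>1 \<eta>\<^sup>2 \<le> 1/q \<integral>u\<^sup>1\<^sup>-\<^sup>q ((- \<Delta>\<eta>)\<^sup>+)\<^sup>2\<close>. Only the positive part of \<open>- \<Delta>\<eta>\<close> enters, so that convex
  powers of \<open>u\<close> or \<open>v\<close>, cut off to an annulus, are good test functions. Together with Green's
  identities for the weights \<open>u\<^sup>a v\<^sup>b\<close> they bound \<open>u\<^sub>R\<close> in \<open>L\<^sup>N\<close> of an annulus, uniformly in \<open>R\<close>, for some
  \<open>N > q + 1\<close>: this is where \<open>p q > 1\<close> is used.
  The functions \<open>u\<^sub>R\<close> and \<open>v\<^sub>R\<close> are superharmonic, so these bounds also control their gradients in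
  \<open>L\<^sup>1\<close>. Mollification then gives compactness in \<open>L\<^sup>1\<close>, and interpolation with \<open>L\<^sup>N\<close> gives it in
  \<open>L\<^sup>q\<^sup>+\<^sup>1\<close>; for \<open>v\<^sub>R\<close> likewise.
\<close>

subsection \<open>Integration by parts\<close>

text \<open>The comparison works in one direction only: it lowers the exponent of \<open>v\<close>
  and raises that of \<open>u\<close>. If \<open>v\<close> counts as \<open>u powr \<sigma>\<close>,
  the energies \<open>u powr (q + 1)\<close> and \<open>v powr (p + 1)\<close> have the same degree,
  and in Green's identities every pair of derivatives that falls on the cut-off lowers the degree by
  \<open>q - \<sigma>\<close>. This gap is positive exactly when \<open>p * q > 1\<close>; cut-off
  terms are then of lower order and can be absorbed into the integral of \<open>u powr N\<close>.
  The obstacle is the top order. Powers of \<open>u\<close> can be traded for powers of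
  \<open>v\<close> only under the integral, and a negative exponent of \<open>v\<close> gives the
  gradient terms the sign this needs; after that, the leading constant of the stability inequality
  has to beat the constants lost in the exchange, strictly. A convex power of \<open>u\<close> is
  available for \<open>q \<ge> 1\<close>, a power of \<open>v\<close> serves for
  \<open>q \<le> 1\<close>; hence there are two closing arguments. All constants are fixed before
  the pair \<open>(u, v)\<close>, so they hold uniformly for the rescaled pairs, which solve the
  same system.\<close>

lemma has_derivative_imp_continuous_on:
  assumes "\<And>x. x \<in> S \<Longrightarrow> (f has_derivative D x) (at x)"
  shows "continuous_on S f"
  using assms by (intro continuous_at_imp_continuous_on ballI has_derivative_continuous)

lemma integrable_compact_support:
  fixes f :: "'a::euclidean_space \<Rightarrow> real"
  assumes "continuous_on UNIV f" "compact C" "\<And>x. x \<notin> C \<Longrightarrow> f x = 0"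
  shows "integrable lborel f"
proof -
  have "integrable lborel (\<lambda>x. indicator C x *\<^sub>R f x)"
    using assms by (intro borel_integrable_compact) (auto intro: continuous_on_subset)
  also have "(\<lambda>x. indicator C x *\<^sub>R f x) = f"
    using assms(3) by (intro ext) (auto simp: indicator_def)
  finally show ?thesis .
qed

lemma continuous_on_UNIV_support:
  fixes f :: "'a::t2_space \<Rightarrow> 'b::real_normed_vector"
  assumes "open S" "compact C" "C \<subseteq> S" "continuous_on S f" "\<And>x. x \<notin> C \<Longrightarrow> f x = 0"
  shows "continuous_on UNIV f"
proof -
  have "continuous_on (- C) f"
    by (rule continuous_on_eq[of _ "\<lambda>x. 0"]) (use assms(5) in auto)
  moreover have "open (- C)" using assms(2) by (simp add: compact_imp_closed open_Compl)
  ultimately have "continuous_on (S \<union> - C) f"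
    using assms by (intro continuous_on_open_Un) auto
  moreover have "S \<union> - C = UNIV" using assms(3) by auto
  ultimately show ?thesis by simp
qed

lemma bounded_compact_support:
  fixes f :: "'a::topological_space \<Rightarrow> real"
  assumes "continuous_on UNIV f" "compact C" "\<And>x. x \<notin> C \<Longrightarrow> f x = 0"
  obtains M where "M \<ge> 0" "\<And>x. \<bar>f x\<bar> \<le> M"
proof -
  have "compact (f ` C)"
    using assms by (intro compact_continuous_image) (auto intro: continuous_on_subset)
  then obtain M where M: "\<forall>y\<in>f ` C. \<bar>y\<bar> \<le> M"
    using compact_imp_bounded bounded_real by metis
  have "\<bar>f x\<bar> \<le> max M 0" for x
    using M assms(3)[of x] by (cases "x \<in> C") auto
  then show ?thesis using that[of "max M 0"] by auto
qed

lemma integrable_translate: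
  fixes f :: "'a::euclidean_space \<Rightarrow> real"
  assumes "integrable lborel f"
  shows "integrable lborel (\<lambda>x. f (x + c))" "(\<integral>x. f (x + c) \<partial>lborel) = (\<integral>x. f x \<partial>lborel)"
proof -
  have m: "(+) c \<in> lborel \<rightarrow>\<^sub>M borel" by simp
  have f: "f \<in> borel_measurable borel" using assms by (simp add: borel_measurable_integrable)
  show "integrable lborel (\<lambda>x. f (x + c))"
    using integrable_distr_eq[OF m f] assms by (simp add: lborel_distr_plus add.commute)
  show "(\<integral>x. f (x + c) \<partial>lborel) = (\<integral>x. f x \<partial>lborel)"
    using integral_distr[OF m f] by (simp add: lborel_distr_plus add.commute)
qed

lemma has_real_derivative_along_line:
  fixes f :: "'a::real_normed_vector \<Rightarrow> real"
  assumes "(f has_derivative D) (at (x + t *\<^sub>R w))"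
  shows "((\<lambda>t. f (x + t *\<^sub>R w)) has_real_derivative D w) (at t)"
proof -
  have "((\<lambda>t. x + t *\<^sub>R w) has_derivative (\<lambda>h. h *\<^sub>R w)) (at t)"
    by (auto intro!: derivative_eq_intros)
  from has_derivative_compose[OF this assms]
  have "((\<lambda>t. f (x + t *\<^sub>R w)) has_derivative (\<lambda>h. D (h *\<^sub>R w))) (at t)" .
  moreover have "D (h *\<^sub>R w) = D w * h" for h
    using assms has_derivative_bounded_linear[OF assms]
    by (simp add: bounded_linear.linear linear_cmul)
  ultimately show ?thesis by (simp add: has_field_derivative_def)
qed

lemma thickening_compact:
  fixes C :: "'a::euclidean_space set"
  assumes "compact C"
  shows "compact {x + y | x y. x \<in> C \<and> y \<in> cball 0 r}"
  using compact_sums[OF assms compact_cball] .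

text \<open>Dominated convergence for quotients with step \<open>1 / Suc n\<close>: the mean value
  theorem bounds them by the bound of \<open>D x w\<close>, and they live on one compact set.
  \<open>\<Phi>\<close> is the identity where the integral of a derivative is wanted,
  \<open>abs\<close> where its \<open>L1\<close> norm is.\<close>

lemma difference_quotients_tendsto:
  fixes g :: "'a::euclidean_space \<Rightarrow> real" and \<Phi> :: "real \<Rightarrow> real"
  assumes der: "\<And>x. (g has_derivative D x) (at x)"
    and cont: "continuous_on UNIV (\<lambda>x. D x w)"
    and C: "compact C" "\<And>x. x \<notin> C \<Longrightarrow> g x = 0"
    and \<Phi>: "continuous_on UNIV \<Phi>" "\<And>t. \<bar>\<Phi> t\<bar> \<le> \<bar>t\<bar>"
  shows "(\<lambda>n. \<integral>x. \<Phi> (real (Suc n) * (g (x + (1 / real (Suc n)) *\<^sub>R w) - g x)) \<partial>lborel)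
      \<longlonglongrightarrow> (\<integral>x. \<Phi> (D x w) \<partial>lborel)"
    and "\<And>x. x \<notin> C \<Longrightarrow> D x w = 0"
proof -
  show D0: "D x w = 0" if "x \<notin> C" for x
  proof -
    have "open (- C)" using C(1) by (simp add: compact_imp_closed open_Compl)
    then have "(g has_derivative (\<lambda>h. 0)) (at x)"
      by (rule has_derivative_transform_within_open[OF has_derivative_const[of 0]])
        (use that C(2) in auto)
    from has_derivative_unique[OF der this] show ?thesis by (simp add: fun_eq_iff)
  qed
  obtain M where M: "M \<ge> 0" "\<And>x. \<bar>D x w\<bar> \<le> M"
    using bounded_compact_support[OF cont C(1) D0] by metis
  \<comment> \<open>No step is longer than \<open>norm w\<close>, so this thickening of
    \<open>C\<close> contains the supports of all quotients.\<close>
  define K where "K = {x + y | x y. x \<in> C \<and> y \<in> cball 0 (norm w)}"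
  have K: "compact K" unfolding K_def by (rule thickening_compact[OF C(1)])
  define s where "s n x = real (Suc n) * (g (x + (1 / real (Suc n)) *\<^sub>R w) - g x)" for n x
  have gc: "continuous_on UNIV g"
    by (rule has_derivative_imp_continuous_on[OF der])
  have lip: "\<bar>s n x\<bar> \<le> M" for n x
  proof -
    have "\<exists>z. z > 0 \<and> z < 1 / real (Suc n) \<and> g (x + (1 / real (Suc n)) *\<^sub>R w) - g (x + 0 *\<^sub>R w)
        = (1 / real (Suc n) - 0) * D (x + z *\<^sub>R w) w"
      by (rule MVT2) (simp, rule has_real_derivative_along_line, rule der)
    then obtain z where "g (x + (1 / real (Suc n)) *\<^sub>R w) - g x = (1 / real (Suc n)) * D (x + z *\<^sub>R w) w"
      by auto
    then have "s n x = D (x + z *\<^sub>R w) w" by (simp add: s_def)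
    then show ?thesis using M(2) by simp
  qed
  have supp: "s n x = 0" if "x \<notin> K" for n x
  proof -
    have "x \<notin> C"
    proof
      assume "x \<in> C"
      moreover have "(0::'a) \<in> cball 0 (norm w)" by simp
      ultimately have "x + 0 \<in> K" unfolding K_def by blast
      then show False using that by simp
    qed
    moreover have "x + (1 / real (Suc n)) *\<^sub>R w \<notin> C"
    proof
      assume "x + (1 / real (Suc n)) *\<^sub>R w \<in> C"
      moreover have "- (1 / real (Suc n)) *\<^sub>R w \<in> cball 0 (norm w)"
        by (simp add: divide_simps mult_left_mono[of 1 "1 + real n" "norm w", simplified])
      ultimately have "(x + (1 / real (Suc n)) *\<^sub>R w) + (- (1 / real (Suc n)) *\<^sub>R w) \<in> K"
        unfolding K_def by blast
      then show False using that by simp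
    qed
    ultimately show ?thesis using C(2) by (simp add: s_def)
  qed
  have lim: "(\<lambda>n. s n x) \<longlonglongrightarrow> D x w" for x
  proof -
    have "((\<lambda>t. g (x + t *\<^sub>R w)) has_real_derivative D x w) (at 0)"
      using has_real_derivative_along_line[of g "D x" x 0 w] der by simp
    then have "((\<lambda>h. (g (x + h *\<^sub>R w) - g x) / h) \<longlongrightarrow> D x w) (at 0)"
      by (simp add: DERIV_def)
    moreover have "filterlim (\<lambda>n. 1 / real (Suc n)) (at 0) sequentially"
      unfolding filterlim_at using LIMSEQ_inverse_real_of_nat by (auto simp: inverse_eq_divide)
    ultimately have "(\<lambda>n. (g (x + (1 / real (Suc n)) *\<^sub>R w) - g x) / (1 / real (Suc n))) \<longlonglongrightarrow> D x w"
      by (rule filterlim_compose)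
    then show ?thesis by (simp add: s_def mult.commute)
  qed
  have \<Phi>m: "\<Phi> \<in> borel_measurable borel"
    using \<Phi>(1) by (rule borel_measurable_continuous_onI)
  have gm: "g \<in> borel_measurable borel"
    using gc by (rule borel_measurable_continuous_onI)
  have Dm: "(\<lambda>x. D x w) \<in> borel_measurable borel"
    using cont by (rule borel_measurable_continuous_onI)
  have "(\<lambda>n. \<integral>x. \<Phi> (s n x) \<partial>lborel) \<longlonglongrightarrow> (\<integral>x. \<Phi> (D x w) \<partial>lborel)"
  proof (rule integral_dominated_convergence[where w = "\<lambda>x. indicator K x *\<^sub>R M"])
    show "(\<lambda>x. \<Phi> (D x w)) \<in> borel_measurable lborel"
      using measurable_compose[OF Dm \<Phi>m] by simp
    show "(\<lambda>x. \<Phi> (s i x)) \<in> borel_measurable lborel" for i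
    proof -
      have "(\<lambda>x. s i x) \<in> borel_measurable borel"
        unfolding s_def using gm by measurable
      then show ?thesis using measurable_compose[OF _ \<Phi>m] by simp
    qed
    show "integrable lborel (\<lambda>x. indicator K x *\<^sub>R M)"
      using borel_integrable_compact[OF K, of "\<lambda>x. M"] by simp
    show "AE x in lborel. (\<lambda>i. \<Phi> (s i x)) \<longlonglongrightarrow> \<Phi> (D x w)"
    proof (intro always_eventually allI)
      fix x
      have "isCont \<Phi> (D x w)" using \<Phi>(1) by (simp add: continuous_on_eq_continuous_at)
      then show "(\<lambda>i. \<Phi> (s i x)) \<longlonglongrightarrow> \<Phi> (D x w)"
        using lim[of x] isCont_tendsto_compose by blast
    qed
    show "AE x in lborel. norm (\<Phi> (s i x)) \<le> indicator K x *\<^sub>R M" for i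
    proof (intro always_eventually allI)
      fix x
      show "norm (\<Phi> (s i x)) \<le> indicator K x *\<^sub>R M"
        using \<Phi>(2)[of "s i x"] lip[of i x] supp[of x i] by (cases "x \<in> K") auto
    qed
  qed
  then show "(\<lambda>n. \<integral>x. \<Phi> (real (Suc n) * (g (x + (1 / real (Suc n)) *\<^sub>R w) - g x)) \<partial>lborel)
      \<longlonglongrightarrow> (\<integral>x. \<Phi> (D x w) \<partial>lborel)"
    by (simp add: s_def)
qed

text \<open>Translation invariance makes the integral of every difference quotient zero, and the
  limit inherits this.\<close>

lemma integral_directional_derivative:
  fixes g :: "'a::euclidean_space \<Rightarrow> real"
  assumes der: "\<And>x. (g has_derivative D x) (at x)"
    and cont: "continuous_on UNIV (\<lambda>x. D x w)"
    and C: "compact C" "\<And>x. x \<notin> C \<Longrightarrow> g x = 0"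
  shows "(\<integral>x. D x w \<partial>lborel) = 0"
proof -
  have gc: "continuous_on UNIV g"
    by (rule has_derivative_imp_continuous_on[OF der])
  have gi: "integrable lborel g" by (rule integrable_compact_support[OF gc C])
  have "(\<integral>x. real (Suc n) * (g (x + (1 / real (Suc n)) *\<^sub>R w) - g x) \<partial>lborel) = 0" for n
    using integrable_translate[OF gi] gi by simp
  then have "(\<lambda>n. 0) \<longlonglongrightarrow> (\<integral>x. D x w \<partial>lborel)"
    using difference_quotients_tendsto(1)[OF der cont C, of "\<lambda>t. t"] by simp
  then show ?thesis using LIMSEQ_unique tendsto_const by blast
qed

text \<open>The translation by \<open>w\<close> is split into \<open>Suc n\<close> equal
  translations, which all cost the same by invariance of the measure. The left-hand side is thus at
  most the \<open>L1\<close> norm of the \<open>n\<close>-th difference quotient, for every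
  \<open>n\<close>.\<close>

lemma integral_translate_diff_le:
  fixes g :: "'a::euclidean_space \<Rightarrow> real"
  assumes der: "\<And>x. (g has_derivative D x) (at x)"
    and cont: "continuous_on UNIV (\<lambda>x. D x w)"
    and C: "compact C" "\<And>x. x \<notin> C \<Longrightarrow> g x = 0"
  shows "(\<integral>x. \<bar>g (x + w) - g x\<bar> \<partial>lborel) \<le> (\<integral>x. \<bar>D x w\<bar> \<partial>lborel)"
proof (rule LIMSEQ_le_const)
  have gc: "continuous_on UNIV g"
    by (rule has_derivative_imp_continuous_on[OF der])
  have gi: "integrable lborel g" by (rule integrable_compact_support[OF gc C])
  show "(\<lambda>n. \<integral>x. \<bar>real (Suc n) * (g (x + (1 / real (Suc n)) *\<^sub>R w) - g x)\<bar> \<partial>lborel)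
      \<longlonglongrightarrow> (\<integral>x. \<bar>D x w\<bar> \<partial>lborel)"
    using difference_quotients_tendsto(1)[OF der cont C, of abs] by (simp add: continuous_intros)
  show "\<exists>N. \<forall>n\<ge>N. (\<integral>x. \<bar>g (x + w) - g x\<bar> \<partial>lborel)
      \<le> (\<integral>x. \<bar>real (Suc n) * (g (x + (1 / real (Suc n)) *\<^sub>R w) - g x)\<bar> \<partial>lborel)"
  proof (intro exI allI impI)
    fix n :: nat
    define h where "h = (1 / real (Suc n)) *\<^sub>R w"
    have i1: "integrable lborel (\<lambda>x. \<bar>g (x + h) - g x\<bar>)"
      using integrable_translate(1)[OF gi] gi by auto
    have e: "(\<integral>x. \<bar>g (x + real (Suc i) *\<^sub>R h) - g (x + real i *\<^sub>R h)\<bar> \<partial>lborel)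
        = (\<integral>x. \<bar>g (x + h) - g x\<bar> \<partial>lborel)" for i
      using integrable_translate(2)[OF i1, of "real i *\<^sub>R h"]
      by (simp add: algebra_simps)
    have "(\<integral>x. \<bar>g (x + real k *\<^sub>R h) - g x\<bar> \<partial>lborel) \<le> real k * (\<integral>x. \<bar>g (x + h) - g x\<bar> \<partial>lborel)" for k
    proof (induction k)
      case (Suc k)
      have "(\<integral>x. \<bar>g (x + real (Suc k) *\<^sub>R h) - g x\<bar> \<partial>lborel)
        \<le> (\<integral>x. \<bar>g (x + real (Suc k) *\<^sub>R h) - g (x + real k *\<^sub>R h)\<bar> + \<bar>g (x + real k *\<^sub>R h) - g x\<bar> \<partial>lborel)"
        by (intro integral_mono Bochner_Integration.integrable_add integrable_abs
            Bochner_Integration.integrable_diff integrable_translate gi) linarith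
      also have "\<dots> = (\<integral>x. \<bar>g (x + real (Suc k) *\<^sub>R h) - g (x + real k *\<^sub>R h)\<bar> \<partial>lborel)
          + (\<integral>x. \<bar>g (x + real k *\<^sub>R h) - g x\<bar> \<partial>lborel)"
        by (intro Bochner_Integration.integral_add integrable_abs
            Bochner_Integration.integrable_diff integrable_translate gi)
      finally show ?case using Suc e[of k] by (simp add: algebra_simps)
    qed simp
    from this[of "Suc n"]
    show "(\<integral>x. \<bar>g (x + w) - g x\<bar> \<partial>lborel)
      \<le> (\<integral>x. \<bar>real (Suc n) * (g (x + (1 / real (Suc n)) *\<^sub>R w) - g x)\<bar> \<partial>lborel)"
      by (simp add: h_def abs_mult)
  qed
qed

subsection \<open>Functions with gradient and Laplacian\<close>

text \<open>\<open>l\<close> is the trace of the derivative \<open>G\<close> of the gradient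
  \<open>g\<close>. Continuity is asked of the diagonal entries, because integration by parts
  differentiates the \<open>b\<close>-th component in the direction \<open>b\<close>. The class is
  stable under sums, products, compositions and dilations, and all barriers and test functions are
  built that way.\<close>

definition has_laplacian ::
    "'a::euclidean_space set \<Rightarrow> ('a \<Rightarrow> real) \<Rightarrow> ('a \<Rightarrow> 'a) \<Rightarrow> ('a \<Rightarrow> real) \<Rightarrow> bool"
  where "has_laplacian S f g l \<longleftrightarrow> (\<exists>G.
    (\<forall>x\<in>S. (f has_derivative (\<lambda>h. g x \<bullet> h)) (at x) \<and> (g has_derivative G x) (at x) \<and>
      l x = (\<Sum>b\<in>Basis. G x b \<bullet> b)) \<and>
    (\<forall>b\<in>Basis. continuous_on S (\<lambda>x. G x b \<bullet> b)))"

lemma has_laplacianD: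
  assumes "has_laplacian S f g l"
  shows "\<And>x. x \<in> S \<Longrightarrow> (f has_derivative (\<lambda>h. g x \<bullet> h)) (at x)"
    and "continuous_on S f" "continuous_on S g" "continuous_on S l"
proof -
  obtain G where G: "\<And>x. x \<in> S \<Longrightarrow> (f has_derivative (\<lambda>h. g x \<bullet> h)) (at x)"
    "\<And>x. x \<in> S \<Longrightarrow> (g has_derivative G x) (at x)"
    "\<And>x. x \<in> S \<Longrightarrow> l x = (\<Sum>b\<in>Basis. G x b \<bullet> b)"
    "\<And>b. b \<in> Basis \<Longrightarrow> continuous_on S (\<lambda>x. G x b \<bullet> b)"
    using assms unfolding has_laplacian_def by blast
  show "\<And>x. x \<in> S \<Longrightarrow> (f has_derivative (\<lambda>h. g x \<bullet> h)) (at x)" by (rule G(1))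
  show "continuous_on S f" "continuous_on S g"
    by (rule has_derivative_imp_continuous_on, erule G(1), rule has_derivative_imp_continuous_on, erule G(2))
  have "continuous_on S (\<lambda>x. \<Sum>b\<in>Basis. G x b \<bullet> b)"
    by (intro continuous_intros G(4))
  then show "continuous_on S l" by (rule continuous_on_eq) (simp add: G(3))
qed

lemma has_laplacian_subset: "has_laplacian S f g l \<Longrightarrow> T \<subseteq> S \<Longrightarrow> has_laplacian T f g l"
  unfolding has_laplacian_def by (elim exE, rule exI) (auto intro: continuous_on_subset)

lemma has_laplacian_cong:
  assumes "has_laplacian S f g l" "\<And>x. x \<in> S \<Longrightarrow> l x = l' x"
  shows "has_laplacian S f g l'"
  using assms unfolding has_laplacian_def by (elim exE, intro exI) auto

lemma has_laplacian_add:
  assumes "has_laplacian S f g l" "has_laplacian S f' g' l'"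
  shows "has_laplacian S (\<lambda>x. f x + f' x) (\<lambda>x. g x + g' x) (\<lambda>x. l x + l' x)"
proof -
  obtain G where G: "\<forall>x\<in>S. (f has_derivative (\<lambda>h. g x \<bullet> h)) (at x) \<and> (g has_derivative G x) (at x) \<and>
      l x = (\<Sum>b\<in>Basis. G x b \<bullet> b)" "\<forall>b\<in>Basis. continuous_on S (\<lambda>x. G x b \<bullet> b)"
    using assms(1) unfolding has_laplacian_def by blast
  obtain G' where G': "\<forall>x\<in>S. (f' has_derivative (\<lambda>h. g' x \<bullet> h)) (at x) \<and> (g' has_derivative G' x) (at x) \<and>
      l' x = (\<Sum>b\<in>Basis. G' x b \<bullet> b)" "\<forall>b\<in>Basis. continuous_on S (\<lambda>x. G' x b \<bullet> b)"
    using assms(2) unfolding has_laplacian_def by blast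
  have "continuous_on S (\<lambda>x. (G x b + G' x b) \<bullet> b)" if "b \<in> Basis" for b
    unfolding inner_add_left using G(2) G'(2) that by (intro continuous_on_add) auto
  then show ?thesis unfolding has_laplacian_def
    using G(1) G'(1) by (intro exI[of _ "\<lambda>x h. G x h + G' x h"])
      (auto intro!: derivative_eq_intros simp: inner_add_left sum.distrib)
qed

lemma has_laplacian_mult:
  assumes "has_laplacian S f g l" "has_laplacian S f' g' l'"
  shows "has_laplacian S (\<lambda>x. f x * f' x) (\<lambda>x. f x *\<^sub>R g' x + f' x *\<^sub>R g x)
    (\<lambda>x. f x * l' x + f' x * l x + 2 * (g x \<bullet> g' x))"
proof -
  note c = has_laplacianD[OF assms(1)] has_laplacianD[OF assms(2)]
  obtain G where G: "\<forall>x\<in>S. (f has_derivative (\<lambda>h. g x \<bullet> h)) (at x) \<and> (g has_derivative G x) (at x) \<and>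
      l x = (\<Sum>b\<in>Basis. G x b \<bullet> b)" "\<forall>b\<in>Basis. continuous_on S (\<lambda>x. G x b \<bullet> b)"
    using assms(1) unfolding has_laplacian_def by blast
  obtain G' where G': "\<forall>x\<in>S. (f' has_derivative (\<lambda>h. g' x \<bullet> h)) (at x) \<and> (g' has_derivative G' x) (at x) \<and>
      l' x = (\<Sum>b\<in>Basis. G' x b \<bullet> b)" "\<forall>b\<in>Basis. continuous_on S (\<lambda>x. G' x b \<bullet> b)"
    using assms(2) unfolding has_laplacian_def by blast
  let ?H = "\<lambda>x h. f x *\<^sub>R G' x h + (g x \<bullet> h) *\<^sub>R g' x + (f' x *\<^sub>R G x h + (g' x \<bullet> h) *\<^sub>R g x)"
  have "((\<lambda>x. f x * f' x) has_derivative (\<lambda>h. (f x *\<^sub>R g' x + f' x *\<^sub>R g x) \<bullet> h)) (at x)" if "x \<in> S" for x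
    using G(1) G'(1) that
    by (auto intro!: derivative_eq_intros simp: inner_add_left algebra_simps)
  moreover have "((\<lambda>x. f x *\<^sub>R g' x + f' x *\<^sub>R g x) has_derivative ?H x) (at x)" if "x \<in> S" for x
    using G(1) G'(1) that by (auto intro!: derivative_eq_intros)
  moreover have "f x * l' x + f' x * l x + 2 * (g x \<bullet> g' x) = (\<Sum>b\<in>Basis. ?H x b \<bullet> b)" if "x \<in> S" for x
  proof -
    have "(\<Sum>b\<in>Basis. ?H x b \<bullet> b) = f x * (\<Sum>b\<in>Basis. G' x b \<bullet> b) + f' x * (\<Sum>b\<in>Basis. G x b \<bullet> b)
      + ((\<Sum>b\<in>Basis. (g x \<bullet> b) * (g' x \<bullet> b)) + (\<Sum>b\<in>Basis. (g x \<bullet> b) * (g' x \<bullet> b)))"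
      by (simp add: inner_add_left sum.distrib sum_distrib_left mult.commute)
    also have "(\<Sum>b\<in>Basis. (g x \<bullet> b) * (g' x \<bullet> b)) = g x \<bullet> g' x"
      by (rule euclidean_inner[symmetric])
    finally show ?thesis using G(1) G'(1) that by simp
  qed
  moreover have "continuous_on S (\<lambda>x. ?H x b \<bullet> b)" if "b \<in> Basis" for b
    unfolding inner_add_left inner_scaleR_left
    by (intro continuous_on_add continuous_on_mult continuous_on_inner[OF _ continuous_on_const] c
        G(2)[rule_format, OF that] G'(2)[rule_format, OF that])
  ultimately show ?thesis unfolding has_laplacian_def by (intro exI[of _ ?H]) blast
qed

lemma has_laplacian_compose:
  assumes "has_laplacian S f g l"
    and \<theta>: "\<And>x. x \<in> S \<Longrightarrow> (\<theta> has_real_derivative \<theta>1 (f x)) (at (f x))"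
      "\<And>x. x \<in> S \<Longrightarrow> (\<theta>1 has_real_derivative \<theta>2 (f x)) (at (f x))"
      "continuous_on (f ` S) \<theta>2"
  shows "has_laplacian S (\<lambda>x. \<theta> (f x)) (\<lambda>x. \<theta>1 (f x) *\<^sub>R g x)
    (\<lambda>x. \<theta>1 (f x) * l x + \<theta>2 (f x) * (norm (g x))\<^sup>2)"
proof -
  note c = has_laplacianD[OF assms(1)]
  obtain G where G: "\<forall>x\<in>S. (f has_derivative (\<lambda>h. g x \<bullet> h)) (at x) \<and> (g has_derivative G x) (at x) \<and>
      l x = (\<Sum>b\<in>Basis. G x b \<bullet> b)" "\<forall>b\<in>Basis. continuous_on S (\<lambda>x. G x b \<bullet> b)"
    using assms(1) unfolding has_laplacian_def by blast
  let ?H = "\<lambda>x h. \<theta>1 (f x) *\<^sub>R G x h + (\<theta>2 (f x) * (g x \<bullet> h)) *\<^sub>R g x"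
  have \<theta>2c: "continuous_on S (\<lambda>x. \<theta>2 (f x))"
    using continuous_on_compose[OF c(2) \<theta>(3)] by (simp add: o_def)
  have d1: "((\<lambda>x. \<theta>1 (f x)) has_derivative (\<lambda>h. \<theta>2 (f x) * (g x \<bullet> h))) (at x)" if "x \<in> S" for x
    using has_derivative_compose[OF c(1)[OF that] \<theta>(2)[OF that, unfolded has_field_derivative_def]] .
  have \<theta>1c: "continuous_on S (\<lambda>x. \<theta>1 (f x))"
    by (rule has_derivative_imp_continuous_on[OF d1])
  have "((\<lambda>x. \<theta> (f x)) has_derivative (\<lambda>h. (\<theta>1 (f x) *\<^sub>R g x) \<bullet> h)) (at x)" if "x \<in> S" for x
    using has_derivative_compose[OF c(1)[OF that] \<theta>(1)[OF that, unfolded has_field_derivative_def]]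
    by simp
  moreover have "((\<lambda>x. \<theta>1 (f x) *\<^sub>R g x) has_derivative ?H x) (at x)" if "x \<in> S" for x
    using G(1) d1[OF that] that by (auto intro!: derivative_eq_intros)
  moreover have "\<theta>1 (f x) * l x + \<theta>2 (f x) * (norm (g x))\<^sup>2 = (\<Sum>b\<in>Basis. ?H x b \<bullet> b)" if "x \<in> S" for x
  proof -
    have "(\<Sum>b\<in>Basis. ?H x b \<bullet> b) = \<theta>1 (f x) * (\<Sum>b\<in>Basis. G x b \<bullet> b)
      + \<theta>2 (f x) * (\<Sum>b\<in>Basis. (g x \<bullet> b) * (g x \<bullet> b))"
      by (simp add: inner_add_left sum.distrib sum_distrib_left mult.assoc)
    also have "(\<Sum>b\<in>Basis. (g x \<bullet> b) * (g x \<bullet> b)) = (norm (g x))\<^sup>2"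
      using euclidean_inner[of "g x" "g x"] by (simp add: power2_norm_eq_inner)
    finally show ?thesis using G(1) that by simp
  qed
  moreover have "continuous_on S (\<lambda>x. ?H x b \<bullet> b)" if "b \<in> Basis" for b
    unfolding inner_add_left inner_scaleR_left
    by (intro continuous_on_add continuous_on_mult continuous_on_inner[OF _ continuous_on_const] c
        \<theta>1c \<theta>2c G(2)[rule_format, OF that])
  ultimately show ?thesis unfolding has_laplacian_def by (intro exI[of _ ?H]) blast
qed

lemma has_laplacian_scale:
  assumes "has_laplacian S f g l"
  shows "has_laplacian {x. R *\<^sub>R x \<in> S} (\<lambda>x. c * f (R *\<^sub>R x)) (\<lambda>x. (c * R) *\<^sub>R g (R *\<^sub>R x))
    (\<lambda>x. c * R\<^sup>2 * l (R *\<^sub>R x))"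
proof -
  obtain G where G: "\<forall>x\<in>S. (f has_derivative (\<lambda>h. g x \<bullet> h)) (at x) \<and> (g has_derivative G x) (at x) \<and>
      l x = (\<Sum>b\<in>Basis. G x b \<bullet> b)" "\<forall>b\<in>Basis. continuous_on S (\<lambda>x. G x b \<bullet> b)"
    using assms(1) unfolding has_laplacian_def by blast
  let ?H = "\<lambda>x h. (c * R) *\<^sub>R G (R *\<^sub>R x) (R *\<^sub>R h)"
  have s: "((\<lambda>x. R *\<^sub>R x) has_derivative (\<lambda>h. R *\<^sub>R h)) (at x)" for x :: 'a
    by (auto intro!: derivative_eq_intros)
  have 1: "((\<lambda>x. c * f (R *\<^sub>R x)) has_derivative (\<lambda>h. ((c * R) *\<^sub>R g (R *\<^sub>R x)) \<bullet> h)) (at x)"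
    if "R *\<^sub>R x \<in> S" for x
    using has_derivative_mult_right[OF has_derivative_compose[OF s G(1)[rule_format, OF that, THEN conjunct1]], of c]
    by (simp add: mult.assoc)
  have 2: "((\<lambda>x. (c * R) *\<^sub>R g (R *\<^sub>R x)) has_derivative ?H x) (at x)" if "R *\<^sub>R x \<in> S" for x
    using has_derivative_scaleR_right[OF has_derivative_compose[OF s
      G(1)[rule_format, OF that, THEN conjunct2, THEN conjunct1]], of "c * R"] .
  have H: "?H x b \<bullet> b = c * R\<^sup>2 * (G (R *\<^sub>R x) b \<bullet> b)" if "R *\<^sub>R x \<in> S" for x b
  proof -
    have "linear (G (R *\<^sub>R x))"
      using G(1) that has_derivative_bounded_linear bounded_linear.linear by blast
    then show ?thesis by (simp add: linear_cmul power2_eq_square algebra_simps)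
  qed
  have cR: "continuous_on {x. R *\<^sub>R x \<in> S} (\<lambda>x. ?H x b \<bullet> b)" if  "b \<in> Basis" for b
  proof (rule continuous_on_eq)
    have "continuous_on {x. R *\<^sub>R x \<in> S} (\<lambda>x. G (R *\<^sub>R x) b \<bullet> b)"
      by (rule continuous_on_compose2[OF G(2)[rule_format, OF that]]) (auto intro!: continuous_intros)
    then show "continuous_on {x. R *\<^sub>R x \<in> S} (\<lambda>x. c * R\<^sup>2 * (G (R *\<^sub>R x) b \<bullet> b))"
      by (intro continuous_on_mult continuous_on_const)
  qed (use H in \<open>metis mem_Collect_eq\<close>)
  have "c * R\<^sup>2 * l (R *\<^sub>R x) = (\<Sum>b\<in>Basis. ?H x b \<bullet> b)" if "R *\<^sub>R x \<in> S" for x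
    using G(1) that by (simp only: H[OF that] sum_distrib_left)
  with 1 2 cR show ?thesis unfolding has_laplacian_def by (intro exI[of _ ?H]) blast
qed

lemma has_laplacian_norm_square:
  "has_laplacian UNIV (\<lambda>x. (norm (x - y))\<^sup>2) (\<lambda>x. 2 *\<^sub>R (x - y)) (\<lambda>_::'a::euclidean_space. 2 * real DIM('a))"
proof -
  have 1: "((\<lambda>x. (norm (x - y))\<^sup>2) has_derivative (\<lambda>h. (2 *\<^sub>R (x - y)) \<bullet> h)) (at x)" for x :: 'a
    unfolding power2_norm_eq_inner
    by (auto intro!: derivative_eq_intros simp: inner_commute algebra_simps)
  have 2: "((\<lambda>x. 2 *\<^sub>R (x - y)) has_derivative (\<lambda>h. 2 *\<^sub>R h)) (at x)" for x :: 'a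
    by (auto intro!: derivative_eq_intros)
  show ?thesis unfolding has_laplacian_def
    by (intro exI[of _ "\<lambda>x h. 2 *\<^sub>R h"] conjI ballI 1 2 continuous_on_const) simp
qed

lemma C2_on_has_laplacian:
  assumes S: "open S" and f: "C2_on S f"
  shows "has_laplacian S f (\<lambda>x. \<Sum>b\<in>Basis. partial_deriv b f x *\<^sub>R b) (laplacian f)"
proof -
  let ?g = "\<lambda>x. \<Sum>b\<in>Basis. partial_deriv b f x *\<^sub>R b"
  let ?G = "\<lambda>x h. \<Sum>b\<in>Basis. frechet_derivative (partial_deriv b f) (at x) h *\<^sub>R b"
  have fd: "(f has_derivative frechet_derivative f (at x)) (at x)" if "x \<in> S" for x
  proof -
    have "f differentiable (at x within S)" using f that by (simp add: C2_on_def differentiable_on_def)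
    then show ?thesis by (simp add: at_within_open[OF that S] frechet_derivative_works)
  qed
  have pd: "(partial_deriv b f has_derivative frechet_derivative (partial_deriv b f) (at x)) (at x)"
    if "x \<in> S" "b \<in> Basis" for x b
  proof -
    have "partial_deriv b f differentiable (at x within S)"
      using f that by (simp add: C2_on_def differentiable_on_def)
    then show ?thesis by (simp add: at_within_open[OF that(1) S] frechet_derivative_works)
  qed
  have "(f has_derivative (\<lambda>h. ?g x \<bullet> h)) (at x)" if "x \<in> S" for x
  proof -
    have lin: "linear (frechet_derivative f (at x))"
      using fd[OF that] has_derivative_bounded_linear bounded_linear.linear by blast
    have "frechet_derivative f (at x) h = ?g x \<bullet> h" for h
    proof -
      have "frechet_derivative f (at x) h = frechet_derivative f (at x) (\<Sum>b\<in>Basis. (h \<bullet> b) *\<^sub>R b)"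
        by (simp add: euclidean_representation)
      also have "\<dots> = (\<Sum>b\<in>Basis. (h \<bullet> b) * frechet_derivative f (at x) b)"
        using lin by (simp add: linear_sum linear_cmul)
      also have "\<dots> = ?g x \<bullet> h"
        unfolding inner_sum_left inner_scaleR_left partial_deriv_def
        by (intro sum.cong refl) (simp add: inner_commute mult.commute)
      finally show ?thesis .
    qed
    then have "frechet_derivative f (at x) = (\<lambda>h. ?g x \<bullet> h)" by auto
    then show ?thesis using fd[OF that] by simp
  qed
  moreover have "(?g has_derivative ?G x) (at x)" if "x \<in> S" for x
    using pd[OF that] by (intro has_derivative_sum has_derivative_scaleR_left)
  moreover have Gb: "?G x c \<bullet> c = partial_deriv c (partial_deriv c f) x" if "c \<in> Basis" for x c
    using that by (simp add: partial_deriv_def)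
  moreover have "laplacian f x = (\<Sum>c\<in>Basis. ?G x c \<bullet> c)" for x
    unfolding laplacian_def by (intro sum.cong) (simp_all add: Gb del: inner_sum_left_Basis)
  moreover have "continuous_on S (\<lambda>x. ?G x c \<bullet> c)" if "c \<in> Basis" for c
    using f that by (simp add: C2_on_def Gb del: inner_sum_left_Basis)
  ultimately show ?thesis unfolding has_laplacian_def by (intro exI[of _ ?G]) blast
qed

text \<open>The divergence theorem for the field \<open>F * g\<close>, with the component along
  \<open>b\<close> integrated in the direction \<open>b\<close>. \<open>F\<close> comes with a
  gradient only, since it will be a quotient by a supersolution or a product of powers; its support
  inside \<open>S\<close> permits extension by zero.\<close>

lemma green_identity:
  fixes F :: "'a::euclidean_space \<Rightarrow> real"
  assumes S: "open S" and w: "has_laplacian S w g l" and C: "compact C" "C \<subseteq> S"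
    and F: "\<And>x. x \<in> S \<Longrightarrow> (F has_derivative (\<lambda>h. F' x \<bullet> h)) (at x)" "continuous_on S F'"
      "\<And>x. x \<notin> C \<Longrightarrow> F x = 0" "\<And>x. x \<notin> C \<Longrightarrow> F' x = 0"
  shows "(\<integral>x. F' x \<bullet> g x + F x * l x \<partial>lborel) = 0"
proof -
  obtain G where G: "\<forall>x\<in>S. (w has_derivative (\<lambda>h. g x \<bullet> h)) (at x) \<and> (g has_derivative G x) (at x) \<and>
      l x = (\<Sum>b\<in>Basis. G x b \<bullet> b)" "\<forall>b\<in>Basis. continuous_on S (\<lambda>x. G x b \<bullet> b)"
    using w unfolding has_laplacian_def by blast
  have oC: "open (- C)" using C by (simp add: compact_imp_closed open_Compl)
  have Fc: "continuous_on S F"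
    by (rule has_derivative_imp_continuous_on[OF F(1)])
  let ?D = "\<lambda>x h b. (F' x \<bullet> h) * (g x \<bullet> b) + F x * (G x h \<bullet> b)"
  let ?D' = "\<lambda>x h b. if x \<in> C then ?D x h b else 0"
  have D0: "?D x h b = ?D' x h b" for x h b using F(3,4) by auto
  have der: "((\<lambda>x. F x * (g x \<bullet> b)) has_derivative (\<lambda>h. ?D' x h b)) (at x)" for x b
  proof (cases "x \<in> S")
    case True
    show ?thesis unfolding D0[symmetric]
      by (rule derivative_eq_intros F(1)[OF True] G(1)[rule_format, OF True, THEN conjunct2, THEN conjunct1] refl)+
        (simp add: algebra_simps)
  next
    case False
    then have x: "x \<notin> C" using C by auto
    have "((\<lambda>x. F x * (g x \<bullet> b)) has_derivative (\<lambda>h. 0)) (at x)"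
      by (rule has_derivative_transform_within_open[OF has_derivative_const[of 0] oC])
        (use x F(3) in auto)
    then show ?thesis using x by simp
  qed
  have cont: "continuous_on UNIV (\<lambda>x. ?D' x b b)" if "b \<in> Basis" for b
  proof (rule continuous_on_UNIV_support[OF S C])
    show "continuous_on S (\<lambda>x. ?D' x b b)" unfolding D0[symmetric]
      by (intro continuous_on_add continuous_on_mult continuous_on_inner[OF _ continuous_on_const]
          F(2) Fc has_laplacianD[OF w] G(2)[rule_format, OF that])
  qed auto
  have 1: "(\<integral>x. ?D' x b b \<partial>lborel) = 0" if "b \<in> Basis" for b
    by (rule integral_directional_derivative[where D = "\<lambda>x h. ?D' x h b" and w = b, OF der cont[OF that] C(1)]) (simp add: F(3))
  have "F' x \<bullet> g x + F x * l x = (\<Sum>b\<in>Basis. ?D' x b b)" for x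
  proof (cases "x \<in> C")
    case True
    then have xS: "x \<in> S" using C by auto
    have "(\<Sum>b\<in>Basis. ?D x b b) = (\<Sum>b\<in>Basis. (F' x \<bullet> b) * (g x \<bullet> b)) + F x * (\<Sum>b\<in>Basis. G x b \<bullet> b)"
      by (simp add: sum.distrib sum_distrib_left)
    also have "\<dots> = F' x \<bullet> g x + F x * l x"
      using G(1) xS by (simp add: euclidean_inner[symmetric])
    finally show ?thesis using True by simp
  qed (simp add: F)
  then have "(\<integral>x. F' x \<bullet> g x + F x * l x \<partial>lborel) = (\<integral>x. (\<Sum>b\<in>Basis. ?D' x b b) \<partial>lborel)"
    by (simp only:)
  also have "\<dots> = (\<Sum>b\<in>Basis. \<integral>x. ?D' x b b \<partial>lborel)"
    by (intro Bochner_Integration.integral_sum integrable_compact_support[OF cont C(1)]) auto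
  also have "\<dots> = 0" using 1 by simp
  finally show ?thesis .
qed

subsection \<open>Maximum principles\<close>

text \<open>If a diagonal entry of the Hessian were positive, the derivative along that axis, which
  vanishes at the maximum, would be positive just after it, and the mean value theorem would produce
  a larger value.\<close>

lemma laplacian_nonpos_at_max:
  fixes f :: "'a::euclidean_space \<Rightarrow> real"
  assumes S: "open S" and f: "has_laplacian S f g l" and x: "x \<in> S" "\<And>y. y \<in> S \<Longrightarrow> f y \<le> f x"
  shows "l x \<le> 0"
proof -
  obtain G where G: "\<forall>x\<in>S. (f has_derivative (\<lambda>h. g x \<bullet> h)) (at x) \<and> (g has_derivative G x) (at x) \<and>
      l x = (\<Sum>b\<in>Basis. G x b \<bullet> b)"
    using f unfolding has_laplacian_def by blast
  obtain r where r: "r > 0" "ball x r \<subseteq> S" using S x(1) openE by blast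
  have "G x b \<bullet> b \<le> 0" if b: "b \<in> Basis" for b
  proof (rule ccontr)
    assume neg: "\<not> G x b \<bullet> b \<le> 0"
    have inS: "x + t *\<^sub>R b \<in> S" if "\<bar>t\<bar> < r" for t
      using that b r(2) by (auto simp: dist_norm subset_iff)
    define \<gamma> where "\<gamma> t = f (x + t *\<^sub>R b)" for t
    define \<gamma>' where "\<gamma>' t = g (x + t *\<^sub>R b) \<bullet> b" for t
    have d1: "(\<gamma> has_real_derivative \<gamma>' t) (at t)" if "\<bar>t\<bar> < r" for t
      unfolding \<gamma>_def \<gamma>'_def
      by (rule has_real_derivative_along_line) (use G inS[OF that] in auto)
    have "((\<lambda>y. g y \<bullet> b) has_derivative (\<lambda>h. G x h \<bullet> b)) (at x)"
      using G x(1) by (auto intro!: derivative_eq_intros)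
    then have d2: "(\<gamma>' has_real_derivative G x b \<bullet> b) (at 0)"
      unfolding \<gamma>'_def using has_real_derivative_along_line[of "\<lambda>y. g y \<bullet> b" "\<lambda>h. G x h \<bullet> b" x 0 b] by simp
    have "\<gamma>' 0 = 0"
      by (rule DERIV_local_max[OF d1 r(1)]) (use r x inS in \<open>auto simp: \<gamma>_def\<close>)
    then obtain d where d: "d > 0" "\<And>h. 0 < h \<Longrightarrow> h < d \<Longrightarrow> \<gamma>' h > 0"
      using DERIV_pos_inc_right[OF d2] neg by auto
    define t where "t = min d r / 2"
    have t: "t > 0" "t < d" "t < r" using d(1) r(1) by (auto simp: t_def min_def)
    have "\<exists>z. z > 0 \<and> z < t \<and> \<gamma> t - \<gamma> 0 = (t - 0) * \<gamma>' z"
      by (rule MVT2) (use t d1 in auto)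
    then obtain z where "0 < z" "z < t" "\<gamma> t - \<gamma> 0 = t * \<gamma>' z" by auto
    moreover have "\<gamma>' z > 0" using d(2) t calculation by auto
    ultimately have "\<gamma> t > \<gamma> 0" using t by (smt (verit) mult_pos_pos)
    then show False using x(2)[OF inS[of t]] t by (simp add: \<gamma>_def)
  qed
  then show ?thesis using G x(1) by (simp add: sum_nonpos)
qed

text \<open>The Keller--Osserman estimate: maximise \<open>(R\<^sup>2 - \<bar>x - x\<^sub>0\<bar>\<^sup>2)\<^sup>\<gamma> w\<close> over a ball
  and let \<open>R\<close> tend to infinity.\<close>
lemma keller_osserman:
  fixes w :: "'a::euclidean_space \<Rightarrow> real"
  assumes w: "has_laplacian UNIV w g l" and c: "c > 0" and e: "e > 0"
    and sub: "\<And>x. w x > 0 \<Longrightarrow> c * w x powr (1 + e) \<le> l x"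
  shows "w x0 \<le> 0"
proof (rule ccontr)
  assume "\<not> w x0 \<le> 0"
  then have w0: "w x0 > 0" by simp
  \<comment> \<open>With \<open>\<gamma> * e = 2\<close> the exponents
    \<open>\<gamma> * (1 + e)\<close> and \<open>\<gamma> + 2\<close> agree, so the powers of
    \<open>\<xi>\<close> cancel at the maximum point.\<close>
  define \<gamma> where "\<gamma> = 2 / e"
  have \<gamma>: "\<gamma> > 0" "\<gamma> * e = 2" using e by (auto simp: \<gamma>_def)
  \<comment> \<open>On the ball, \<open>B * R^2 * \<xi> powr (- \<gamma> - 2)\<close> bounds the
    Laplacian of \<open>\<xi> powr (- \<gamma>)\<close>. The first summand comes from the Laplacian
    of the squared norm, the second from its squared gradient.\<close>
  define B where "B = \<gamma> * (2 * real DIM('a) + 4 * (\<gamma> + 1))"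
  have B: "B > 0" using \<gamma> by (simp add: B_def add_nonneg_pos)
  have bound: "R\<^sup>2 * w x0 powr e \<le> B / c" if R: "R > 0" for R
  proof -
    define \<xi> where "\<xi> x = R\<^sup>2 - (norm (x - x0))\<^sup>2" for x
    define P where "P x = \<xi> x powr \<gamma> * w x" for x
    have \<xi>_nonneg: "\<xi> x \<ge> 0" if "x \<in> cball x0 R" for x
      using that R by (simp add: \<xi>_def dist_norm norm_minus_commute power_mono)
    have "continuous_on (cball x0 R) P" unfolding P_def
    proof (intro continuous_on_mult continuous_on_powr')
      show "continuous_on (cball x0 R) \<xi>" unfolding \<xi>_def by (intro continuous_intros)
      show "continuous_on (cball x0 R) w"
        using has_laplacianD(2)[OF w] continuous_on_subset by blast
    qed (use \<gamma> \<xi>_nonneg in auto)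
    then obtain x1 where x1: "x1 \<in> cball x0 R" "\<And>y. y \<in> cball x0 R \<Longrightarrow> P y \<le> P x1"
      using continuous_attains_sup[of "cball x0 R" P] R by (auto simp: less_imp_le)
    have \<xi>0: "\<xi> x0 = R\<^sup>2" by (simp add: \<xi>_def)
    have "P x0 > 0" using w0 R by (simp add: P_def \<xi>0)
    then have P1: "P x1 > 0" using x1(2)[of x0] R by simp
    then have \<xi>1: "\<xi> x1 > 0" using \<xi>_nonneg[OF x1(1)] by (cases "\<xi> x1 = 0") (auto simp: P_def)
    then have w1: "w x1 > 0" using P1 by (simp add: P_def zero_less_mult_iff)
    define S where "S = ball x0 R"
    have \<xi>S: "\<xi> y > 0" if "y \<in> S" for y
      using that R by (simp add: \<xi>_def S_def dist_norm norm_minus_commute power_strict_mono)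
    have x1S: "x1 \<in> S"
      using \<xi>1 R unfolding \<xi>_def S_def by (simp add: dist_norm norm_minus_commute) (metis less_imp_le power2_less_imp_less)
    \<comment> \<open>Maximality of \<open>P\<close> at \<open>x1\<close> means that
      \<open>P x1 * \<xi> powr (- \<gamma>)\<close> touches \<open>w\<close> from above at
      \<open>x1\<close>. \<open>\<theta>\<close> is minus this barrier, as a function of the squared
      distance.\<close>
    define \<theta> \<theta>1 \<theta>2 where "\<theta> t = - P x1 * (R\<^sup>2 - t) powr (-\<gamma>)"
      and "\<theta>1 t = - P x1 * \<gamma> * (R\<^sup>2 - t) powr (-\<gamma>-1)"
      and "\<theta>2 t = - P x1 * \<gamma> * (\<gamma> + 1) * (R\<^sup>2 - t) powr (-\<gamma>-2)" for t
    have dom: "R\<^sup>2 - (norm (y - x0))\<^sup>2 > 0" if "y \<in> S" for y using \<xi>S[OF that] by (simp add: \<xi>_def)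
    have L: "has_laplacian S (\<lambda>x. \<theta> ((norm (x - x0))\<^sup>2)) (\<lambda>x. \<theta>1 ((norm (x - x0))\<^sup>2) *\<^sub>R (2 *\<^sub>R (x - x0)))
        (\<lambda>x. \<theta>1 ((norm (x - x0))\<^sup>2) * (2 * real DIM('a)) + \<theta>2 ((norm (x - x0))\<^sup>2) * (norm (2 *\<^sub>R (x - x0)))\<^sup>2)"
    proof (rule has_laplacian_compose[OF has_laplacian_subset[OF has_laplacian_norm_square]])
      fix x assume "x \<in> S"
      show "(\<theta> has_real_derivative \<theta>1 ((norm (x - x0))\<^sup>2)) (at ((norm (x - x0))\<^sup>2))"
        unfolding \<theta>_def \<theta>1_def by (rule derivative_eq_intros refl dom[OF \<open>x \<in> S\<close>])+ simp
      show "(\<theta>1 has_real_derivative \<theta>2 ((norm (x - x0))\<^sup>2)) (at ((norm (x - x0))\<^sup>2))"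
        unfolding \<theta>2_def \<theta>1_def by (rule derivative_eq_intros refl dom[OF \<open>x \<in> S\<close>])+ (simp add: algebra_simps)
    next
      show "continuous_on ((\<lambda>x. (norm (x - x0))\<^sup>2) ` S) \<theta>2"
        unfolding \<theta>2_def by (intro continuous_intros) (use dom in force)
    qed simp
    have "l x1 + (\<theta>1 ((norm (x1 - x0))\<^sup>2) * (2 * real DIM('a)) + \<theta>2 ((norm (x1 - x0))\<^sup>2) * (norm (2 *\<^sub>R (x1 - x0)))\<^sup>2) \<le> 0"
    proof (rule laplacian_nonpos_at_max[OF _ has_laplacian_add[OF has_laplacian_subset[OF w] L] x1S])
      fix y assume y: "y \<in> S"
      have "P y \<le> P x1" using x1(2) y by (simp add: S_def)
      then have "w y \<le> P x1 * \<xi> y powr (-\<gamma>)"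
        using \<xi>S[OF y] by (simp add: P_def powr_minus field_simps)
      moreover have "w x1 = P x1 * \<xi> x1 powr (-\<gamma>)"
        using \<xi>1 by (simp add: P_def powr_minus field_simps)
      ultimately show "w y + \<theta> ((norm (y - x0))\<^sup>2) \<le> w x1 + \<theta> ((norm (x1 - x0))\<^sup>2)"
        by (simp add: \<theta>_def \<xi>_def)
    qed (auto simp: S_def)
    then have "l x1 \<le> P x1 * \<gamma> * \<xi> x1 powr (-\<gamma>-1) * (2 * real DIM('a))
        + P x1 * \<gamma> * (\<gamma> + 1) * \<xi> x1 powr (-\<gamma>-2) * (4 * (norm (x1 - x0))\<^sup>2)"
      by (simp add: \<theta>1_def \<theta>2_def \<xi>_def power_mult_distrib)
    also have "\<xi> x1 powr (-\<gamma>-1) = \<xi> x1 powr (-\<gamma>-2) * \<xi> x1"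
    proof -
      have "-\<gamma>-1 = (-\<gamma>-2) + 1" by simp
      then show ?thesis using \<xi>1 by (simp only: powr_add) simp
    qed
    also have "P x1 * \<gamma> * (\<xi> x1 powr (-\<gamma>-2) * \<xi> x1) * (2 * real DIM('a))
        + P x1 * \<gamma> * (\<gamma> + 1) * \<xi> x1 powr (-\<gamma>-2) * (4 * (norm (x1 - x0))\<^sup>2)
      = P x1 * \<gamma> * \<xi> x1 powr (-\<gamma>-2) * (2 * real DIM('a) * \<xi> x1 + 4 * (\<gamma> + 1) * (norm (x1 - x0))\<^sup>2)"
      by (simp add: algebra_simps)
    also have "\<dots> \<le> P x1 * \<gamma> * \<xi> x1 powr (-\<gamma>-2) * (2 * real DIM('a) * R\<^sup>2 + 4 * (\<gamma> + 1) * R\<^sup>2)"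
    proof (intro mult_left_mono add_mono)
      have "(norm (x1 - x0))\<^sup>2 \<le> R\<^sup>2" using \<xi>1 by (simp add: \<xi>_def)
      then show "(norm (x1 - x0))\<^sup>2 \<le> R\<^sup>2" .
    qed (use P1 \<gamma> \<xi>1 in \<open>auto simp: \<xi>_def\<close>)
    also have "\<dots> = P x1 * \<xi> x1 powr (-\<gamma>-2) * (B * R\<^sup>2)"
      by (simp add: B_def algebra_simps)
    finally have le: "c * w x1 powr (1 + e) \<le> P x1 * \<xi> x1 powr (-\<gamma>-2) * (B * R\<^sup>2)"
      using sub[OF w1] by linarith
    have "w x1 = P x1 * \<xi> x1 powr (-\<gamma>)" using \<xi>1 by (simp add: P_def powr_minus field_simps)
    then have "w x1 powr (1 + e) = P x1 powr (1 + e) * \<xi> x1 powr (-\<gamma> * (1 + e))"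
      using P1 by (simp add: powr_mult powr_powr)
    also have "-\<gamma> * (1 + e) = -\<gamma> - 2" using \<gamma> by (simp add: algebra_simps)
    also have "P x1 powr (1 + e) = P x1 * P x1 powr e" using P1 by (simp add: powr_add)
    finally have "c * (P x1 * P x1 powr e * \<xi> x1 powr (-\<gamma>-2)) \<le> P x1 * \<xi> x1 powr (-\<gamma>-2) * (B * R\<^sup>2)"
      using le by simp
    then have "(P x1 * \<xi> x1 powr (-\<gamma>-2)) * (c * P x1 powr e) \<le> (P x1 * \<xi> x1 powr (-\<gamma>-2)) * (B * R\<^sup>2)"
      by (simp add: algebra_simps)
    then have le2: "c * P x1 powr e \<le> B * R\<^sup>2"
      by (rule mult_left_le_imp_le) (use P1 \<xi>1 in auto)
    have "P x0 powr e \<le> P x1 powr e"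
      using x1(2)[of x0] R e \<open>P x0 > 0\<close> by (intro powr_mono2) auto
    moreover have "P x0 powr e = (R\<^sup>2) powr (\<gamma> * e) * w x0 powr e"
      using R w0 by (simp add: P_def \<xi>0 powr_mult powr_powr)
    moreover have "(R\<^sup>2) powr (\<gamma> * e) = R\<^sup>2 * R\<^sup>2"
      using R by (simp add: \<gamma>(2) power2_eq_square)
    ultimately have "c * (R\<^sup>2 * R\<^sup>2 * w x0 powr e) \<le> B * R\<^sup>2"
      using le2 c by (smt (verit) mult_left_mono)
    then have "R\<^sup>2 * (c * (R\<^sup>2 * w x0 powr e)) \<le> R\<^sup>2 * B" by (simp add: algebra_simps)
    then have "c * (R\<^sup>2 * w x0 powr e) \<le> B"
      by (rule mult_left_le_imp_le) (use R in auto)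
    then show ?thesis using c by (simp add: field_simps)
  qed
  define R where "R = sqrt ((B / c + 1) / w x0 powr e)"
  have "R\<^sup>2 * w x0 powr e = B / c + 1" "R > 0"
    using B c w0 by (auto simp: R_def add_pos_pos)
  then show False using bound[of R] by simp
qed

text \<open>Comparison with a barrier on a shell around a ball on which \<open>f\<close> exceeds
  \<open>m\<close>. The barrier is at most \<open>m\<close> on the inner sphere, zero on the outer
  one and strictly subharmonic in between, so its difference with \<open>f\<close> has no positive
  maximum; at \<open>x\<close> the barrier is positive.\<close>

lemma superharmonic_pos:
  fixes f :: "'a::euclidean_space \<Rightarrow> real"
  assumes f: "has_laplacian UNIV f g l" and nonneg: "\<And>x. f x \<ge> 0" and sup: "\<And>x. l x \<le> 0"
    and pos: "f x1 > 0"
  shows "f x > 0"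
proof -
  have fc: "continuous_on UNIV f" by (rule has_laplacianD[OF f])
  define m where "m = f x1 / 2"
  have m: "m > 0" using pos by (simp add: m_def)
  have "open (f -` {m<..})" using fc by (simp add: open_vimage)
  moreover have "x1 \<in> f -` {m<..}" using pos by (simp add: m_def)
  ultimately obtain r where r: "r > 0" "cball x1 r \<subseteq> f -` {m<..}"
    using open_contains_cball by blast
  show ?thesis
  proof (cases "norm (x - x1) \<le> r")
    case True
    then have "x \<in> cball x1 r" by (simp add: dist_norm norm_minus_commute)
    then have "x \<in> f -` {m<..}" using r by blast
    then show ?thesis using m by simp
  next
    case False
    define n where "n = real DIM('a)"
    have n: "n > 0" by (simp add: n_def)
    define R where "R = norm (x - x1) + 1"
    have R: "R > r" "R > 0" using False r by (auto simp: R_def)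
    define \<kappa> where "\<kappa> = m * (r\<^sup>2) powr n"
    have \<kappa>: "\<kappa> > 0" using m r by (simp add: \<kappa>_def)
    \<comment> \<open>\<open>t\<close> is the squared distance and \<open>n\<close> the dimension.
      The power \<open>t powr (- n)\<close> decays faster than the fundamental solution; its
      Laplacian is \<open>n * (2 * n + 4) * t powr (- n - 1)\<close>, hence strictly
      positive.\<close>
    define \<theta> \<theta>1 \<theta>2 where "\<theta> t = \<kappa> * (t powr (-n) - (R\<^sup>2) powr (-n))"
      and "\<theta>1 t = - \<kappa> * n * t powr (-n-1)" and "\<theta>2 t = \<kappa> * n * (n + 1) * t powr (-n-2)" for t
    define N where "N y = (norm (y - x1))\<^sup>2" for y
    define S where "S = ball x1 R - cball x1 r"
    have S: "open S" by (simp add: S_def open_Diff)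
    have NS: "N y > 0" if "y \<in> S" for y
      using that r by (auto simp: N_def S_def)
    have L: "has_laplacian S (\<lambda>y. \<theta> (N y)) (\<lambda>y. \<theta>1 (N y) *\<^sub>R (2 *\<^sub>R (y - x1)))
        (\<lambda>y. \<theta>1 (N y) * (2 * n) + \<theta>2 (N y) * (norm (2 *\<^sub>R (y - x1)))\<^sup>2)"
      unfolding N_def n_def
    proof (rule has_laplacian_compose[OF has_laplacian_subset[OF has_laplacian_norm_square]])
      fix x assume "x \<in> S"
      then have dom: "(norm (x - x1))\<^sup>2 > 0" using NS by (auto simp: N_def)
      show "(\<theta> has_real_derivative \<theta>1 ((norm (x - x1))\<^sup>2)) (at ((norm (x - x1))\<^sup>2))"
        unfolding \<theta>_def \<theta>1_def by (rule derivative_eq_intros refl dom)+ simp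
      show "(\<theta>1 has_real_derivative \<theta>2 ((norm (x - x1))\<^sup>2)) (at ((norm (x - x1))\<^sup>2))"
        unfolding \<theta>2_def \<theta>1_def by (rule derivative_eq_intros refl dom)+ (simp add: algebra_simps)
    next
      show "continuous_on ((\<lambda>x. (norm (x - x1))\<^sup>2) ` S) \<theta>2"
        unfolding \<theta>2_def by (intro continuous_intros) (use NS in \<open>force simp: N_def\<close>)
    qed simp
    define A where "A = cball x1 R - ball x1 r"
    have A: "compact A" by (simp add: A_def compact_diff)
    have xA: "x \<in> A" using False by (auto simp: A_def R_def dist_norm norm_minus_commute)
    have "continuous_on A (\<lambda>y. \<theta> (N y) - f y)"
    proof (intro continuous_on_diff continuous_on_subset[OF fc])
      have "N y \<noteq> 0" if "y \<in> A" for y using that r by (auto simp: A_def N_def)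
      then show "continuous_on A (\<lambda>y. \<theta> (N y))"
        unfolding \<theta>_def N_def by (intro continuous_intros) (auto simp: N_def)
    qed auto
    then obtain y where y: "y \<in> A" "\<And>z. z \<in> A \<Longrightarrow> \<theta> (N z) - f z \<le> \<theta> (N y) - f y"
      using continuous_attains_sup[OF A] xA by blast
    have "\<theta> (N y) - f y \<le> 0"
    proof (rule ccontr)
      assume c: "\<not> \<theta> (N y) - f y \<le> 0"
      have "norm (y - x1) \<noteq> R" using c nonneg[of y] by (auto simp: \<theta>_def N_def)
      moreover have "norm (y - x1) \<noteq> r"
      proof
        assume eq: "norm (y - x1) = r"
        then have "y \<in> cball x1 r" by (simp add: dist_norm norm_minus_commute)
        then have "f y > m" using r by auto
        moreover have "\<theta> (N y) \<le> m"
        proof -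
          have "\<theta> (N y) = m - \<kappa> * (R\<^sup>2) powr (-n)"
            using r eq by (simp add: \<theta>_def N_def \<kappa>_def powr_minus algebra_simps)
          then show ?thesis using \<kappa> by simp
        qed
        ultimately show False using c by simp
      qed
      ultimately have yS: "y \<in> S" using y(1) by (auto simp: A_def S_def dist_norm norm_minus_commute)
      have "has_laplacian S (\<lambda>y. -1 * f (1 *\<^sub>R y)) (\<lambda>y. (-1 * 1) *\<^sub>R g (1 *\<^sub>R y)) (\<lambda>y. -1 * 1\<^sup>2 * l (1 *\<^sub>R y))"
        by (rule has_laplacian_subset[OF has_laplacian_scale[OF f]]) simp
      from has_laplacian_add[OF L this]
      have "\<theta>1 (N y) * (2 * n) + \<theta>2 (N y) * (norm (2 *\<^sub>R (y - x1)))\<^sup>2 + -1 * 1\<^sup>2 * l (1 *\<^sub>R y) \<le> 0"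
        by (rule laplacian_nonpos_at_max[OF S _ yS]) (use y(2) in \<open>auto simp: A_def S_def\<close>)
      then have "\<theta>1 (N y) * (2 * n) + \<theta>2 (N y) * (4 * N y) \<le> l y"
        by (simp add: N_def power_mult_distrib)
      also have "\<dots> \<le> 0" by (rule sup)
      also have "N y powr (-n-1) = N y powr (-n-2) * N y"
      proof -
        have "-n-1 = (-n-2) + 1" by simp
        then show ?thesis using NS[OF yS] by (simp only: powr_add) simp
      qed
      then have "\<theta>1 (N y) * (2 * n) + \<theta>2 (N y) * (4 * N y) = \<kappa> * n * (N y powr (-n-2) * N y) * (2 * n + 4)"
        by (simp add: \<theta>1_def \<theta>2_def algebra_simps)
      moreover have "\<dots> > 0" using \<kappa> n NS[OF yS] by (intro mult_pos_pos) auto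
      ultimately show False by linarith
    qed
    with y(2)[OF xA] have "f x \<ge> \<theta> (N x)" by linarith
    moreover have "\<theta> (N x) > 0"
    proof -
      have "N x > 0" "N x < R\<^sup>2" using False r by (auto simp: N_def R_def power_strict_mono)
      then have "(R\<^sup>2) powr (-n) < N x powr (-n)" using n by (intro powr_less_mono2_neg) auto
      then show ?thesis using \<kappa> by (simp add: \<theta>_def)
    qed
    ultimately show ?thesis by linarith
  qed
qed

text \<open>Souplet's comparison of the components: \<open>v - C (u + \<epsilon>)\<^sup>\<sigma>\<close> is a subsolution
  of \<open>\<Delta>w = c w\<^sup>1\<^sup>+\<^sup>e\<close> where it is positive.\<close>
lemma lane_emden_comparison:
  fixes u v :: "'a::euclidean_space \<Rightarrow> real"
  assumes pq: "p \<ge> q" "q > 0" "p * q > 1"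
    and u: "has_laplacian UNIV u gu (\<lambda>x. - (v x powr p))" and v: "has_laplacian UNIV v gv (\<lambda>x. - (u x powr q))"
    and nonneg: "\<And>x. u x \<ge> 0" "\<And>x. v x \<ge> 0"
    and \<sigma>: "\<sigma> = (q + 1) / (p + 1)"
  shows "v x \<le> \<sigma> powr (- 1 / (p + 1)) * u x powr \<sigma>"
proof -
  define C where "C = \<sigma> powr (- 1 / (p + 1))"
  have p0: "p > 0" using pq by simp
  have p1: "p > 1"
  proof (rule ccontr)
    assume "\<not> p > 1"
    then have "p * q \<le> 1 * 1" using pq by (intro mult_mono) auto
    then show False using pq by simp
  qed
  \<comment> \<open>Here \<open>p \<ge> q\<close> enters: \<open>\<sigma> \<le> 1\<close> makes
    \<open>powr \<sigma>\<close> concave, which gives the gradient term its favourable sign, and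
    makes \<open>powr (\<sigma> - 1)\<close> decreasing.\<close>
  have s: "0 < \<sigma>" "\<sigma> \<le> 1" using pq p0 by (auto simp: \<sigma> divide_simps)
  have C: "C > 0" using s by (simp add: C_def)
  have sp: "q + 1 = \<sigma> * (p + 1)" using p0 by (simp add: \<sigma>)
  \<comment> \<open>If \<open>U\<close> is replaced by a multiple of
    \<open>v powr (1 / \<sigma>)\<close>, then \<open>U powr (\<sigma> - 1) * v powr (p - 1)\<close>
    becomes a multiple of \<open>v powr e\<close>. Positivity of \<open>e\<close> amounts to
    \<open>p * q > 1\<close>.\<close>
  define e where "e = p - 1 / \<sigma>"
  have e: "e > 0"
    using pq p0 by (simp add: e_def \<sigma> field_simps)
  \<comment> \<open>This normalisation determines \<open>C\<close>. For
    \<open>z = C * U powr \<sigma>\<close> it gives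
    \<open>U powr q = C * \<sigma> * U powr (\<sigma> - 1) * z powr p\<close>, so the two source
    terms balance when \<open>v\<close> equals \<open>z\<close>.\<close>
  have Cs: "C * \<sigma> * C powr p = 1"
  proof -
    have "C powr (p + 1) = \<sigma> powr (-1)" using p0 by (simp add: C_def powr_powr)
    then have "C powr (p + 1) = 1 / \<sigma>" using s by (simp add: powr_minus divide_simps)
    moreover have "C powr (p + 1) = C powr p * C" using C by (simp add: powr_add)
    ultimately show ?thesis using s by (simp add: field_simps)
  qed
  define c where "c = C * \<sigma> * (1 / C) powr ((\<sigma> - 1) / \<sigma>)"
  have c: "c > 0" using C s by (simp add: c_def)
  \<comment> \<open>The shift keeps the power twice differentiable at zeros of \<open>u\<close>; it
    is removed by a limit at the end.\<close>
  have le: "v x \<le> C * (u x + \<epsilon>) powr \<sigma>" if \<epsilon>: "\<epsilon> > 0" for \<epsilon> x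
  proof -
    define \<theta> \<theta>1 \<theta>2 where "\<theta> t = - C * (t + \<epsilon>) powr \<sigma>" and "\<theta>1 t = - C * \<sigma> * (t + \<epsilon>) powr (\<sigma> - 1)"
      and "\<theta>2 t = - C * \<sigma> * (\<sigma> - 1) * (t + \<epsilon>) powr (\<sigma> - 2)" for t
    have U: "u x + \<epsilon> > 0" for x using nonneg(1)[of x] \<epsilon> by simp
    have L: "has_laplacian UNIV (\<lambda>x. \<theta> (u x)) (\<lambda>x. \<theta>1 (u x) *\<^sub>R gu x)
        (\<lambda>x. \<theta>1 (u x) * (- (v x powr p)) + \<theta>2 (u x) * (norm (gu x))\<^sup>2)"
    proof (rule has_laplacian_compose[OF u])
      show "(\<theta> has_real_derivative \<theta>1 (u x)) (at (u x))" for x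
        unfolding \<theta>_def \<theta>1_def by (rule derivative_eq_intros refl U)+ simp
      show "(\<theta>1 has_real_derivative \<theta>2 (u x)) (at (u x))" for x
        unfolding \<theta>2_def \<theta>1_def by (rule derivative_eq_intros refl U)+ (simp add: algebra_simps)
      show "continuous_on (range u) \<theta>2"
        unfolding \<theta>2_def by (intro continuous_intros) (metis U imageE less_irrefl)
    qed
    have "v x + \<theta> (u x) \<le> 0"
    proof (rule keller_osserman[OF has_laplacian_add[OF v L] c e])
      fix x assume w: "0 < v x + \<theta> (u x)"
      define U where "U = u x + \<epsilon>"
      define z where "z = C * U powr \<sigma>"
      have U0: "U > 0" "u x \<le> U" using nonneg(1)[of x] \<epsilon> by (auto simp: U_def)
      have z: "0 < z" "z < v x" using w C U0 by (auto simp: z_def \<theta>_def U_def)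
      have "u x powr q \<le> U powr q" using U0 nonneg(1) pq by (intro powr_mono2) auto
      also have "\<dots> = U powr (\<sigma> - 1) * U powr (\<sigma> * p)"
      proof -
        have "q = (\<sigma> - 1) + \<sigma> * p" using sp by (simp add: algebra_simps)
        then show ?thesis by (metis powr_add)
      qed
      also have "U powr (\<sigma> * p) = C * \<sigma> * C powr p * U powr (\<sigma> * p)" using Cs by simp
      also have "\<dots> = C * \<sigma> * z powr p"
        using C U0 by (simp add: z_def powr_mult powr_powr)
      finally have 1: "u x powr q \<le> U powr (\<sigma> - 1) * (C * \<sigma> * z powr p)" .
      have "z powr p = z powr (p - 1) * z" using z powr_add[of z "p - 1" 1] by simp
      also have "\<dots> \<le> v x powr (p - 1) * z"
        using z p1 by (intro mult_right_mono powr_mono2) auto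
      finally have 2: "v x powr (p - 1) * (v x - z) \<le> v x powr p - z powr p"
        using z powr_add[of "v x" "p - 1" 1] by (simp add: algebra_simps)
      \<comment> \<open>The region \<open>v > z\<close> is used here: it bounds \<open>U\<close> by
        a power of \<open>v\<close>, and the negative or zero exponent \<open>\<sigma> - 1\<close>
        turns that into a lower bound for the coefficient.\<close>
      have U1: "U \<le> (v x / C) powr (1 / \<sigma>)"
      proof -
        have "U = (z / C) powr (1 / \<sigma>)" using C U0 s by (simp add: z_def powr_powr)
        also have "\<dots> \<le> (v x / C) powr (1 / \<sigma>)"
          using z C s by (intro powr_mono2 divide_right_mono) auto
        finally show ?thesis .
      qed
      have "(v x / C) powr ((\<sigma> - 1) / \<sigma>) = ((v x / C) powr (1 / \<sigma>)) powr (\<sigma> - 1)"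
        by (simp add: powr_powr)
      also have "\<dots> \<le> U powr (\<sigma> - 1)" using U1 U0 s by (intro powr_mono2') auto
      finally have 3: "(1 / C) powr ((\<sigma> - 1) / \<sigma>) * v x powr ((\<sigma> - 1) / \<sigma>) \<le> U powr (\<sigma> - 1)"
        using z C by (simp add: powr_mult[symmetric])
      define w where "w = v x - z"
      have w0: "0 < w" "w \<le> v x" using z by (auto simp: w_def)
      have "c * w powr (1 + e) = c * (w powr e * w)" using w0 by (simp add: powr_add)
      also have "\<dots> \<le> c * (v x powr e * w)"
        using w0 c e by (intro mult_left_mono mult_right_mono powr_mono2) auto
      also have "v x powr e = v x powr ((\<sigma> - 1) / \<sigma>) * v x powr (p - 1)"
        using s by (simp add: e_def powr_add[symmetric] field_simps)
      also have "c * (v x powr ((\<sigma> - 1) / \<sigma>) * v x powr (p - 1) * w)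
          = C * \<sigma> * ((1 / C) powr ((\<sigma> - 1) / \<sigma>) * v x powr ((\<sigma> - 1) / \<sigma>)) * (v x powr (p - 1) * w)"
        by (simp add: c_def)
      also have "\<dots> \<le> C * \<sigma> * U powr (\<sigma> - 1) * (v x powr p - z powr p)"
        using 2 3 C s w0 by (intro mult_mono mult_left_mono) (auto simp: w_def)
      also have "\<dots> \<le> - (u x powr q) + C * \<sigma> * U powr (\<sigma> - 1) * v x powr p"
        using 1 by (simp add: algebra_simps)
      also have "\<dots> \<le> - (u x powr q) + (\<theta>1 (u x) * (- (v x powr p)) + \<theta>2 (u x) * (norm (gu x))\<^sup>2)"
      proof -
        have "0 \<le> C * \<sigma> * (1 - \<sigma>) * U powr (\<sigma> - 2) * (norm (gu x))\<^sup>2"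
          using C s by (intro mult_nonneg_nonneg) auto
        then show ?thesis by (simp add: \<theta>1_def \<theta>2_def U_def algebra_simps)
      qed
      finally show "c * (v x + \<theta> (u x)) powr (1 + e)
          \<le> - (u x powr q) + (\<theta>1 (u x) * (- (v x powr p)) + \<theta>2 (u x) * (norm (gu x))\<^sup>2)"
        by (simp add: w_def z_def \<theta>_def U_def)
    qed
    then show ?thesis by (simp add: \<theta>_def)
  qed
  have "(\<lambda>n. C * (u x + inverse (real (Suc n))) powr \<sigma>) \<longlonglongrightarrow> C * (u x + 0) powr \<sigma>"
    using nonneg(1)[of x] s
    by (intro tendsto_mult tendsto_const tendsto_powr' tendsto_add LIMSEQ_inverse_real_of_nat) auto
  then have "v x \<le> C * (u x + 0) powr \<sigma>"
    by (rule LIMSEQ_le_const) (use le in auto)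
  then show ?thesis by (simp add: C_def)
qed

subsection \<open>Cut-off functions\<close>

lemma has_real_derivative_max0_power:
  assumes "n \<ge> 2"
  shows "((\<lambda>y. max 0 y ^ n) has_real_derivative real n * max 0 y ^ (n - 1)) (at y)"
proof -
  consider "y > 0" | "y < 0" | "y = 0" by linarith
  then show ?thesis
  proof cases
    case 1
    have "((\<lambda>y. y ^ n) has_real_derivative real n * y ^ (n - 1)) (at y)"
      using DERIV_pow[of n y] by simp
    then have "((\<lambda>y. max 0 y ^ n) has_real_derivative real n * y ^ (n - 1)) (at y)"
      by (rule has_field_derivative_transform_within_open[of _ _ _ "{0<..}"]) (use 1 in auto)
    then show ?thesis using 1 by simp
  next
    case 2
    have "((\<lambda>y. 0) has_real_derivative 0) (at y)" by simp
    then have "((\<lambda>y. max 0 y ^ n) has_real_derivative 0) (at y)"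
      by (rule has_field_derivative_transform_within_open[of _ _ _ "{..<0}"]) (use 2 assms in auto)
    then show ?thesis using 2 assms by (simp add: power_0_left)
  next
    case 3
    have "((\<lambda>h. (max 0 (0 + h) ^ n - max 0 0 ^ n) / h) \<longlongrightarrow> 0) (at (0::real))"
    proof (rule Lim_null_comparison)
      show "eventually (\<lambda>h::real. norm ((max 0 (0 + h) ^ n - max 0 0 ^ n) / h) \<le> \<bar>h\<bar>) (at 0)"
        unfolding eventually_at
      proof (intro exI[of _ 1] conjI ballI impI)
        fix h :: real assume h: "h \<noteq> 0 \<and> dist h 0 < 1"
        show "norm ((max 0 (0 + h) ^ n - max 0 0 ^ n) / h) \<le> \<bar>h\<bar>"
        proof (cases "h > 0")
          case True
          have "h ^ n \<le> h ^ 2" using assms h True by (intro power_decreasing) auto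
          then show ?thesis using True assms by (simp add: divide_simps power2_eq_square power_0_left)
        qed (use assms in auto)
      qed simp
      show "((\<lambda>h::real. \<bar>h\<bar>) \<longlongrightarrow> 0) (at 0)"
        using tendsto_rabs[OF tendsto_ident_at[of "0::real" UNIV]] by simp
    qed
    then show ?thesis using 3 assms by (simp add: DERIV_def power_0_left)
  qed
qed

text \<open>The cut-offs are powers of the positive part \<open>H\<close> of one function
  \<open>h\<close>. A derivative of \<open>H ^ n\<close> is controlled by a lower power of
  \<open>H\<close>, so remainders still carry the cut-off and can be absorbed by Young's inequality.
  The bounds are asked only where \<open>h\<close> is positive, since \<open>H\<close> vanishes
  elsewhere.\<close>

locale cutoff =
  fixes h :: "'a::euclidean_space \<Rightarrow> real" and gh lh C M
  assumes h: "has_laplacian UNIV h gh lh" and C: "compact C" "\<And>x. x \<notin> C \<Longrightarrow> h x \<le> 0"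
    and M: "M \<ge> 1" "\<And>x. h x > 0 \<Longrightarrow> h x \<le> M" "\<And>x. h x > 0 \<Longrightarrow> norm (gh x) \<le> M"
      "\<And>x. h x > 0 \<Longrightarrow> \<bar>lh x\<bar> \<le> M"
begin

definition H where "H x = max 0 (h x)"

definition gH where "gH n x = (real n * H x ^ (n - 1)) *\<^sub>R gh x"

definition lH where
  "lH n x = real n * H x ^ (n - 1) * lh x + real n * (real (n - 1) * H x ^ (n - 2)) * (norm (gh x))\<^sup>2"

lemma H_bounds: "0 \<le> H x" "H x \<le> M"
proof -
  show "0 \<le> H x" by (simp add: H_def)
  show "H x \<le> M"
  proof (cases "h x > 0")
    case True
    then show ?thesis using M(2) by (simp add: H_def)
  qed (use M(1) in \<open>simp add: H_def\<close>)
qed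

lemma H_outside: "x \<notin> C \<Longrightarrow> H x = 0"
  using C(2)[of x] by (simp add: H_def)

lemma H_cont: "continuous_on S H"
  unfolding H_def using has_laplacianD(2)[OF h] continuous_on_subset
  by (intro continuous_on_max continuous_on_const) blast

text \<open>The exponent 3 is the first for which the second derivative of
  \<open>max 0 y ^ n\<close> is continuous at zero.\<close>

lemma H_laplacian:
  assumes "n \<ge> 3"
  shows "has_laplacian UNIV (\<lambda>x. H x ^ n) (gH n) (lH n)"
proof -
  have "((\<lambda>y. real n * max 0 y ^ (n - 1)) has_real_derivative real n * (real (n - 1) * max 0 y ^ (n - 2))) (at y)" for y
    using DERIV_cmult[OF has_real_derivative_max0_power[of "n - 1" y], of "real n"] assms
    by (simp add: numeral_2_eq_2)
  then have "has_laplacian UNIV (\<lambda>x. max 0 (h x) ^ n) (\<lambda>x. (real n * max 0 (h x) ^ (n - 1)) *\<^sub>R gh x)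
    (\<lambda>x. real n * max 0 (h x) ^ (n - 1) * lh x + real n * (real (n - 1) * max 0 (h x) ^ (n - 2)) * (norm (gh x))\<^sup>2)"
    using assms by (intro has_laplacian_compose[OF h] has_real_derivative_max0_power continuous_intros) auto
  then show ?thesis by (simp add: H_def gH_def[abs_def] lH_def[abs_def])
qed

lemma gH_bound:
  assumes "n \<ge> 2"
  shows "norm (gH n x) \<le> real n * M * H x ^ (n - 1)"
proof (cases "h x > 0")
  case True
  have "norm (gH n x) = real n * H x ^ (n - 1) * norm (gh x)"
    by (simp add: gH_def H_bounds)
  also have "\<dots> \<le> real n * H x ^ (n - 1) * M"
    using M(3)[OF True] by (intro mult_left_mono) (auto simp: H_bounds)
  finally show ?thesis by (simp add: mult_ac)
qed (use assms in \<open>simp add: gH_def H_def power_0_left\<close>)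

lemma lH_bound:
  assumes "n \<ge> 3"
  shows "\<bar>lH n x\<bar> \<le> (real n * M)\<^sup>2 * H x ^ (n - 2)"
proof (cases "h x > 0")
  case True
  have p: "H x ^ (n - 1) = H x * H x ^ (n - 2)"
  proof -
    obtain k where "n = Suc (Suc k)" using assms by (metis add_2_eq_Suc le_Suc_ex numeral_3_eq_3 Suc_leD numeral_2_eq_2)
    then show ?thesis by simp
  qed
  have "\<bar>lH n x\<bar> \<le> \<bar>real n * H x ^ (n - 1) * lh x\<bar> + \<bar>real n * (real (n - 1) * H x ^ (n - 2)) * (norm (gh x))\<^sup>2\<bar>"
    unfolding lH_def by (rule abs_triangle_ineq)
  also have "\<bar>real n * H x ^ (n - 1) * lh x\<bar> = real n * (H x * H x ^ (n - 2)) * \<bar>lh x\<bar>"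
    unfolding p by (simp add: abs_mult H_bounds)
  also have "\<dots> \<le> real n * (M * H x ^ (n - 2)) * M"
    using M(1) M(4)[OF True] H_bounds by (intro mult_mono mult_left_mono mult_right_mono) auto
  also have "\<bar>real n * (real (n - 1) * H x ^ (n - 2)) * (norm (gh x))\<^sup>2\<bar>
      = real n * (real (n - 1) * H x ^ (n - 2)) * (norm (gh x))\<^sup>2"
    by (simp add: abs_mult H_bounds)
  also have "\<dots> \<le> real n * (real (n - 1) * H x ^ (n - 2)) * M\<^sup>2"
    using M(3)[OF True] H_bounds by (intro mult_left_mono power_mono) auto
  also have "real n * (M * H x ^ (n - 2)) * M + real n * (real (n - 1) * H x ^ (n - 2)) * M\<^sup>2
      = (real n * M)\<^sup>2 * H x ^ (n - 2)"
    using assms by (simp add: of_nat_diff power2_eq_square algebra_simps)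
  finally show ?thesis by simp
qed (use assms in \<open>simp add: lH_def H_def power_0_left\<close>)

lemma integrable_H:
  assumes "continuous_on UNIV f" "k > 0"
  shows "integrable lborel (\<lambda>x. f x * H x ^ k)"
  by (rule integrable_compact_support[OF _ C(1)])
    (use assms H_outside in \<open>auto intro!: continuous_intros H_cont simp: power_0_left\<close>)

text \<open>Green's identity for the vector field \<open>f\<^sup>a w\<^sup>b\<^sup>+\<^sup>1 H\<^sup>n \<nabla>w\<close>; the term containing
  \<open>\<nabla>H\<close> is absorbed by Young's inequality.\<close>
lemma mixed_identity:
  assumes f: "has_laplacian UNIV f gf lf" "\<And>x. f x > 0" and w: "has_laplacian UNIV w gw lw" "\<And>x. w x > 0"
    and n: "n \<ge> 3" and \<epsilon>: "\<epsilon> > 0"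
  shows "\<bar>(b + 1) * (\<integral>x. f x powr a * w x powr b * (norm (gw x))\<^sup>2 * H x ^ n \<partial>lborel)
      + a * (\<integral>x. f x powr (a - 1) * w x powr (b + 1) * (gf x \<bullet> gw x) * H x ^ n \<partial>lborel)
      + (\<integral>x. f x powr a * w x powr (b + 1) * lw x * H x ^ n \<partial>lborel)\<bar>
    \<le> \<epsilon> * (\<integral>x. f x powr a * w x powr b * (norm (gw x))\<^sup>2 * H x ^ n \<partial>lborel)
      + (real n * M)\<^sup>2 / (4 * \<epsilon>) * (\<integral>x. f x powr a * w x powr (b + 2) * H x ^ (n - 2) \<partial>lborel)"
proof -
  note fD = has_laplacianD[OF f(1)] and wD = has_laplacianD[OF w(1)] and HD = has_laplacianD[OF H_laplacian[OF n]]
  have ne: "f x \<noteq> 0" "w x \<noteq> 0" for x using f(2)[of x] w(2)[of x] by auto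
  have gHc: "continuous_on UNIV (gH n)" by (rule HD)
  define F where "F x = f x powr a * w x powr (b + 1) * H x ^ n" for x
  define F' where "F' x = (a * f x powr (a - 1) * w x powr (b + 1) * H x ^ n) *\<^sub>R gf x
     + ((b + 1) * f x powr a * w x powr b * H x ^ n) *\<^sub>R gw x + (f x powr a * w x powr (b + 1)) *\<^sub>R gH n x" for x
  have 0: "(\<integral>x. F' x \<bullet> gw x + F x * lw x \<partial>lborel) = 0"
  proof (rule green_identity[OF open_UNIV w(1) C(1)])
    fix x
    have df: "((\<lambda>x. f x powr a) has_derivative (\<lambda>h. a * f x powr (a - 1) * (gf x \<bullet> h))) (at x)"
      by (rule has_derivative_compose[OF fD(1), of _ "\<lambda>y. y powr a", unfolded])
        (use f(2)[of x] in \<open>auto intro!: has_real_derivative_powr[THEN has_field_derivative_imp_has_derivative]\<close>)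
    have dw: "((\<lambda>x. w x powr (b + 1)) has_derivative (\<lambda>h. (b + 1) * w x powr b * (gw x \<bullet> h))) (at x)"
      by (rule has_derivative_compose[OF wD(1), of _ "\<lambda>y. y powr (b + 1)", unfolded])
        (use w(2)[of x] has_real_derivative_powr[of "w x" "b + 1"] in
          \<open>auto intro!: has_field_derivative_imp_has_derivative\<close>)
    show "(F has_derivative (\<lambda>h. F' x \<bullet> h)) (at x)"
      unfolding F_def F'_def
      by (rule derivative_eq_intros df dw HD(1) refl UNIV_I)+ (simp add: inner_add_left algebra_simps)
  next
    show "continuous_on UNIV F'" unfolding F'_def
      by (intro continuous_intros fD wD H_cont gHc) (use ne in auto)
  qed (use n H_outside in \<open>auto simp: F_def F'_def gH_def power_0_left\<close>)
  let ?A = "\<lambda>x. f x powr a * w x powr b * (norm (gw x))\<^sup>2 * H x ^ n"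
  let ?B = "\<lambda>x. f x powr (a - 1) * w x powr (b + 1) * (gf x \<bullet> gw x) * H x ^ n"
  let ?D = "\<lambda>x. f x powr a * w x powr (b + 1) * lw x * H x ^ n"
  let ?E = "\<lambda>x. f x powr a * w x powr (b + 2) * H x ^ (n - 2)"
  let ?R = "\<lambda>x. f x powr a * w x powr (b + 1) * (gH n x \<bullet> gw x)"
  have iA: "integrable lborel ?A" and iB: "integrable lborel ?B" and iD: "integrable lborel ?D"
    and iE: "integrable lborel ?E"
    using ne n by (intro integrable_H continuous_intros fD wD; simp)+
  have R0: "?R x = 0" if "x \<notin> C" for x
    using H_outside[OF that] n by (simp add: gH_def power_0_left)
  have iR: "integrable lborel ?R"
    by (rule integrable_compact_support[OF _ C(1) R0])
      (intro continuous_intros fD wD gHc; use ne in simp)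
  have e: "F' x \<bullet> gw x + F x * lw x = (b + 1) * ?A x + a * ?B x + ?D x + ?R x" for x
    by (simp add: F_def F'_def inner_add_left power2_norm_eq_inner algebra_simps)
  have "(\<integral>x. F' x \<bullet> gw x + F x * lw x \<partial>lborel)
      = (b + 1) * integral\<^sup>L lborel ?A + a * integral\<^sup>L lborel ?B + integral\<^sup>L lborel ?D + integral\<^sup>L lborel ?R"
    unfolding e using iA iB iD iR by simp
  then have "\<bar>(b + 1) * integral\<^sup>L lborel ?A + a * integral\<^sup>L lborel ?B + integral\<^sup>L lborel ?D\<bar> = \<bar>integral\<^sup>L lborel ?R\<bar>"
    using 0 by linarith
  also have "\<dots> \<le> (\<integral>x. \<bar>?R x\<bar> \<partial>lborel)" by (rule integral_abs_bound)
  also have "\<dots> \<le> (\<integral>x. \<epsilon> * ?A x + (real n * M)\<^sup>2 / (4 * \<epsilon>) * ?E x \<partial>lborel)"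
  proof (rule integral_mono)
    fix x
    \<comment> \<open>One factor \<open>H\<close> goes with the gradient, so that \<open>s^2\<close>
      restores \<open>H ^ n\<close> and \<open>t^2\<close> keeps \<open>H ^ (n - 2)\<close>.\<close>
    define s where "s = H x * norm (gw x)"
    define t where "t = real n * M * w x"
    have "\<bar>gH n x \<bullet> gw x\<bar> \<le> norm (gH n x) * norm (gw x)" by (rule Cauchy_Schwarz_ineq2)
    also have "\<dots> \<le> real n * M * H x ^ (n - 1) * norm (gw x)"
      using n by (intro mult_right_mono gH_bound) auto
    finally have "w x * \<bar>gH n x \<bullet> gw x\<bar> \<le> w x * (real n * M * H x ^ (n - 1) * norm (gw x))"
      using w(2)[of x] by (intro mult_left_mono) auto
    also have "\<dots> = H x ^ (n - 2) * (s * t)"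
      using n power_add[of "H x" "n - 2" 1] by (simp add: s_def t_def Suc_diff_Suc numeral_2_eq_2 algebra_simps)
    also have "\<dots> \<le> H x ^ (n - 2) * (\<epsilon> * s\<^sup>2 + t\<^sup>2 / (4 * \<epsilon>))"
    proof (intro mult_left_mono)
      have "0 \<le> (2 * \<epsilon> * s - t)\<^sup>2 / (4 * \<epsilon>)" using \<epsilon> by simp
      then show "s * t \<le> \<epsilon> * s\<^sup>2 + t\<^sup>2 / (4 * \<epsilon>)"
        using \<epsilon> by (simp add: power2_eq_square field_simps)
    qed (simp add: H_bounds)
    finally have k: "w x * \<bar>gH n x \<bullet> gw x\<bar> \<le> H x ^ (n - 2) * (\<epsilon> * s\<^sup>2 + t\<^sup>2 / (4 * \<epsilon>))" .
    have "\<bar>?R x\<bar> = f x powr a * w x powr b * (w x * \<bar>gH n x \<bullet> gw x\<bar>)"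
      using w(2)[of x] by (simp add: abs_mult powr_add)
    also have "\<dots> \<le> f x powr a * w x powr b * (H x ^ (n - 2) * (\<epsilon> * s\<^sup>2 + t\<^sup>2 / (4 * \<epsilon>)))"
      using k by (intro mult_left_mono) auto
    also have "\<dots> = \<epsilon> * ?A x + (real n * M)\<^sup>2 / (4 * \<epsilon>) * ?E x"
    proof -
      have "H x ^ n = H x ^ (n - 2) * (H x)\<^sup>2" proof -
        have "n = (n - 2) + 2" using n by simp
        then show ?thesis by (metis power_add)
      qed
      moreover have "w x powr (b + 2) = w x powr b * (w x)\<^sup>2" using w(2)[of x] by (simp add: powr_add)
      ultimately show ?thesis by (simp add: s_def t_def power_mult_distrib algebra_simps)
    qed
    finally show "\<bar>?R x\<bar> \<le> \<epsilon> * ?A x + (real n * M)\<^sup>2 / (4 * \<epsilon>) * ?E x" .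
  qed (use iA iE iR in auto)
  also have "\<dots> = \<epsilon> * integral\<^sup>L lborel ?A + (real n * M)\<^sup>2 / (4 * \<epsilon>) * integral\<^sup>L lborel ?E"
    using iA iE by simp
  finally show ?thesis .
qed

end

subsection \<open>The stability inequality\<close>

lemma green_integrable:
  fixes F :: "'a::euclidean_space \<Rightarrow> real"
  assumes S: "open S" and w: "has_laplacian S w g l" and C: "compact C" "C \<subseteq> S"
    and F: "\<And>x. x \<in> S \<Longrightarrow> (F has_derivative (\<lambda>h. F' x \<bullet> h)) (at x)" "continuous_on S F'"
      "\<And>x. x \<notin> C \<Longrightarrow> F x = 0" "\<And>x. x \<notin> C \<Longrightarrow> F' x = 0"
  shows "integrable lborel (\<lambda>x. F' x \<bullet> g x + F x * l x)"
proof (rule integrable_compact_support[OF continuous_on_UNIV_support[OF S C] C(1)])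
  show "continuous_on S (\<lambda>x. F' x \<bullet> g x + F x * l x)"
    by (intro continuous_intros F(2) has_derivative_imp_continuous_on[OF F(1)] has_laplacianD[OF w])
qed (auto simp: F)

text \<open>Add Green's identities for the pairs \<open>(\<eta>\<^sup>2/\<psi>, \<phi>)\<close>, \<open>(\<phi>\<eta>/\<psi>, \<eta>)\<close> and \<open>(\<phi>\<eta>\<^sup>2/\<psi>\<^sup>2, \<psi>)\<close> with
  weights \<open>1\<close>, \<open>-2\<close>, \<open>1\<close>: the gradient terms form \<open>-2\<phi>/\<psi> \<bar>\<nabla>\<eta> - \<eta>\<nabla>\<psi>/\<psi>\<bar>\<^sup>2\<close>.\<close>
lemma stability_inequality:
  fixes u v \<phi> \<psi> \<eta> :: "'a::euclidean_space \<Rightarrow> real"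
  assumes S: "open S" and C: "compact C" "C \<subseteq> S"
    and \<phi>: "has_laplacian S \<phi> g\<phi> l\<phi>" and \<psi>: "has_laplacian S \<psi> g\<psi> l\<psi>"
    and pos: "\<And>x. x \<in> S \<Longrightarrow> \<phi> x > 0" "\<And>x. x \<in> S \<Longrightarrow> \<psi> x > 0"
    and st: "\<And>x. x \<in> S \<Longrightarrow> p * v x powr (p - 1) * \<psi> x \<le> - l\<phi> x"
      "\<And>x. x \<in> S \<Longrightarrow> q * u x powr (q - 1) * \<phi> x \<le> - l\<psi> x"
    and uv: "continuous_on UNIV u" "continuous_on UNIV v" "\<And>x. u x > 0" "\<And>x. v x > 0" and q: "q > 0"
    and \<eta>: "has_laplacian UNIV \<eta> g\<eta> l\<eta>" "\<And>x. \<eta> x \<ge> 0" "\<And>x. x \<notin> C \<Longrightarrow> \<eta> x = 0" "\<And>x. x \<notin> C \<Longrightarrow> g\<eta> x = 0"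
    and E: "continuous_on UNIV E" "\<And>x. x \<notin> C \<Longrightarrow> E x = 0" "\<And>x. - l\<eta> x \<le> E x"
  shows "p * (\<integral>x. v x powr (p - 1) * (\<eta> x)\<^sup>2 \<partial>lborel) \<le> 1 / q * (\<integral>x. u x powr (1 - q) * (E x)\<^sup>2 \<partial>lborel)"
proof -
  note D = has_laplacianD[OF \<phi>] has_laplacianD[OF \<psi>] has_laplacianD[OF has_laplacian_subset[OF \<eta>(1) subset_UNIV[of S]]]
  have ne: "\<psi> x \<noteq> 0" if "x \<in> S" for x using pos(2)[OF that] by simp
  have une: "u x \<noteq> 0" "v x \<noteq> 0" for x using uv(3)[of x] uv(4)[of x] by auto
  define F1 where "F1 x = (\<eta> x)\<^sup>2 / \<psi> x" for x
  define F1' where "F1' x = (2 * \<eta> x / \<psi> x) *\<^sub>R g\<eta> x - ((\<eta> x)\<^sup>2 / (\<psi> x)\<^sup>2) *\<^sub>R g\<psi> x" for x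
  define F2 where "F2 x = \<phi> x * \<eta> x / \<psi> x" for x
  define F2' where "F2' x = (\<eta> x / \<psi> x) *\<^sub>R g\<phi> x + (\<phi> x / \<psi> x) *\<^sub>R g\<eta> x - (\<phi> x * \<eta> x / (\<psi> x)\<^sup>2) *\<^sub>R g\<psi> x" for x
  define F3 where "F3 x = \<phi> x * (\<eta> x)\<^sup>2 / (\<psi> x)\<^sup>2" for x
  define F3' where "F3' x = ((\<eta> x)\<^sup>2 / (\<psi> x)\<^sup>2) *\<^sub>R g\<phi> x + (2 * \<phi> x * \<eta> x / (\<psi> x)\<^sup>2) *\<^sub>R g\<eta> x
    - (2 * \<phi> x * (\<eta> x)\<^sup>2 / (\<psi> x)^3) *\<^sub>R g\<psi> x" for x
  have d1: "(F1 has_derivative (\<lambda>h. F1' x \<bullet> h)) (at x)" if "x \<in> S" for x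
    unfolding F1_def F1'_def
    by (rule derivative_eq_intros D(1,5,9) that ne refl)+
      (use ne[OF that] in \<open>simp add: inner_diff_left field_simps power2_eq_square\<close>)
  have d2: "(F2 has_derivative (\<lambda>h. F2' x \<bullet> h)) (at x)" if "x \<in> S" for x
    unfolding F2_def F2'_def
    by (rule derivative_eq_intros D(1,5,9) that ne refl)+
      (use ne[OF that] in \<open>simp add: inner_diff_left inner_add_left field_simps power2_eq_square\<close>)
  have d3: "(F3 has_derivative (\<lambda>h. F3' x \<bullet> h)) (at x)" if "x \<in> S" for x
    unfolding F3_def F3'_def
    by (rule derivative_eq_intros D(1,5,9) that ne refl)+
      (use ne[OF that] in \<open>simp_all add: inner_diff_left inner_add_left field_simps power2_eq_square power3_eq_cube\<close>)
  have c1: "continuous_on S F1'" and c2: "continuous_on S F2'" and c3: "continuous_on S F3'"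
    unfolding F1'_def F2'_def F3'_def using ne by (auto intro!: continuous_intros D)
  have z: "F1 x = 0" "F1' x = 0" "F2 x = 0" "F3 x = 0" "F3' x = 0" "F2' x = 0" if "x \<notin> C" for x
    using \<eta>(3,4)[OF that] by (auto simp: F1_def F1'_def F2_def F2'_def F3_def F3'_def)
  let ?I1 = "\<lambda>x. F1' x \<bullet> g\<phi> x + F1 x * l\<phi> x"
  let ?I2 = "\<lambda>x. F2' x \<bullet> g\<eta> x + F2 x * l\<eta> x"
  let ?I3 = "\<lambda>x. F3' x \<bullet> g\<psi> x + F3 x * l\<psi> x"
  note \<eta>S = has_laplacian_subset[OF \<eta>(1) subset_UNIV[of S]]
  have I: "integrable lborel ?I1" "integrable lborel ?I2" "integrable lborel ?I3"
    using green_integrable[OF S \<phi> C d1 c1] green_integrable[OF S \<eta>S C d2 c2]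
      green_integrable[OF S \<psi> C d3 c3] z by auto
  have I0: "integral\<^sup>L lborel ?I1 = 0" "integral\<^sup>L lborel ?I2 = 0" "integral\<^sup>L lborel ?I3 = 0"
    using green_identity[OF S \<phi> C d1 c1] green_identity[OF S \<eta>S C d2 c2]
      green_identity[OF S \<psi> C d3 c3] z by auto
  have iv: "integrable lborel (\<lambda>x. v x powr (p - 1) * (\<eta> x)\<^sup>2)"
    by (rule integrable_compact_support[OF _ C(1)])
      (use \<eta>(3) une in \<open>auto intro!: continuous_intros uv has_laplacianD[OF \<eta>(1)]\<close>)
  have iu: "integrable lborel (\<lambda>x. u x powr (1 - q) * (E x)\<^sup>2)"
    by (rule integrable_compact_support[OF _ C(1)])
      (use E(2) une in \<open>auto intro!: continuous_intros uv E(1)\<close>)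
  have pt: "?I1 x - 2 * ?I2 x + ?I3 x \<le> 1 / q * (u x powr (1 - q) * (E x)\<^sup>2) - p * (v x powr (p - 1) * (\<eta> x)\<^sup>2)" for x
  proof (cases "x \<in> C")
    case True
    then have x: "x \<in> S" using C by auto
    \<comment> \<open>Once the gradient square and the first supersolution inequality have been
      used, the remaining dependence on the supersolution is through this one quantity.\<close>
    define X where "X = \<phi> x * \<eta> x / \<psi> x"
    have X: "X \<ge> 0" using pos[OF x] \<eta>(2)[of x] by (simp add: X_def)
    define a where "a = g\<phi> x \<bullet> g\<eta> x" define b where "b = g\<phi> x \<bullet> g\<psi> x"
    define c where "c = g\<eta> x \<bullet> g\<psi> x" define e where "e = g\<eta> x \<bullet> g\<eta> x"
    define f where "f = g\<psi> x \<bullet> g\<psi> x"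
    note cc = a_def b_def c_def e_def f_def
    have g0: "e - 2 * (\<eta> x / \<psi> x) * c + (\<eta> x / \<psi> x)\<^sup>2 * f \<ge> 0"
    proof -
      have "0 \<le> (norm (g\<eta> x - (\<eta> x / \<psi> x) *\<^sub>R g\<psi> x))\<^sup>2" by simp
      also have "\<dots> = e - 2 * (\<eta> x / \<psi> x) * c + (\<eta> x / \<psi> x)\<^sup>2 * f"
        unfolding power2_norm_eq_inner cc
        by (simp add: inner_diff_left inner_diff_right inner_commute power2_eq_square algebra_simps)
      finally show ?thesis .
    qed
    have "?I1 x - 2 * ?I2 x + ?I3 x = - (2 * \<phi> x / \<psi> x) * (e - 2 * (\<eta> x / \<psi> x) * c + (\<eta> x / \<psi> x)\<^sup>2 * f)
        + (\<eta> x)\<^sup>2 / \<psi> x * l\<phi> x - 2 * X * l\<eta> x + \<phi> x * (\<eta> x)\<^sup>2 / (\<psi> x)\<^sup>2 * l\<psi> x"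
    proof -
      have 1: "F1' x \<bullet> g\<phi> x = 2 * \<eta> x / \<psi> x * a - (\<eta> x)\<^sup>2 / (\<psi> x)\<^sup>2 * b"
        unfolding F1'_def cc inner_diff_left inner_scaleR_left by (simp add: inner_commute)
      have 2: "F2' x \<bullet> g\<eta> x = \<eta> x / \<psi> x * a + \<phi> x / \<psi> x * e - \<phi> x * \<eta> x / (\<psi> x)\<^sup>2 * c"
        unfolding F2'_def cc inner_diff_left inner_add_left inner_scaleR_left by (simp add: inner_commute)
      have 3: "F3' x \<bullet> g\<psi> x = (\<eta> x)\<^sup>2 / (\<psi> x)\<^sup>2 * b + 2 * \<phi> x * \<eta> x / (\<psi> x)\<^sup>2 * c - 2 * \<phi> x * (\<eta> x)\<^sup>2 / (\<psi> x)^3 * f"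
        unfolding F3'_def cc inner_diff_left inner_add_left inner_scaleR_left by (simp add: inner_commute)
      show ?thesis unfolding 1 2 3 using ne[OF x]
        by (simp add: F1_def F2_def F3_def X_def field_simps power2_eq_square power3_eq_cube)
    qed
    also have "\<dots> \<le> 0 - p * v x powr (p - 1) * (\<eta> x)\<^sup>2 + 2 * X * E x - q * u x powr (q - 1) * X\<^sup>2"
    proof -
      have 1: "- (2 * \<phi> x / \<psi> x) * (e - 2 * (\<eta> x / \<psi> x) * c + (\<eta> x / \<psi> x)\<^sup>2 * f) \<le> 0"
        using g0 pos[OF x] by (simp add: mult_nonpos_nonneg)
      have "(\<eta> x)\<^sup>2 / \<psi> x * (p * v x powr (p - 1) * \<psi> x) \<le> (\<eta> x)\<^sup>2 / \<psi> x * (- l\<phi> x)"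
        using st(1)[OF x] pos(2)[OF x] by (intro mult_left_mono) auto
      then have 2: "(\<eta> x)\<^sup>2 / \<psi> x * l\<phi> x \<le> - (p * v x powr (p - 1) * (\<eta> x)\<^sup>2)"
        using ne[OF x] by (simp add: mult_ac)
      have 3: "- 2 * X * l\<eta> x \<le> 2 * X * E x"
        using mult_left_mono[OF E(3)[of x], of "2 * X"] X by simp
      have "\<phi> x * (\<eta> x)\<^sup>2 / (\<psi> x)\<^sup>2 * (q * u x powr (q - 1) * \<phi> x) \<le> \<phi> x * (\<eta> x)\<^sup>2 / (\<psi> x)\<^sup>2 * (- l\<psi> x)"
        using st(2)[OF x] pos[OF x] by (intro mult_left_mono) auto
      then have 4: "\<phi> x * (\<eta> x)\<^sup>2 / (\<psi> x)\<^sup>2 * l\<psi> x \<le> - (q * u x powr (q - 1) * X\<^sup>2)"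
        by (simp add: X_def power2_eq_square algebra_simps)
      show ?thesis using 1 2 3 4 by linarith
    qed
    also have "\<dots> \<le> 1 / q * (u x powr (1 - q) * (E x)\<^sup>2) - p * (v x powr (p - 1) * (\<eta> x)\<^sup>2)"
    proof -
      define k where "k = u x powr (q - 1)"
      have k: "k > 0" using uv(3)[of x] by (simp add: k_def)
      have k1: "u x powr (1 - q) = 1 / k"
        using uv(3)[of x] powr_minus_divide[of "u x" "q - 1"] by (simp add: k_def)
      \<comment> \<open>The quadratic \<open>2 * X * E - q * k * X^2\<close> is replaced by its
        maximum over \<open>X\<close>. This removes \<open>\<phi>\<close> and \<open>\<psi>\<close>
        from the estimate.\<close>
      have "0 \<le> (q * k * X - E x)\<^sup>2 / (q * k)" using q k by simp
      then have "2 * X * E x - q * k * X\<^sup>2 \<le> 1 / q * (1 / k * (E x)\<^sup>2)"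
        using q k by (simp add: power2_eq_square field_simps)
      then show ?thesis unfolding k1 k_def[symmetric] by (simp add: mult_ac)
    qed
    finally show ?thesis .
  next
    case False
    then show ?thesis using z \<eta>(3) E(2) by simp
  qed
  have lin: "(\<integral>x. f x - 2 * g x + k x \<partial>lborel) = integral\<^sup>L lborel f - 2 * integral\<^sup>L lborel g + integral\<^sup>L lborel k"
    if "integrable lborel f" "integrable lborel g" "integrable lborel k" for f g k :: "'a \<Rightarrow> real"
    using that by simp
  have "0 = (\<integral>x. ?I1 x - 2 * ?I2 x + ?I3 x \<partial>lborel)"
    using lin[OF I] I0 by simp
  also have "\<dots> \<le> (\<integral>x. 1 / q * (u x powr (1 - q) * (E x)\<^sup>2) - p * (v x powr (p - 1) * (\<eta> x)\<^sup>2) \<partial>lborel)"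
    by (rule integral_mono[OF _ _ pt]) (intro Bochner_Integration.integrable_add Bochner_Integration.integrable_diff
        integrable_mult_right I iu iv)+
  also have "\<dots> = 1 / q * (\<integral>x. u x powr (1 - q) * (E x)\<^sup>2 \<partial>lborel) - p * (\<integral>x. v x powr (p - 1) * (\<eta> x)\<^sup>2 \<partial>lborel)"
    using iu iv by simp
  finally show ?thesis by simp
qed

subsection \<open>Integral estimates\<close>

text \<open>With \<open>A = y powr N * t ^ m\<close> and \<open>\<theta> = r / N < 1\<close>, the
  left side is \<open>A powr \<theta>\<close> times a power of \<open>t\<close>. The condition
  \<open>m * r \<le> N * k\<close> says that this power has a nonnegative exponent, so
  \<open>M\<close> bounds it. \<open>T\<close> is the value of \<open>A\<close> from which on the
  linear term \<open>\<epsilon> * A\<close> dominates.\<close>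

lemma absorb_lower_power:
  fixes r N M :: real and k m :: nat
  assumes r: "0 \<le> r" "r < N" and k: "k > 0" "real m * r \<le> N * real k" and M: "M \<ge> 1" and \<epsilon>: "\<epsilon> > 0"
  shows "\<exists>K\<ge>0. \<forall>y t. 0 < y \<longrightarrow> 0 \<le> t \<longrightarrow> t \<le> M \<longrightarrow> y powr r * t ^ k \<le> \<epsilon> * (y powr N * t ^ m) + K"
proof -
  define \<theta> where "\<theta> = r / N"
  have N: "N > 0" using r by simp
  have \<theta>: "0 \<le> \<theta>" "\<theta> < 1" using r N by (auto simp: \<theta>_def)
  define D where "D = M ^ k"
  have D: "D \<ge> 1" using M by (simp add: D_def)
  define T where "T = (\<epsilon> / D) powr (1 / (\<theta> - 1))"
  have T: "T > 0" using \<epsilon> D by (simp add: T_def)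
  have TD: "T powr (\<theta> - 1) = \<epsilon> / D" using \<theta> \<epsilon> D by (simp add: T_def powr_powr)
  have "y powr r * t ^ k \<le> \<epsilon> * (y powr N * t ^ m) + D * T powr \<theta>" if y: "0 < y" and t: "0 \<le> t" "t \<le> M" for y t
  proof (cases "t = 0")
    case True
    then show ?thesis using k \<epsilon> D by (simp add: power_0_left)
  next
    case False
    then have t0: "t > 0" using t by simp
    define A where "A = y powr N * t ^ m"
    have A: "A > 0" using y t0 by (simp add: A_def)
    have "y powr r = (y powr N) powr \<theta>" using N by (simp add: powr_powr \<theta>_def)
    moreover have "t ^ k = (t ^ m) powr \<theta> * t powr (real k - real m * \<theta>)"
      using t0 by (simp add: powr_realpow[symmetric] powr_powr powr_add[symmetric])
    ultimately have "y powr r * t ^ k = A powr \<theta> * t powr (real k - real m * \<theta>)"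
      using y t0 by (simp add: A_def powr_mult)
    also have "t powr (real k - real m * \<theta>) \<le> D"
    proof -
      have e: "real k - real m * \<theta> \<ge> 0" using k N by (simp add: \<theta>_def field_simps)
      have "t powr (real k - real m * \<theta>) \<le> M powr (real k - real m * \<theta>)"
        using t e by (intro powr_mono2) auto
      also have "\<dots> \<le> M powr real k" using M \<theta> by (intro powr_mono) auto
      also have "\<dots> = D" using M by (simp add: D_def powr_realpow)
      finally show ?thesis .
    qed
    finally have 1: "y powr r * t ^ k \<le> A powr \<theta> * D" by (simp add: mult_left_mono)
    also have "\<dots> \<le> \<epsilon> * A + D * T powr \<theta>"
    proof (cases "A \<le> T")
      case True
      have "A powr \<theta> * D \<le> T powr \<theta> * D" using True A D \<theta> by (intro mult_right_mono powr_mono2) auto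
      then show ?thesis using A \<epsilon> by (simp add: mult.commute add_increasing)
    next
      case False
      have "A powr \<theta> = A * A powr (\<theta> - 1)" using A powr_add[of A 1 "\<theta> - 1"] by simp
      also have "\<dots> \<le> A * T powr (\<theta> - 1)"
        using False A T \<theta> by (intro mult_left_mono powr_mono2') auto
      finally have "A powr \<theta> * D \<le> A * (\<epsilon> / D) * D" using D by (intro mult_right_mono) (auto simp: TD)
      then show ?thesis using D by (simp add: mult.commute add_increasing2)
    qed
    finally show ?thesis by (simp add: A_def)
  qed
  moreover have "0 \<le> D * T powr \<theta>" using D by simp
  ultimately show ?thesis by blast
qed

text \<open>Choosing the constant as a function of the numerical data alone makes its independence
  of the solution visible: it can be named before \<open>u\<close> and \<open>v\<close> are
  introduced.\<close>

definition absorb_const :: "real \<Rightarrow> real \<Rightarrow> nat \<Rightarrow> real \<Rightarrow> nat \<Rightarrow> real \<Rightarrow> real" where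
  "absorb_const M N m r k \<epsilon> = (SOME K. K \<ge> 0 \<and> (\<forall>y t. 0 < y \<longrightarrow> 0 \<le> t \<longrightarrow> t \<le> M \<longrightarrow>
    y powr r * t ^ k \<le> \<epsilon> * (y powr N * t ^ m) + K))"

lemma absorb_const:
  assumes "0 \<le> r" "r < N" "k > 0" "real m * r \<le> N * real k" "M \<ge> 1" "\<epsilon> > 0" "0 < y" "0 \<le> t" "t \<le> M"
  shows "y powr r * t ^ k \<le> \<epsilon> * (y powr N * t ^ m) + absorb_const M N m r k \<epsilon>"
proof -
  have "absorb_const M N m r k \<epsilon> \<ge> 0 \<and> (\<forall>y t. 0 < y \<longrightarrow> 0 \<le> t \<longrightarrow> t \<le> M \<longrightarrow>
    y powr r * t ^ k \<le> \<epsilon> * (y powr N * t ^ m) + absorb_const M N m r k \<epsilon>)"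
    unfolding absorb_const_def by (rule someI_ex) (use absorb_lower_power[OF assms(1-6)] in blast)
  then show ?thesis using assms by blast
qed

text \<open>The coefficient of \<open>x^2\<close> stays arbitrarily close to 1. The leading term of
  the stability inequality has to be compared with \<open>p * q\<close>, where a factor 3 from the
  usual inequality would be fatal.\<close>

lemma square_sum3_le:
  fixes x y z \<epsilon> :: real
  assumes "\<epsilon> > 0"
  shows "(x + y + z)\<^sup>2 \<le> (1 + \<epsilon>) * x\<^sup>2 + 2 * (1 + 1 / \<epsilon>) * (y\<^sup>2 + z\<^sup>2)"
proof -
  have "0 \<le> (\<epsilon> * x - (y + z))\<^sup>2 / \<epsilon>" using assms by simp
  then have "2 * x * (y + z) \<le> \<epsilon> * x\<^sup>2 + (y + z)\<^sup>2 / \<epsilon>"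
    using assms by (simp add: power2_eq_square field_simps)
  moreover have "(x + y + z)\<^sup>2 = x\<^sup>2 + 2 * x * (y + z) + (y + z)\<^sup>2" by (simp add: power2_eq_square algebra_simps)
  moreover have "(1 + 1 / \<epsilon>) * (y + z)\<^sup>2 = (y + z)\<^sup>2 + (y + z)\<^sup>2 / \<epsilon>" by (simp add: algebra_simps)
  moreover have "(1 + 1 / \<epsilon>) * (y + z)\<^sup>2 \<le> (1 + 1 / \<epsilon>) * (2 * (y\<^sup>2 + z\<^sup>2))"
  proof (rule mult_left_mono)
    have "0 \<le> (y - z)\<^sup>2" by simp
    then show "(y + z)\<^sup>2 \<le> 2 * (y\<^sup>2 + z\<^sup>2)" by (simp add: power2_eq_square algebra_simps)
  qed (use assms in simp)
  moreover have "(1 + 1 / \<epsilon>) * (2 * (y\<^sup>2 + z\<^sup>2)) = 2 * (1 + 1 / \<epsilon>) * (y\<^sup>2 + z\<^sup>2)" by (simp add: algebra_simps)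
  moreover have "(1 + \<epsilon>) * x\<^sup>2 = x\<^sup>2 + \<epsilon> * x\<^sup>2" by (simp add: algebra_simps)
  ultimately show ?thesis by linarith
qed

text \<open>Stability enters as an integral inequality for test functions supported in
  \<open>C\<close>, with the supersolution already eliminated; \<open>E\<close> is a continuous
  majorant of \<open>- l\<eta>\<close>. Every rescaled pair can therefore be an instance with the
  same cut-off and the same constants.\<close>

locale lane_emden = cutoff h gh lh C M for h :: "'a::euclidean_space \<Rightarrow> real" and gh lh C M +
  fixes p q \<sigma> c :: real and u v :: "'a \<Rightarrow> real" and gu gv
  assumes pq: "p > 1" "q > 0" "p * q > 1" and \<sigma>: "\<sigma> = (q + 1) / (p + 1)" and c: "c > 0"
    and u: "has_laplacian UNIV u gu (\<lambda>x. - (v x powr p))" and v: "has_laplacian UNIV v gv (\<lambda>x. - (u x powr q))"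
    and upos: "\<And>x. u x > 0" and vpos: "\<And>x. v x > 0"
    and comparison: "\<And>x. v x \<le> c * u x powr \<sigma>"
    and stability: "\<And>\<eta> g\<eta> l\<eta> E. has_laplacian UNIV \<eta> g\<eta> l\<eta> \<Longrightarrow> (\<And>x. \<eta> x \<ge> 0) \<Longrightarrow>
      (\<And>x. x \<notin> C \<Longrightarrow> \<eta> x = 0) \<Longrightarrow> (\<And>x. x \<notin> C \<Longrightarrow> g\<eta> x = 0) \<Longrightarrow> continuous_on UNIV E \<Longrightarrow>
      (\<And>x. x \<notin> C \<Longrightarrow> E x = 0) \<Longrightarrow> (\<And>x. - l\<eta> x \<le> E x) \<Longrightarrow>
      p * (\<integral>x. v x powr (p - 1) * (\<eta> x)\<^sup>2 \<partial>lborel) \<le> 1 / q * (\<integral>x. u x powr (1 - q) * (E x)\<^sup>2 \<partial>lborel)"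
begin

lemma nz: "u x \<noteq> 0" "v x \<noteq> 0" using upos[of x] vpos[of x] by auto

lemmas uvD = has_laplacianD[OF u] has_laplacianD[OF v]

text \<open>The degree of \<open>J i j k\<close> is \<open>i + \<sigma> * j\<close>: the exponent
  left when \<open>v\<close> is replaced by \<open>u powr \<sigma>\<close>. The comparison preserves
  it, and so do the leading terms of Green's identities.\<close>

definition J where "J i j k = (\<integral>x. u x powr i * v x powr j * H x ^ k \<partial>lborel)"
definition GU where "GU i j k = (\<integral>x. u x powr i * v x powr j * (norm (gu x))\<^sup>2 * H x ^ k \<partial>lborel)"
definition GV where "GV i j k = (\<integral>x. u x powr i * v x powr j * (norm (gv x))\<^sup>2 * H x ^ k \<partial>lborel)"
definition GZ where "GZ i j k = (\<integral>x. u x powr i * v x powr j * (gu x \<bullet> gv x) * H x ^ k \<partial>lborel)"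

lemma J_integrable: "k > 0 \<Longrightarrow> integrable lborel (\<lambda>x. u x powr i * v x powr j * H x ^ k)"
  using nz by (intro integrable_H continuous_intros uvD; simp)

lemma J_nonneg: "0 \<le> J i j k" and GU_nonneg: "0 \<le> GU i j k" and GV_nonneg: "0 \<le> GV i j k"
  unfolding J_def GU_def GV_def by (intro integral_nonneg_AE AE_I2 mult_nonneg_nonneg; simp add: H_bounds)+

lemma v_shift: "t \<ge> 0 \<Longrightarrow> v x powr j \<le> c powr t * u x powr (\<sigma> * t) * v x powr (j - t)"
proof -
  assume t: "t \<ge> 0"
  have "v x powr j = v x powr t * v x powr (j - t)" by (simp add: powr_add[symmetric])
  also have "v x powr t \<le> (c * u x powr \<sigma>) powr t"
    using t vpos[of x] comparison[of x] by (intro powr_mono2) auto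
  also have "(c * u x powr \<sigma>) powr t = c powr t * u x powr (\<sigma> * t)"
    using c by (simp add: powr_mult powr_powr)
  finally show ?thesis by (simp add: mult_right_mono)
qed

text \<open>The only pointwise exchange available: \<open>t \<ge> 0\<close> takes \<open>v\<close>
  powers away and adds \<open>u\<close> powers of the same degree. The exponent of \<open>v\<close>
  may be negative before or after. The new exponents are given by equations so that the lemma
  applies to any arithmetic form of them.\<close>

lemma uv_shift:
  assumes "t \<ge> 0" "i' = i + \<sigma> * t" "j' = j - t"
  shows "u x powr i * v x powr j \<le> c powr t * (u x powr i' * v x powr j')"
  using mult_left_mono[OF v_shift[OF assms(1), of x j], of "u x powr i"]
  by (simp add: assms(2,3) powr_add mult_ac)

lemma weighted_shift:
  assumes "t \<ge> 0" "i' = i + \<sigma> * t" "j' = j - t" "k > 0" and w: "continuous_on UNIV w" "\<And>x. w x \<ge> 0"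
  shows "(\<integral>x. u x powr i * v x powr j * w x * H x ^ k \<partial>lborel) \<le> c powr t * (\<integral>x. u x powr i' * v x powr j' * w x * H x ^ k \<partial>lborel)"
proof -
  have "(\<integral>x. u x powr i * v x powr j * w x * H x ^ k \<partial>lborel) \<le> (\<integral>x. c powr t * (u x powr i' * v x powr j' * w x * H x ^ k) \<partial>lborel)"
  proof (intro integral_mono integrable_mult_right integrable_H continuous_intros uvD w assms(4))
    fix x
    show "u x powr i * v x powr j * w x * H x ^ k \<le> c powr t * (u x powr i' * v x powr j' * w x * H x ^ k)"
      using mult_right_mono[OF uv_shift[OF assms(1-3), of x], of "w x * H x ^ k"] w(2) H_bounds[of x]
      by (simp add: mult.assoc)
  qed (use nz in auto)
  then show ?thesis by simp
qed

lemma J_shift: "t \<ge> 0 \<Longrightarrow> i' = i + \<sigma> * t \<Longrightarrow> j' = j - t \<Longrightarrow> k > 0 \<Longrightarrow> J i j k \<le> c powr t * J i' j' k"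
  using weighted_shift[of t i' i j' j k "\<lambda>_. 1"] by (simp add: J_def)

lemma GU_shift: "t \<ge> 0 \<Longrightarrow> i' = i + \<sigma> * t \<Longrightarrow> j' = j - t \<Longrightarrow> k > 0 \<Longrightarrow> GU i j k \<le> c powr t * GU i' j' k"
  unfolding GU_def by (intro weighted_shift continuous_intros uvD) auto

lemma GV_shift: "t \<ge> 0 \<Longrightarrow> i' = i + \<sigma> * t \<Longrightarrow> j' = j - t \<Longrightarrow> k > 0 \<Longrightarrow> GV i j k \<le> c powr t * GV i' j' k"
  unfolding GV_def by (intro weighted_shift continuous_intros uvD) auto

text \<open>All of \<open>v powr j\<close> is traded for \<open>u\<close>, which leaves a pure power
  of \<open>u\<close> whose exponent is the degree \<open>r < N\<close>; that is absorbed into the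
  top integral. The additive constant involves only exponents, \<open>M\<close>, \<open>c\<close>
  and the measure of \<open>C\<close>.\<close>

lemma J_absorb:
  assumes "j \<ge> 0" "r = i + \<sigma> * j" "0 \<le> r" "r < N" "k > 0" "real m * r \<le> N * real k" "m > 0" "\<delta> > 0"
  shows "J i j k \<le> \<delta> * J N 0 m + c powr j * absorb_const M N m r k (\<delta> / c powr j) * measure lborel C"
proof -
  let ?K = "absorb_const M N m r k (\<delta> / c powr j)"
  have cj: "c powr j > 0" using c by simp
  have iC: "integrable lborel (indicator C :: 'a \<Rightarrow> real)"
    using borel_integrable_compact[OF C(1), of "\<lambda>x. 1::real"] by simp
  have "J i j k \<le> c powr j * J r 0 k"
    using assms by (intro J_shift) auto
  also have "J r 0 k \<le> (\<integral>x. \<delta> / c powr j * (u x powr N * v x powr 0 * H x ^ m) + ?K * indicator C x \<partial>lborel)"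
    unfolding J_def
  proof (intro integral_mono Bochner_Integration.integrable_add integrable_mult_right J_integrable iC assms)
    fix x
    show "u x powr r * v x powr 0 * H x ^ k \<le> \<delta> / c powr j * (u x powr N * v x powr 0 * H x ^ m) + ?K * indicator C x"
    proof (cases "x \<in> C")
      case True
      then show ?thesis
        using absorb_const[OF assms(3-6) M(1), of "\<delta> / c powr j" "u x" "H x"] assms(8) cj upos[of x] H_bounds[of x] vpos[of x]
        by simp
    next
      case False
      then show ?thesis using assms by (simp add: H_outside power_0_left)
    qed
  qed
  also have "\<dots> = \<delta> / c powr j * J N 0 m + ?K * measure lborel C"
  proof -
    have lin: "(\<integral>x. a * f x + b * g x \<partial>lborel) = a * integral\<^sup>L lborel f + b * integral\<^sup>L lborel g"
      if "integrable lborel f" "integrable lborel g" for a b :: real and f g :: "'a \<Rightarrow> real"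
      using that by simp
    show ?thesis unfolding J_def by (subst lin[OF J_integrable[OF \<open>m > 0\<close>] iC]) simp
  qed
  finally show ?thesis using cj by (simp add: algebra_simps mult_left_mono)
qed

text \<open>Green's identity for the field \<open>u powr a * v powr (b + 1) * H ^ n * gv\<close>.
  The source term and the cut-off remainder differ in degree by \<open>q - \<sigma>\<close>.\<close>

lemma V_identity:
  assumes "n \<ge> 3" "\<epsilon> > 0" "b1 = b + 1" "b2 = b + 2" "a1 = a - 1" "aq = a + q"
  shows "\<bar>b1 * GV a b n + a * GZ a1 b1 n - J aq b1 n\<bar> \<le> \<epsilon> * GV a b n + (real n * M)\<^sup>2 / (4 * \<epsilon>) * J a b2 (n - 2)"
proof -
  have "(\<integral>x. u x powr a * v x powr (b + 1) * - (u x powr q) * H x ^ n \<partial>lborel) = - J aq b1 n"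
    unfolding J_def Bochner_Integration.integral_minus[symmetric]
    by (intro Bochner_Integration.integral_cong refl) (simp add: assms powr_add)
  then show ?thesis
    using mixed_identity[OF u upos v vpos assms(1,2), of b a]
    by (simp add: GV_def GZ_def J_def assms)
qed

text \<open>The field is now \<open>u powr (a - 1) * v powr (b + 2) * H ^ n * gu\<close>. Its
  exponents are shifted so that the mixed term \<open>GZ a1 b1 n\<close> and the remainder
  \<open>J a b2 (n - 2)\<close> are those of the previous identity; hence the mixed term can be
  eliminated between the two.\<close>

lemma U_identity:
  assumes "n \<ge> 3" "\<epsilon> > 0" "a1 = a - 1" "a2 = a - 2" "b1 = b + 1" "b2 = b + 2" "bp = b + 2 + p"
  shows "\<bar>a1 * GU a2 b2 n + b2 * GZ a1 b1 n - J a1 bp n\<bar> \<le> \<epsilon> * GU a2 b2 n + (real n * M)\<^sup>2 / (4 * \<epsilon>) * J a b2 (n - 2)"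
proof -
  have "(\<integral>x. v x powr b2 * u x powr (a2 + 1) * - (v x powr p) * H x ^ n \<partial>lborel) = - J a1 bp n"
    unfolding J_def Bochner_Integration.integral_minus[symmetric]
    by (intro Bochner_Integration.integral_cong refl) (simp add: assms powr_add)
  moreover have "(\<integral>x. v x powr b2 * u x powr a2 * (norm (gu x))\<^sup>2 * H x ^ n \<partial>lborel) = GU a2 b2 n"
    unfolding GU_def by (intro Bochner_Integration.integral_cong refl) (simp add: mult_ac)
  moreover have "(\<integral>x. v x powr (b2 - 1) * u x powr (a2 + 1) * (gv x \<bullet> gu x) * H x ^ n \<partial>lborel) = GZ a1 b1 n"
    unfolding GZ_def by (intro Bochner_Integration.integral_cong refl) (simp add: mult_ac inner_commute assms add.commute)
  moreover have "(\<integral>x. v x powr b2 * u x powr (a2 + 2) * H x ^ (n - 2) \<partial>lborel) = J a b2 (n - 2)"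
    unfolding J_def by (intro Bochner_Integration.integral_cong refl) (simp add: mult_ac assms)
  moreover have "a2 + 1 = a1" using assms by simp
  ultimately show ?thesis
    using mixed_identity[OF v vpos u upos assms(1,2), of a2 b2] by simp
qed

text \<open>Adding the two identities with weights \<open>1 - \<kappa>\<close> and \<open>a\<close> eliminates \<open>GZ\<close>; the negative
  exponent \<open>-\<kappa>\<close> of \<open>v\<close> gives both squared gradients a favourable sign.\<close>
lemma core_estimate:
  assumes "n \<ge> 3" "a > 1" "0 < \<kappa>" "\<kappa> < 1"
  shows "(1 - \<kappa>) * (J (a + q) (- \<kappa>) n + \<kappa> / 2 * GV a (- 1 - \<kappa>) n) + a * (a - 1) / 2 * GU (a - 2) (1 - \<kappa>) n
    \<le> a * J (a - 1) (1 - \<kappa> + p) n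
      + ((real n * M)\<^sup>2 / (2 * \<kappa>) + a * ((real n * M)\<^sup>2 / (2 * (a - 1)))) * J a (1 - \<kappa>) (n - 2)"
proof -
  let ?Z = "GZ (a - 1) (- \<kappa>) n" let ?L = "J a (1 - \<kappa>) (n - 2)"
  let ?P1 = "J (a + q) (- \<kappa>) n" let ?P2 = "J (a - 1) (1 - \<kappa> + p) n"
  let ?X = "GV a (- 1 - \<kappa>) n" let ?Y = "GU (a - 2) (1 - \<kappa>) n"
  let ?D1 = "(real n * M)\<^sup>2 / (2 * \<kappa>)" let ?D2 = "(real n * M)\<^sup>2 / (2 * (a - 1))"
  \<comment> \<open>Here \<open>b = - 1 - \<kappa>\<close>, so the coefficient of \<open>?X\<close>
    is \<open>- \<kappa>\<close>. Half of it pays for the cut-off term, half remains as a gain; the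
    second identity treats \<open>a - 1\<close> in the same way.\<close>
  have "\<bar>- \<kappa> * ?X + a * ?Z - ?P1\<bar> \<le> \<kappa> / 2 * ?X + (real n * M)\<^sup>2 / (4 * (\<kappa> / 2)) * ?L"
    using assms by (intro V_identity) auto
  then have 1: "?P1 + \<kappa> / 2 * ?X \<le> a * ?Z + ?D1 * ?L" by (simp add: abs_le_iff algebra_simps)
  have "\<bar>(a - 1) * ?Y + (1 - \<kappa>) * ?Z - ?P2\<bar> \<le> (a - 1) / 2 * ?Y + (real n * M)\<^sup>2 / (4 * ((a - 1) / 2)) * ?L"
    using assms by (intro U_identity[where b = "- 1 - \<kappa>"]) auto
  moreover have "4 * ((a - 1) / 2) = 2 * (a - 1)" by simp
  ultimately have "(a - 1) * ?Y + (1 - \<kappa>) * ?Z - ?P2 \<le> (a - 1) / 2 * ?Y + ?D2 * ?L"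
    unfolding abs_le_iff by metis
  moreover have "(a - 1) * ?Y = (a - 1) / 2 * ?Y + (a - 1) / 2 * ?Y" by (simp add: field_simps)
  ultimately have 2: "(1 - \<kappa>) * ?Z \<le> ?P2 + ?D2 * ?L - (a - 1) / 2 * ?Y" by linarith
  have "(1 - \<kappa>) * (?P1 + \<kappa> / 2 * ?X) \<le> (1 - \<kappa>) * (a * ?Z + ?D1 * ?L)"
    using 1 assms by (intro mult_left_mono) auto
  also have "\<dots> = a * ((1 - \<kappa>) * ?Z) + (1 - \<kappa>) * (?D1 * ?L)" by (simp add: algebra_simps)
  also have "\<dots> \<le> a * (?P2 + ?D2 * ?L - (a - 1) / 2 * ?Y) + 1 * (?D1 * ?L)"
    using 2 assms by (intro add_mono mult_left_mono mult_right_mono) (auto simp: J_nonneg)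
  finally show ?thesis by (simp add: algebra_simps)
qed

text \<open>For \<open>b \<ge> 1\<close> the power is convex, so the term with \<open>\<bar>\<nabla>f\<bar>\<^sup>2 H\<^sup>k\<close> in \<open>- \<Delta>(f\<^sup>b H\<^sup>k)\<close> is
  nonpositive and can be dropped from \<open>E\<close>.\<close>
lemma stability_power:
  assumes f: "has_laplacian UNIV f gf (\<lambda>x. - s x)" "\<And>x. f x > 0" "\<And>x. s x \<ge> 0"
    and k: "k \<ge> 3" and b: "b \<ge> 1" and \<epsilon>: "\<epsilon> > 0"
  shows "p * (\<integral>x. v x powr (p - 1) * f x powr (2 * b) * H x ^ (2 * k) \<partial>lborel)
    \<le> 1 / q * ((1 + \<epsilon>) * b\<^sup>2 * (\<integral>x. u x powr (1 - q) * f x powr (2 * b - 2) * (s x)\<^sup>2 * H x ^ (2 * k) \<partial>lborel)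
      + 2 * (1 + 1 / \<epsilon>) * ((real k * M) ^ 4 * (\<integral>x. u x powr (1 - q) * f x powr (2 * b) * H x ^ (2 * k - 4) \<partial>lborel)
        + 4 * b\<^sup>2 * (real k * M)\<^sup>2 * (\<integral>x. u x powr (1 - q) * f x powr (2 * b - 2) * (norm (gf x))\<^sup>2 * H x ^ (2 * k - 2) \<partial>lborel)))"
proof -
  note fD = has_laplacianD[OF f(1)]
  have fnz: "f x \<noteq> 0" for x using f(2)[of x] by auto
  have sc: "continuous_on UNIV s" using continuous_on_minus[OF fD(4)] by simp
  have Lf: "has_laplacian UNIV (\<lambda>x. f x powr b) (\<lambda>x. (b * f x powr (b - 1)) *\<^sub>R gf x)
      (\<lambda>x. b * f x powr (b - 1) * - s x + b * (b - 1) * f x powr (b - 2) * (norm (gf x))\<^sup>2)"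
  proof (rule has_laplacian_compose[OF f(1)])
    show "((\<lambda>y. y powr b) has_real_derivative b * f x powr (b - 1)) (at (f x))" for x
      by (rule derivative_eq_intros refl f(2))+ simp
    show "((\<lambda>y. b * y powr (b - 1)) has_real_derivative b * (b - 1) * f x powr (b - 2)) (at (f x))" for x
      by (rule derivative_eq_intros refl f(2))+ (simp add: algebra_simps)
    show "continuous_on (range f) (\<lambda>t. b * (b - 1) * t powr (b - 2))"
      by (intro continuous_intros) (metis f(2) imageE less_irrefl)
  qed
  define \<eta> where "\<eta> x = f x powr b * H x ^ k" for x
  \<comment> \<open>\<open>X\<close> comes from the equation for \<open>f\<close>, \<open>Y\<close>
    from the Laplacian of the cut-off, and \<open>Z\<close> from the cross term of the two
    gradients. Only \<open>X\<close> is of top order.\<close>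
  define X where "X x = b * f x powr (b - 1) * s x * H x ^ k" for x
  define Y where "Y x = (real k * M)\<^sup>2 * f x powr b * H x ^ (k - 2)" for x
  define Z where "Z x = 2 * b * (real k * M) * f x powr (b - 1) * norm (gf x) * H x ^ (k - 1)" for x
  have k1: "H x ^ k = H x * H x ^ (k - 1)" for x using k by (simp add: power_eq_if)
  have main: "p * (\<integral>x. v x powr (p - 1) * (\<eta> x)\<^sup>2 \<partial>lborel) \<le> 1 / q * (\<integral>x. u x powr (1 - q) * (X x + Y x + Z x)\<^sup>2 \<partial>lborel)"
    unfolding \<eta>_def
  proof (rule stability[OF has_laplacian_mult[OF Lf H_laplacian[OF k]]])
    show "continuous_on UNIV (\<lambda>x. X x + Y x + Z x)"
      unfolding X_def Y_def Z_def by (intro continuous_intros fD H_cont sc) (use fnz in auto)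
    fix x
    have "- (2 * ((b * f x powr (b - 1)) *\<^sub>R gf x \<bullet> gH k x)) \<le> 2 * b * f x powr (b - 1) * (norm (gf x) * norm (gH k x))"
    proof -
      have "- (gf x \<bullet> gH k x) \<le> norm (gf x) * norm (gH k x)"
        using Cauchy_Schwarz_ineq2[of "gf x" "gH k x"] by (simp add: abs_le_iff)
      from mult_left_mono[OF this, of "2 * b * f x powr (b - 1)"] show ?thesis using b by (simp add: mult_ac)
    qed
    also have "\<dots> \<le> 2 * b * f x powr (b - 1) * (norm (gf x) * (real k * M * H x ^ (k - 1)))"
      using b k by (intro mult_left_mono gH_bound) auto
    finally have 1: "- (2 * ((b * f x powr (b - 1)) *\<^sub>R gf x \<bullet> gH k x)) \<le> Z x"
      by (simp add: Z_def mult_ac)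
    have "f x powr b * - lH k x \<le> f x powr b * ((real k * M)\<^sup>2 * H x ^ (k - 2))"
      using lH_bound[OF k, of x] by (intro mult_left_mono) (auto simp: abs_le_iff)
    then have 2: "- (f x powr b * lH k x) \<le> Y x" by (simp add: Y_def mult_ac)
    have "0 \<le> H x ^ k * (b * (b - 1) * f x powr (b - 2) * (norm (gf x))\<^sup>2)"
      using b H_bounds(1)[of x] by (intro mult_nonneg_nonneg) auto
    then have 3: "- (H x ^ k * (b * f x powr (b - 1) * - s x + b * (b - 1) * f x powr (b - 2) * (norm (gf x))\<^sup>2)) \<le> X x"
      by (simp add: X_def algebra_simps)
    show "- (f x powr b * lH k x + H x ^ k * (b * f x powr (b - 1) * - s x + b * (b - 1) * f x powr (b - 2) * (norm (gf x))\<^sup>2)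
        + 2 * ((b * f x powr (b - 1)) *\<^sub>R gf x \<bullet> gH k x)) \<le> X x + Y x + Z x"
      using 1 2 3 by linarith
  next
    fix x assume "x \<notin> C"
    then show "f x powr b *\<^sub>R gH k x + H x ^ k *\<^sub>R (b * f x powr (b - 1)) *\<^sub>R gf x = 0"
      "f x powr b * H x ^ k = 0" "X x + Y x + Z x = 0"
      using k by (simp_all add: H_outside gH_def X_def Y_def Z_def power_0_left)
  qed (simp add: H_bounds)
  let ?I1 = "\<lambda>x. u x powr (1 - q) * f x powr (2 * b - 2) * (s x)\<^sup>2 * H x ^ (2 * k)"
  let ?I2 = "\<lambda>x. u x powr (1 - q) * f x powr (2 * b) * H x ^ (2 * k - 4)"
  let ?I3 = "\<lambda>x. u x powr (1 - q) * f x powr (2 * b - 2) * (norm (gf x))\<^sup>2 * H x ^ (2 * k - 2)"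
  have i1: "integrable lborel ?I1" and i2: "integrable lborel ?I2" and i3: "integrable lborel ?I3"
    using fnz nz k by (intro integrable_H continuous_intros uvD fD sc; simp)+
  have f2: "(f x powr b)\<^sup>2 = f x powr (2 * b)" "(f x powr (b - 1))\<^sup>2 = f x powr (2 * b - 2)" for x
    by (simp_all add: power2_eq_square powr_add[symmetric])
  have Hk: "(H x ^ k)\<^sup>2 = H x ^ (2 * k)" "(H x ^ (k - 2))\<^sup>2 = H x ^ (2 * k - 4)" "(H x ^ (k - 1))\<^sup>2 = H x ^ (2 * k - 2)" for x
    by (simp_all add: power_mult[symmetric] mult.commute diff_mult_distrib2)
  note Hk = Hk Hk(3)[unfolded One_nat_def]
  have "(\<integral>x. u x powr (1 - q) * (X x + Y x + Z x)\<^sup>2 \<partial>lborel)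
      \<le> (\<integral>x. (1 + \<epsilon>) * b\<^sup>2 * ?I1 x + 2 * (1 + 1 / \<epsilon>) * ((real k * M) ^ 4 * ?I2 x + 4 * b\<^sup>2 * (real k * M)\<^sup>2 * ?I3 x) \<partial>lborel)"
  proof (rule integral_mono')
    show "integrable lborel (\<lambda>x. (1 + \<epsilon>) * b\<^sup>2 * ?I1 x + 2 * (1 + 1 / \<epsilon>) * ((real k * M) ^ 4 * ?I2 x + 4 * b\<^sup>2 * (real k * M)\<^sup>2 * ?I3 x))"
      by (intro Bochner_Integration.integrable_add integrable_mult_right i1 i2 i3)
    fix x
    have "u x powr (1 - q) * (X x + Y x + Z x)\<^sup>2 \<le> u x powr (1 - q) * ((1 + \<epsilon>) * (X x)\<^sup>2 + 2 * (1 + 1 / \<epsilon>) * ((Y x)\<^sup>2 + (Z x)\<^sup>2))"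
      by (intro mult_left_mono square_sum3_le \<epsilon>) auto
    also have "\<dots> = (1 + \<epsilon>) * b\<^sup>2 * ?I1 x + 2 * (1 + 1 / \<epsilon>) * ((real k * M) ^ 4 * ?I2 x + 4 * b\<^sup>2 * (real k * M)\<^sup>2 * ?I3 x)"
    proof -
      have "(X x)\<^sup>2 = b\<^sup>2 * f x powr (2 * b - 2) * (s x)\<^sup>2 * H x ^ (2 * k)"
        by (simp add: X_def power_mult_distrib f2 Hk)
      moreover have "(Y x)\<^sup>2 = (real k * M) ^ 4 * f x powr (2 * b) * H x ^ (2 * k - 4)"
        unfolding Y_def power_mult_distrib[of _ "H x ^ (k - 2)"] power_mult_distrib[of "(real k * M)\<^sup>2"] f2 Hk
        by (simp add: power_mult[symmetric])
      moreover have "(Z x)\<^sup>2 = 4 * b\<^sup>2 * (real k * M)\<^sup>2 * f x powr (2 * b - 2) * (norm (gf x))\<^sup>2 * H x ^ (2 * k - 2)"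
        by (simp add: Z_def power_mult_distrib f2 Hk)
      ultimately show ?thesis by (simp add: algebra_simps)
    qed
    finally show "u x powr (1 - q) * (X x + Y x + Z x)\<^sup>2
        \<le> (1 + \<epsilon>) * b\<^sup>2 * ?I1 x + 2 * (1 + 1 / \<epsilon>) * ((real k * M) ^ 4 * ?I2 x + 4 * b\<^sup>2 * (real k * M)\<^sup>2 * ?I3 x)" .
  qed (intro add_nonneg_nonneg mult_nonneg_nonneg; use \<epsilon> H_bounds in simp)
  also have "\<dots> = (1 + \<epsilon>) * b\<^sup>2 * integral\<^sup>L lborel ?I1
      + 2 * (1 + 1 / \<epsilon>) * ((real k * M) ^ 4 * integral\<^sup>L lborel ?I2 + 4 * b\<^sup>2 * (real k * M)\<^sup>2 * integral\<^sup>L lborel ?I3)"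
  proof -
    have lin: "(\<integral>x. a * f x + b * (d * g x + e * k x) \<partial>lborel)
       = a * integral\<^sup>L lborel f + b * (d * integral\<^sup>L lborel g + e * integral\<^sup>L lborel k)"
      if "integrable lborel f" "integrable lborel g" "integrable lborel k" for a b d e :: real and f g k :: "'a \<Rightarrow> real"
      using that by simp
    show ?thesis by (rule lin[OF i1 i2 i3])
  qed
  finally have fin: "1 / q * (\<integral>x. u x powr (1 - q) * (X x + Y x + Z x)\<^sup>2 \<partial>lborel) \<le> 1 / q * \<dots>"
    using pq by (intro mult_left_mono) auto
  have e: "(\<integral>x. v x powr (p - 1) * (\<eta> x)\<^sup>2 \<partial>lborel) = (\<integral>x. v x powr (p - 1) * f x powr (2 * b) * H x ^ (2 * k) \<partial>lborel)"
    by (intro Bochner_Integration.integral_cong refl) (simp add: \<eta>_def power_mult_distrib f2 Hk)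
  show ?thesis using order_trans[OF main fin] unfolding e .
qed

text \<open>The exponent \<open>b = (q + 1) / 2\<close> cancels the weight
  \<open>u powr (1 - q)\<close>: the leading term becomes the pure power
  \<open>v powr (2 * p)\<close> and the gradient term loses its weight. \<open>q \<ge> 1\<close> is
  the convexity condition \<open>b \<ge> 1\<close>.\<close>

lemma stability_u:
  assumes "k \<ge> 3" "q \<ge> 1" "\<epsilon> > 0"
  shows "p * J (q + 1) (p - 1) (2 * k) \<le> 1 / q * ((1 + \<epsilon>) * ((q + 1) / 2)\<^sup>2 * J 0 (2 * p) (2 * k)
    + 2 * (1 + 1 / \<epsilon>) * ((real k * M) ^ 4 * J 2 0 (2 * k - 4) + 4 * ((q + 1) / 2)\<^sup>2 * (real k * M)\<^sup>2 * GU 0 0 (2 * k - 2)))"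
proof -
  have b: "2 * ((q + 1) / 2) = q + 1" "q + 1 - 2 = q - 1" by simp_all
  have "(\<integral>x. v x powr (p - 1) * u x powr (q + 1) * H x ^ (2 * k) \<partial>lborel) = J (q + 1) (p - 1) (2 * k)"
    unfolding J_def by (intro Bochner_Integration.integral_cong refl) simp
  moreover have "(\<integral>x. u x powr (1 - q) * u x powr (q - 1) * (v x powr p)\<^sup>2 * H x ^ (2 * k) \<partial>lborel) = J 0 (2 * p) (2 * k)"
    unfolding J_def by (intro Bochner_Integration.integral_cong refl) (simp add: powr_add[symmetric] power2_eq_square nz)
  moreover have "(\<integral>x. u x powr (1 - q) * u x powr (q + 1) * H x ^ (2 * k - 4) \<partial>lborel) = J 2 0 (2 * k - 4)"
    unfolding J_def by (intro Bochner_Integration.integral_cong refl) (simp add: powr_add[symmetric] nz del: powr_numeral)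
  moreover have "(\<integral>x. u x powr (1 - q) * u x powr (q - 1) * (norm (gu x))\<^sup>2 * H x ^ (2 * k - 2) \<partial>lborel) = GU 0 0 (2 * k - 2)"
    unfolding GU_def by (intro Bochner_Integration.integral_cong refl) (simp add: powr_add[symmetric] nz)
  ultimately show ?thesis
    using stability_power[OF u upos, of k "(q + 1) / 2" \<epsilon>] assms unfolding b by simp
qed

text \<open>At \<open>s = 0\<close> the two leading integrals are the energies of \<open>v\<close>
  and of \<open>u\<close>, which agree up to cut-off terms. A positive \<open>s\<close> gains
  integrability and disturbs that agreement slightly.\<close>

lemma stability_v:
  assumes "k \<ge> 3" "s \<ge> 0" "\<epsilon> > 0"
  shows "p * J 0 (p + 1 + s) (2 * k) \<le> 1 / q * ((1 + \<epsilon>) * (1 + s / 2)\<^sup>2 * J (q + 1) s (2 * k)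
    + 2 * (1 + 1 / \<epsilon>) * ((real k * M) ^ 4 * J (1 - q) (2 + s) (2 * k - 4) + 4 * (1 + s / 2)\<^sup>2 * (real k * M)\<^sup>2 * GV (1 - q) s (2 * k - 2)))"
proof -
  have b: "2 * (1 + s / 2) = 2 + s" "2 + s - 2 = s" by simp_all
  have "(\<integral>x. v x powr (p - 1) * v x powr (2 + s) * H x ^ (2 * k) \<partial>lborel) = J 0 (p + 1 + s) (2 * k)"
    unfolding J_def by (intro Bochner_Integration.integral_cong refl) (simp add: powr_add[symmetric] nz algebra_simps)
  moreover have "(\<integral>x. u x powr (1 - q) * v x powr s * (u x powr q)\<^sup>2 * H x ^ (2 * k) \<partial>lborel) = J (q + 1) s (2 * k)"
    unfolding J_def
  proof (intro Bochner_Integration.integral_cong refl)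
    fix x
    have "u x powr (1 - q) * (u x powr q)\<^sup>2 = u x powr (q + 1)"
      by (simp add: powr_add[symmetric] power2_eq_square algebra_simps)
    then show "u x powr (1 - q) * v x powr s * (u x powr q)\<^sup>2 * H x ^ (2 * k) = u x powr (q + 1) * v x powr s * H x ^ (2 * k)"
      by (simp add: mult_ac)
  qed
  moreover have "(\<integral>x. u x powr (1 - q) * v x powr (2 + s) * H x ^ (2 * k - 4) \<partial>lborel) = J (1 - q) (2 + s) (2 * k - 4)"
    by (simp add: J_def)
  moreover have "(\<integral>x. u x powr (1 - q) * v x powr s * (norm (gv x))\<^sup>2 * H x ^ (2 * k - 2) \<partial>lborel) = GV (1 - q) s (2 * k - 2)"
    by (simp add: GV_def)
  ultimately show ?thesis
    using stability_power[OF v vpos, of k "1 + s / 2" \<epsilon>] assms unfolding b by simp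
qed

end

text \<open>Derivatives cost up to four powers of the cut-off. A large exponent \<open>2 * k\<close>
  makes this loss relatively small, so that all degrees below \<open>N\<close> by at least
  \<open>g\<close> meet the condition for absorption.\<close>

lemma exists_power_exponent:
  fixes g N :: real
  assumes "g > 0"
  shows "\<exists>k\<ge>3. \<forall>r. r \<le> N - g \<longrightarrow> real (2 * k) * r \<le> N * real (2 * k - 4)"
proof -
  obtain k0 :: nat where k0: "real k0 \<ge> 2 * \<bar>N\<bar> / g" using real_arch_simple by blast
  define k where "k = max 3 k0"
  have k: "k \<ge> 3" "real k * g \<ge> 2 * \<bar>N\<bar>"
    using k0 assms by (auto simp: k_def field_simps max_def intro: order_trans)
  show ?thesis
  proof (intro exI[of _ k] conjI allI impI k)
    fix r assume r: "r \<le> N - g"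
    have "real (2 * k) * r \<le> real (2 * k) * (N - g)" using r by (intro mult_left_mono) auto
    also have "\<dots> = N * real (2 * k) - 2 * (real k * g)" by (simp add: algebra_simps)
    also have "\<dots> \<le> N * real (2 * k) - 4 * N" using k by linarith
    also have "\<dots> = N * real (2 * k - 4)" using k by (simp add: of_nat_diff algebra_simps)
    finally show "real (2 * k) * r \<le> N * real (2 * k - 4)" .
  qed
qed

text \<open>Three terms with a sixth each leave half of \<open>W\<close>, which can be subtracted
  because \<open>W\<close> is a finite number.\<close>

lemma absorb_three:
  fixes W :: real
  assumes "W \<le> K * (L1 + L2 + L3)" "K > 0" "L1 \<le> 1 / (6 * K) * W + k1" "L2 \<le> 1 / (6 * K) * W + k2" "L3 \<le> 1 / (6 * K) * W + k3"
  shows "W \<le> 2 * K * (k1 + k2 + k3)"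
proof -
  have "W \<le> K * ((1 / (6 * K) * W + k1) + (1 / (6 * K) * W + k2) + (1 / (6 * K) * W + k3))"
    using assms(2-5) by (intro order_trans[OF assms(1)] mult_left_mono) auto
  also have "\<dots> = W / 2 + K * (k1 + k2 + k3)" using assms(2) by (simp add: field_simps)
  finally show ?thesis by simp
qed

text \<open>Stability is tested with \<open>u powr ((q + 1) / 2) * H ^ k\<close>; it closes because
  \<open>(q + 1) (p + 1) < 4 p q\<close>.\<close>
lemma higher_integrability_ge1:
  fixes h :: "'a::euclidean_space \<Rightarrow> real"
  assumes exps: "p > 1" "p * q > 1" "q \<ge> 1" and \<sigma>: "\<sigma> = (q + 1) / (p + 1)" and c0: "c > 0" "c powr (p + 1) = 1 / \<sigma>"
    and cut: "cutoff h gh lh C M"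
  shows "\<exists>N>q + 1. \<exists>m>0. \<exists>K. \<forall>u v gu gv. lane_emden h gh lh C M p q \<sigma> c u v gu gv \<longrightarrow>
    lane_emden.J h u v N 0 m \<le> K"
proof -
  have \<sigma>f: "0 < \<sigma>" "\<sigma> * (p + 1) = q + 1" "\<sigma> < q" "1 < p * \<sigma>"
    using exps by (auto simp: \<sigma> field_simps)
  interpret cutoff h gh lh C M by (rule cut)
  \<comment> \<open>The common degree of both leading terms of the stability inequality,
    \<open>J 0 (2 * p)\<close> and \<open>J (q + 1) (p - 1)\<close>.\<close>
  define N where "N = 2 * p * \<sigma>"
  define b where "b = (q + 1) / 2"
  have Nq: "N = 2 * (q + 1) - 2 * \<sigma>" using \<sigma>f(2) by (simp add: N_def algebra_simps)
  have N1: "N > q + 1" "N > q" "N - q > 1"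
  proof -
    have "2 * \<sigma> < q + 1" using \<sigma>f(1,2) exps(1) mult_strict_left_mono[of 2 "p + 1" \<sigma>] by (simp add: mult.commute)
    then show "N > q + 1" "N > q" "N - q > 1" by (auto simp: Nq)
  qed
  \<comment> \<open>The three entries are the gaps between \<open>N\<close> and the degrees of the
    lower-order integrals \<open>?L1\<close>, \<open>?L2\<close> and \<open>?L3\<close>
    below.\<close>
  define g where "g = min (min (N - 2) (N - (1 + p * \<sigma>))) (q - \<sigma>)"
  have g: "g > 0" using \<sigma>f by (auto simp: g_def N_def mult.commute)
  obtain k where k: "k \<ge> 3" "\<And>r. r \<le> N - g \<Longrightarrow> real (2 * k) * r \<le> N * real (2 * k - 4)"
    using exists_power_exponent[OF g] by blast
  define m where "m = 2 * k"
  have m: "m \<ge> 6" using k by (simp add: m_def)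
  have b2: "b\<^sup>2 / \<sigma> < p * q"
  proof -
    have "(q + 1) * (p + 1) < 4 * (p * q)"
    proof -
      have "(q + 1) * (p + 1) < (q + 1) * (2 * p)" using exps by (intro mult_strict_left_mono) auto
      also have "\<dots> \<le> (2 * q) * (2 * p)" using exps by (intro mult_right_mono) auto
      finally show ?thesis by (simp add: mult.commute)
    qed
    moreover have "b\<^sup>2 / \<sigma> = (q + 1) * (p + 1) / 4"
      using exps by (simp add: b_def \<sigma> power2_eq_square field_simps)
    ultimately show ?thesis by linarith
  qed
  define r where "r = b\<^sup>2 / \<sigma>"
  have b0: "r > 0" using exps \<sigma>f by (simp add: b_def r_def)
  have b2: "r < p * q" using b2 by (simp add: r_def)
  \<comment> \<open>Half of the available room: with it \<open>\<omega>\<close> is the mean of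
    \<open>r\<close> and \<open>p * q\<close>.\<close>
  define \<epsilon> where "\<epsilon> = (p * q / r - 1) / 2"
  have \<epsilon>: "\<epsilon> > 0" using b2 b0 by (simp add: \<epsilon>_def less_divide_eq_1_pos)
  define \<omega> where "\<omega> = (1 + \<epsilon>) * r"
  have \<omega>: "\<omega> < p * q"
  proof -
    have "\<omega> = (p * q + r) / 2" using b0 by (simp add: \<omega>_def \<epsilon>_def field_simps)
    then show ?thesis using b2 by simp
  qed
  define E1 where "E1 = 2 * (1 + 1 / \<epsilon>) * (real k * M) ^ 4"
  define E2 where "E2 = 2 * (1 + 1 / \<epsilon>) * (4 * b\<^sup>2 * (real k * M)\<^sup>2)"
  define D where "D = (real (m - 2) * M)\<^sup>2"
  have E: "E1 \<ge> 0" "E2 \<ge> 0" "D \<ge> 0" using \<epsilon> by (auto simp: E1_def E2_def D_def)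
  define K3 where "K3 = (E1 + E2 * D + 2 * E2) / (p * q - \<omega>)"
  have K3: "K3 \<ge> 0" using E \<omega> by (simp add: K3_def)
  \<comment> \<open>This gives \<open>J (a + q) (- 1/2)\<close> the degree \<open>N\<close>, so that
    the comparison bounds the integral of \<open>u powr N\<close> by it.\<close>
  define a where "a = N - q + \<sigma> / 2"
  have a: "a > 1" using N1 \<sigma>f by (simp add: a_def)
  define K4 where "K4 = (real m * M)\<^sup>2 / (2 * (1/2)) + a * ((real m * M)\<^sup>2 / (2 * (a - 1)))"
  have K4: "K4 \<ge> 0" using a by (simp add: K4_def)
  define K5 where "K5 = 2 * c powr (1/2) * (a * c powr (3/2) * K3 + K4) + 1"
  have K5: "K5 > 0" using K3 K4 a by (simp add: K5_def add_nonneg_pos)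
  define \<delta> where "\<delta> = 1 / (6 * K5)"
  have \<delta>: "\<delta> > 0" using K5 by (simp add: \<delta>_def)
  have gle: "g \<le> N - 2" "g \<le> N - (1 + p * \<sigma>)" "g \<le> q - \<sigma>" by (auto simp: g_def)
  have rN: "2 \<le> N - g" "1 + \<sigma> * p \<le> N - g" "a + \<sigma> / 2 \<le> N - g"
    using gle by (auto simp: a_def mult.commute)
  define \<kappa> where "\<kappa> j r k = c powr j * absorb_const M N m r k (\<delta> / c powr j) * measure lborel C" for j r k
  have deg: "real m * r \<le> N * real (m - 4)" "real m * r \<le> N * real (m - 2)" if "r \<le> N - g" for r
  proof -
    show "real m * r \<le> N * real (m - 4)" using k(2)[OF that] by (simp add: m_def)
    also have "\<dots> \<le> N * real (m - 2)" using N1 exps by (intro mult_left_mono) auto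
    finally show "real m * r \<le> N * real (m - 2)" .
  qed
  have "lane_emden.J h u v N 0 m \<le> 2 * K5 * (\<kappa> 0 2 (m - 4) + \<kappa> p (1 + \<sigma> * p) (m - 2) + \<kappa> (1/2) (a + \<sigma> / 2) (m - 2))"
    if "lane_emden h gh lh C M p q \<sigma> c u v gu gv" for u v gu gv
  proof -
    interpret lane_emden h gh lh C M p q \<sigma> c u v gu gv by (rule that)
    let ?W = "J N 0 m" let ?L1 = "J 2 0 (m - 4)" let ?L2 = "J 1 p (m - 2)" let ?L3 = "J a (1/2) (m - 2)"
    let ?A = "J (q + 1) (p - 1) m" let ?G = "GU 0 0 (m - 2)" let ?Q = "J 0 (2 * p) m"
    have L1: "?L1 \<le> \<delta> * ?W + \<kappa> 0 2 (m - 4)"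
      unfolding \<kappa>_def by (rule J_absorb) (use \<delta> m deg[OF rN(1)] rN g in auto)
    have L2: "?L2 \<le> \<delta> * ?W + \<kappa> p (1 + \<sigma> * p) (m - 2)"
      unfolding \<kappa>_def by (rule J_absorb) (use \<delta> m deg[OF rN(2)] rN g \<sigma>f exps in auto)
    have L3: "?L3 \<le> \<delta> * ?W + \<kappa> (1/2) (a + \<sigma> / 2) (m - 2)"
      unfolding \<kappa>_def by (rule J_absorb) (use \<delta> m deg[OF rN(3)] rN g \<sigma>f a in auto)
    have "p * ?A \<le> 1 / q * ((1 + \<epsilon>) * b\<^sup>2 * ?Q + 2 * (1 + 1 / \<epsilon>) * ((real k * M) ^ 4 * ?L1 + 4 * b\<^sup>2 * (real k * M)\<^sup>2 * ?G))"
      unfolding m_def b_def by (rule stability_u) (use k exps \<epsilon> in auto)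
    then have h1: "p * q * ?A \<le> (1 + \<epsilon>) * b\<^sup>2 * ?Q + (E1 * ?L1 + E2 * ?G)"
      using exps unfolding E1_def E2_def by (simp add: field_simps)
    have "?Q \<le> c powr (p + 1) * ?A"
      by (rule J_shift) (use exps m \<sigma>f in auto)
    then have "(1 + \<epsilon>) * b\<^sup>2 * ?Q \<le> (1 + \<epsilon>) * b\<^sup>2 * (c powr (p + 1) * ?A)"
      using \<epsilon> by (intro mult_left_mono) auto
    then have h2: "(1 + \<epsilon>) * b\<^sup>2 * ?Q \<le> \<omega> * ?A" by (simp add: c0(2) \<omega>_def r_def)
    \<comment> \<open>For \<open>b = - 2\<close> the coefficient \<open>b + 2\<close> of the mixed
      term is zero, so the unweighted gradient integral is bounded by lower-order integrals
      alone.\<close>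
    have "\<bar>1 * ?G + 0 * GZ 1 (-1) (m - 2) - ?L2\<bar> \<le> 1/2 * ?G + (real (m - 2) * M)\<^sup>2 / (4 * (1/2)) * J 2 0 (m - 2 - 2)"
      by (rule U_identity[where b = "-2"]) (use m in auto)
    then have h3: "?G \<le> 2 * ?L2 + D * ?L1"
      using m by (simp add: D_def abs_le_iff)
    have "(p * q - \<omega>) * ?A \<le> (E1 + E2 * D + 2 * E2) * (?L1 + ?L2)"
    proof -
      have "E2 * ?G \<le> E2 * (2 * ?L2 + D * ?L1)" using h3 E by (intro mult_left_mono) auto
      then have "(p * q - \<omega>) * ?A \<le> E1 * ?L1 + E2 * (2 * ?L2 + D * ?L1)"
        using h1 h2 by (simp add: algebra_simps)
      also have "\<dots> \<le> E1 * ?L1 + E2 * (2 * ?L2 + D * ?L1) + (E1 * ?L2 + E2 * D * ?L2 + 2 * E2 * ?L1)"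
        using E by (simp add: J_nonneg)
      also have "\<dots> = (E1 + E2 * D + 2 * E2) * (?L1 + ?L2)" by (simp add: algebra_simps)
      finally show ?thesis .
    qed
    then have A: "?A \<le> K3 * (?L1 + ?L2)"
      using \<omega> by (simp add: K3_def field_simps)
    have P1: "J (a + q) (- (1/2)) m \<le> 2 * (a * J (a - 1) (1/2 + p) m + K4 * ?L3)"
    proof -
      have lin: "P \<le> 2 * r" if "(1 - 1/2) * (P + (1/2) / 2 * X) + Y \<le> r" "0 \<le> X" "0 \<le> Y" for P X Y r :: real
        using that by (simp add: add_divide_distrib)
      have "(1 - 1/2) * (J (a + q) (- (1/2)) m + (1/2) / 2 * GV a (- 1 - 1/2) m) + a * (a - 1) / 2 * GU (a - 2) (1 - 1/2) m
        \<le> a * J (a - 1) (1 - 1/2 + p) m + K4 * J a (1 - 1/2) (m - 2)"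
        unfolding K4_def using m a by (intro core_estimate) auto
      from lin[OF this GV_nonneg] have "J (a + q) (- (1/2)) m \<le> 2 * (a * J (a - 1) (1 - 1/2 + p) m + K4 * J a (1 - 1/2) (m - 2))"
        using a by (simp add: GU_nonneg)
      moreover have "1 - 1/2 + p = 1/2 + p" "1 - 1/2 = (1/2::real)" by simp_all
      ultimately show ?thesis by metis
    qed
    have "?W \<le> c powr (1/2) * J (a + q) (- (1/2)) m"
      by (rule J_shift) (use m in \<open>auto simp: a_def\<close>)
    also have "\<dots> \<le> c powr (1/2) * (2 * (a * J (a - 1) (1/2 + p) m + K4 * ?L3))"
      using P1 by (intro mult_left_mono) auto
    also have "J (a - 1) (1/2 + p) m \<le> c powr (3/2) * ?A"
      by (rule J_shift) (use m in \<open>auto simp: a_def Nq\<close>)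
    also have "c powr (3/2) * ?A \<le> c powr (3/2) * (K3 * (?L1 + ?L2))"
      using A by (intro mult_left_mono) auto
    also have "c powr (1/2) * (2 * (a * (c powr (3/2) * (K3 * (?L1 + ?L2))) + K4 * ?L3))
        \<le> K5 * (?L1 + ?L2 + ?L3)"
    proof -
      let ?x = "2 * c powr (1/2) * (a * c powr (3/2) * K3)" let ?y = "2 * c powr (1/2) * K4"
      have xy: "?x \<ge> 0" "?y \<ge> 0" using a K3 K4 by simp_all
      have "c powr (1/2) * (2 * (a * (c powr (3/2) * (K3 * (?L1 + ?L2))) + K4 * ?L3)) = ?x * (?L1 + ?L2) + ?y * ?L3"
        by (simp add: algebra_simps)
      also have "\<dots> \<le> ?x * (?L1 + ?L2) + ?y * ?L3 + (?x * ?L3 + ?y * (?L1 + ?L2) + (?L1 + ?L2 + ?L3))"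
        using xy by (simp add: J_nonneg)
      also have "\<dots> = K5 * (?L1 + ?L2 + ?L3)" by (simp add: K5_def algebra_simps)
      finally show ?thesis .
    qed
    finally have W: "?W \<le> K5 * (?L1 + ?L2 + ?L3)"
      using a by (simp add: mult_left_mono)
    show ?thesis
      by (rule absorb_three[OF W K5 L1[unfolded \<delta>_def] L2[unfolded \<delta>_def] L3[unfolded \<delta>_def]])
  qed
  moreover have "m > 0" using m by simp
  ultimately show ?thesis using N1 by blast
qed

text \<open>Stability is tested with \<open>v powr (1 + s / 2) * H ^ k\<close>. Replacing \<open>\<integral>u\<^sup>q\<^sup>+\<^sup>1 v\<^sup>s\<close> by
  \<open>\<integral>v\<^sup>p\<^sup>+\<^sup>1\<^sup>+\<^sup>s\<close> costs a factor \<open>1 + O(s)\<close> with a constant \<open>C0\<close> independent of \<open>s\<close>, so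
  \<open>p q > 1\<close> leaves room for some \<open>s > 0\<close>.\<close>
lemma higher_integrability_le1:
  fixes h :: "'a::euclidean_space \<Rightarrow> real"
  assumes exps: "p > 1" "p * q > 1" "0 < q" "q \<le> 1" and \<sigma>: "\<sigma> = (q + 1) / (p + 1)" and c0: "c > 0"
    and cut: "cutoff h gh lh C M"
  shows "\<exists>N>q + 1. \<exists>m>0. \<exists>K. \<forall>u v gu gv. lane_emden h gh lh C M p q \<sigma> c u v gu gv \<longrightarrow>
    lane_emden.J h u v N 0 m \<le> K"
proof -
  have \<sigma>f: "0 < \<sigma>" "\<sigma> * (p + 1) = q + 1" "\<sigma> < q" "1 < p * \<sigma>"
    using exps by (auto simp: \<sigma> field_simps)
  interpret cutoff h gh lh C M by (rule cut)
  \<comment> \<open>With \<open>\<kappa> = 1/2 - s\<close> chosen later,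
    \<open>J (a + q) (- \<kappa>)\<close> has degree \<open>q + 1 + \<sigma> * s\<close>, while
    \<open>a\<close> itself does not depend on \<open>s\<close>.\<close>
  define a where "a = 1 + \<sigma> / 2"
  have a: "1 < a" "a \<le> 2" using \<sigma>f exps by (auto simp: a_def)
  \<comment> \<open>Fixed before \<open>s\<close>, to avoid a circular choice: \<open>32\<close> is
    twice the factor in the bound of \<open>?X\<close> and \<open>4 / \<sigma>\<close> the factor in
    that of \<open>?Y\<close>, both valid for all \<open>s \<le> 1/4\<close>.\<close>
  define C1 where "C1 = c powr (1/2) * (32 + 4 / \<sigma>)"
  have C1: "C1 \<ge> 0" using \<sigma>f by (simp add: C1_def)
  define C0 where "C0 = C1 * (2 * c powr (p + 1/2))"
  have C0: "C0 \<ge> 0" using C1 by (simp add: C0_def)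
  \<comment> \<open>At \<open>s = 0\<close> the inequality reads \<open>1 < p * q\<close>, so it
    persists for small positive \<open>s\<close>.\<close>
  have "\<exists>s. 0 < s \<and> s \<le> 1/4 \<and> (1 + s) * (1 + s / 2)\<^sup>2 < p * q * (1 - s * C0)"
  proof -
    have "((\<lambda>s. p * q * (1 - s * C0) - (1 + s) * (1 + s / 2)\<^sup>2) \<longlongrightarrow> p * q * (1 - 0 * C0) - (1 + 0) * (1 + 0 / 2)\<^sup>2) (at_right 0)"
      by (intro tendsto_intros) auto
    then have "eventually (\<lambda>s. p * q * (1 - s * C0) - (1 + s) * (1 + s / 2)\<^sup>2 > 0) (at_right 0)"
      by (rule order_tendstoD(1)) (use exps in simp)
    moreover have "eventually (\<lambda>s. s \<in> {0<..<1/4::real}) (at_right 0)"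
      by (rule eventually_at_right_real) simp
    ultimately have "eventually (\<lambda>s. 0 < s \<and> s \<le> 1/4 \<and> (1 + s) * (1 + s / 2)\<^sup>2 < p * q * (1 - s * C0)) (at_right 0)"
      by eventually_elim auto
    then show ?thesis using eventually_happens'[OF trivial_limit_at_right_real] by blast
  qed
  then obtain s where s: "0 < s" "s \<le> 1/4" "(1 + s) * (1 + s / 2)\<^sup>2 < p * q * (1 - s * C0)" by blast
  \<comment> \<open>The leading factor of the stability inequality, in which \<open>s\<close> also
    plays the part of \<open>\<epsilon>\<close>.\<close>
  define t where "t = (1 + s) * (1 + s / 2)\<^sup>2"
  have t: "0 < t" "t < p * q * (1 - s * C0)" using s by (auto simp: t_def)
  define N where "N = q + 1 + \<sigma> * s"
  have N1: "N > q + 1" using \<sigma>f s by (simp add: N_def)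
  obtain k where k: "k \<ge> 3" "\<And>r. r \<le> N - (q - \<sigma>) \<Longrightarrow> real (2 * k) * r \<le> N * real (2 * k - 4)"
    using exists_power_exponent[of "q - \<sigma>" N] \<sigma>f by auto
  define m where "m = 2 * k"
  have m: "m \<ge> 6" using k by (simp add: m_def)
  have deg: "real m * r \<le> N * real (m - 4)" "real m * r \<le> N * real (m - 2)" if "r \<le> N - (q - \<sigma>)" for r
  proof -
    show "real m * r \<le> N * real (m - 4)" using k(2)[OF that] by (simp add: m_def)
    also have "\<dots> \<le> N * real (m - 2)" using N1 exps by (intro mult_left_mono) auto
    finally show "real m * r \<le> N * real (m - 2)" .
  qed
  define E1 where "E1 = 2 * (1 + 1 / s) * (real k * M) ^ 4"
  define E2 where "E2 = 2 * (1 + 1 / s) * (4 * (1 + s / 2)\<^sup>2 * (real k * M)\<^sup>2)"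
  define D1 where "D1 = (real (m - 2) * M)\<^sup>2 / (4 * (1/2))"
  define D2 where "D2 = (real (m - 2) * M)\<^sup>2 / (4 * q)"
  define D3 where "D3 = (real m * M)\<^sup>2 / (4 * s)"
  define \<kappa> where "\<kappa> = 1/2 - s"
  have \<kappa>: "1/4 \<le> \<kappa>" "\<kappa> < 1/2" using s by (auto simp: \<kappa>_def)
  define K4 where "K4 = (real m * M)\<^sup>2 / (2 * \<kappa>) + a * ((real m * M)\<^sup>2 / (2 * (a - 1)))"
  have K: "E1 \<ge> 0" "E2 \<ge> 0" "D1 \<ge> 0" "D2 \<ge> 0" "D3 \<ge> 0" "K4 \<ge> 0"
    using s \<kappa> a exps by (auto simp: E1_def E2_def D1_def D2_def D3_def K4_def)
  define F where "F = E1 + E2 * (2 + 2 * (D1 + D2)) + p * q * (s * C1 * K4 + 2 * D3)"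
  have F: "F \<ge> 0" using K C1 s exps by (simp add: F_def)
  define K6 where "K6 = F / (p * q * (1 - s * C0) - t)"
  have K6: "K6 \<ge> 0" using F t by (simp add: K6_def)
  define K5 where "K5 = c powr \<kappa> * 2 * (2 * c powr (p + 1/2) * K6 + K4) + 1"
  have K5: "K5 > 0" using K6 K by (simp add: K5_def add_nonneg_pos)
  define \<delta> where "\<delta> = 1 / (6 * K5)"
  have \<delta>: "\<delta> > 0" using K5 by (simp add: \<delta>_def)
  define \<mu> where "\<mu> j r k = c powr j * absorb_const M N m r k (\<delta> / c powr j) * measure lborel C" for j r k
  have "lane_emden.J h u v N 0 m \<le> 2 * K5 * (\<mu> (2 + s) (1 - q + \<sigma> * (2 + s)) (m - 4)
      + \<mu> (1 + s) (1 + \<sigma> * (1 + s)) (m - 2) + \<mu> (1/2 + s) (a + \<sigma> * (1/2 + s)) (m - 2))"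
    if "lane_emden h gh lh C M p q \<sigma> c u v gu gv" for u v gu gv
  proof -
    interpret lane_emden h gh lh C M p q \<sigma> c u v gu gv by (rule that)
    let ?W = "J N 0 m" let ?L1 = "J (1 - q) (2 + s) (m - 4)" let ?L2 = "J 1 (1 + s) (m - 2)" let ?L3 = "J a (1/2 + s) (m - 2)"
    let ?A = "J (q + 1) s m" let ?B = "J 0 (p + 1 + s) m" let ?G = "GV (1 - q) s (m - 2)"
    have "0 \<le> 1 - q + \<sigma> * (2 + s)" using exps \<sigma>f s by simp
    then have L1: "?L1 \<le> \<delta> * ?W + \<mu> (2 + s) (1 - q + \<sigma> * (2 + s)) (m - 4)"
      unfolding \<mu>_def by (intro J_absorb)
        (use \<delta> m deg(1)[of "1 - q + \<sigma> * (2 + s)"] \<sigma>f exps s in \<open>auto simp: N_def algebra_simps\<close>)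
    have L2: "?L2 \<le> \<delta> * ?W + \<mu> (1 + s) (1 + \<sigma> * (1 + s)) (m - 2)"
      unfolding \<mu>_def by (rule J_absorb)
        (use \<delta> m deg(2)[of "1 + \<sigma> * (1 + s)"] \<sigma>f exps s in \<open>auto simp: N_def algebra_simps add_nonneg_nonneg\<close>)
    have L3: "?L3 \<le> \<delta> * ?W + \<mu> (1/2 + s) (a + \<sigma> * (1/2 + s)) (m - 2)"
      unfolding \<mu>_def by (rule J_absorb)
        (use \<delta> m deg(2)[of "a + \<sigma> * (1/2 + s)"] \<sigma>f exps s in \<open>auto simp: N_def a_def algebra_simps add_nonneg_nonneg\<close>)
    have "p * ?B \<le> 1 / q * ((1 + s) * (1 + s / 2)\<^sup>2 * ?A
        + 2 * (1 + 1 / s) * ((real k * M) ^ 4 * ?L1 + 4 * (1 + s / 2)\<^sup>2 * (real k * M)\<^sup>2 * ?G))"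
      unfolding m_def by (rule stability_v) (use k s in auto)
    then have h1: "p * q * ?B \<le> t * ?A + (E1 * ?L1 + E2 * ?G)"
      using exps unfolding E1_def E2_def t_def by (simp add: field_simps)
    have h2: "?G \<le> 2 * ?L2 + 2 * (D1 + D2) * ?L1"
    proof -
      let ?Z = "GZ (- q) (1 + s) (m - 2)" let ?Y = "GU (- 1 - q) (2 + s) (m - 2)"
      have "\<bar>(1 + s) * ?G + (1 - q) * ?Z - ?L2\<bar> \<le> 1/2 * ?G + D1 * J (1 - q) (2 + s) (m - 2 - 2)"
        unfolding D1_def by (rule V_identity) (use m in auto)
      then have 1: "(1 + s) * ?G \<le> 1/2 * ?G + D1 * ?L1 + ?L2 - (1 - q) * ?Z"
        by (simp add: abs_le_iff)
      \<comment> \<open>With \<open>\<epsilon> = q\<close> the gradient term \<open>- q * ?Y\<close>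
        cancels exactly. The remaining \<open>J\<close> integral is nonnegative, so a lower bound
        for the mixed term is left, as needed for its coefficient
        \<open>1 - q \<ge> 0\<close>.\<close>
      have "\<bar>- q * ?Y + (2 + s) * ?Z - J (- q) (s + 2 + p) (m - 2)\<bar> \<le> q * ?Y + D2 * J (1 - q) (2 + s) (m - 2 - 2)"
        unfolding D2_def by (rule U_identity[where b = s]) (use m exps in auto)
      then have "J (- q) (s + 2 + p) (m - 2) - q * ?Y - (- q * ?Y + (2 + s) * ?Z) \<le> D2 * ?L1"
        by (simp add: abs_le_iff)
      then have "- ((2 + s) * ?Z) \<le> D2 * ?L1"
        using J_nonneg[of "- q" "s + 2 + p" "m - 2"] by simp
      moreover have "- ?Z \<le> max 0 (- ((2 + s) * ?Z))"
      proof (cases "?Z \<ge> 0")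
        case False
        then have "1 * (- ?Z) \<le> (2 + s) * (- ?Z)" using s by (intro mult_right_mono) auto
        then show ?thesis by simp
      qed simp
      moreover have "0 \<le> D2 * ?L1" using K by (simp add: J_nonneg)
      ultimately have "- ?Z \<le> D2 * ?L1" by linarith
      then have "(1 - q) * (- ?Z) \<le> (1 - q) * (D2 * ?L1)" using exps by (intro mult_left_mono) auto
      also have "\<dots> \<le> 1 * (D2 * ?L1)" using exps K by (intro mult_right_mono) (auto simp: J_nonneg)
      finally have "(1 + s) * ?G \<le> 1/2 * ?G + (D1 + D2) * ?L1 + ?L2"
        using 1 by (simp add: algebra_simps)
      moreover have "1 * ?G \<le> (1 + s) * ?G" using s GV_nonneg by (intro mult_right_mono) auto
      moreover have "2 * (D1 + D2) * ?L1 = (D1 + D2) * ?L1 + (D1 + D2) * ?L1" by (simp add: algebra_simps)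
      ultimately show ?thesis by linarith
    qed
    let ?X = "GV a (- 1 - \<kappa>) m" let ?Y = "GU (a - 2) (1 - \<kappa>) m" let ?P1 = "J (a + q) (- \<kappa>) m"
    let ?P2 = "J (a - 1) (1 - \<kappa> + p) m"
    have core: "(1 - \<kappa>) * (?P1 + \<kappa> / 2 * ?X) + a * (a - 1) / 2 * ?Y \<le> a * ?P2 + K4 * ?L3"
    proof -
      have "1 - \<kappa> = 1/2 + s" by (simp add: \<kappa>_def)
      then show ?thesis using core_estimate[of m a \<kappa>] m a \<kappa> by (simp add: K4_def)
    qed
    then have core: "(1 - \<kappa>) * ?P1 + (1 - \<kappa>) * (\<kappa> / 2 * ?X) + a * (a - 1) / 2 * ?Y \<le> a * ?P2 + K4 * ?L3"
      by (simp only: distrib_left)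
    have P2: "?P2 \<le> c powr (p + 1/2) * ?A"
    proof (rule J_shift)
      have "q + 1 = \<sigma> * p + \<sigma>" using \<sigma>f(2) by (simp add: algebra_simps)
      then show "q + 1 = a - 1 + \<sigma> * (p + 1/2)" by (simp add: a_def algebra_simps)
    qed (use m exps in \<open>auto simp: \<kappa>_def\<close>)
    have RHS: "a * ?P2 + K4 * ?L3 \<le> 2 * c powr (p + 1/2) * ?A + K4 * ?L3"
      using a P2 mult_mono[of a 2 ?P2 "c powr (p + 1/2) * ?A"] by (simp add: J_nonneg)
    have Yn: "0 \<le> a * (a - 1) / 2 * ?Y" and Xn: "0 \<le> (1 - \<kappa>) * (\<kappa> / 2 * ?X)" and P1n: "0 \<le> (1 - \<kappa>) * ?P1"
      using a \<kappa> by (simp_all add: GU_nonneg GV_nonneg J_nonneg)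
    have P1: "?P1 \<le> 2 * (2 * c powr (p + 1/2) * ?A + K4 * ?L3)"
    proof -
      have "1/2 * ?P1 \<le> (1 - \<kappa>) * ?P1" using \<kappa> by (intro mult_right_mono) (auto simp: J_nonneg)
      moreover have "P \<le> 2 * r" if "1/2 * P \<le> x" "x + y + z \<le> w" "w \<le> r" "0 \<le> y" "0 \<le> z" for P x y z w r :: real
        using that by linarith
      ultimately show ?thesis using core RHS Xn Yn by blast
    qed
    have X: "?X \<le> 16 * (2 * c powr (p + 1/2) * ?A + K4 * ?L3)"
    proof -
      have "1/2 * (1/8 * ?X) \<le> (1 - \<kappa>) * (\<kappa> / 2 * ?X)"
        using \<kappa> by (intro mult_right_mono mult_mono) (auto simp: GV_nonneg)
      moreover have "P \<le> 16 * r" if "1/2 * (1/8 * P) \<le> y" "x + y + z \<le> w" "w \<le> r" "0 \<le> x" "0 \<le> z" for P x y z w r :: real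
        using that by linarith
      ultimately show ?thesis using core RHS P1n Yn by blast
    qed
    have Y: "?Y \<le> 4 / \<sigma> * (2 * c powr (p + 1/2) * ?A + K4 * ?L3)"
    proof -
      have "\<sigma> / 4 * ?Y \<le> a * (a - 1) / 2 * ?Y"
      proof (rule mult_right_mono)
        have "1 * (\<sigma> / 2) / 2 \<le> a * (\<sigma> / 2) / 2" using a \<sigma>f by (intro divide_right_mono mult_right_mono) auto
        then show "\<sigma> / 4 \<le> a * (a - 1) / 2" by (simp add: a_def)
      qed (rule GU_nonneg)
      moreover have "P \<le> r" if "P \<le> z" "x + y + z \<le> w" "w \<le> r" "0 \<le> x" "0 \<le> y" for P x y z w r :: real
        using that by linarith
      ultimately have "\<sigma> / 4 * ?Y \<le> 2 * c powr (p + 1/2) * ?A + K4 * ?L3"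
        using core RHS P1n Xn by blast
      then show ?thesis using \<sigma>f by (simp add: field_simps)
    qed
    let ?X' = "GV 1 (s - 1) m" let ?Y' = "GU (- 1) (1 + s) m" let ?Z' = "GZ 0 s m"
    have "?X' \<le> c powr (1/2) * ?X" by (rule GV_shift) (use m in \<open>auto simp: a_def \<kappa>_def\<close>)
    moreover have "?Y' \<le> c powr (1/2) * ?Y" by (rule GU_shift) (use m in \<open>auto simp: a_def \<kappa>_def\<close>)
    ultimately have "2 * ?X' + ?Y' \<le> c powr (1/2) * (2 * ?X + ?Y)" by (simp add: algebra_simps)
    also have "\<dots> \<le> c powr (1/2) * ((32 + 4 / \<sigma>) * (2 * c powr (p + 1/2) * ?A + K4 * ?L3))"
      using X Y by (intro mult_left_mono) (auto simp: algebra_simps)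
    finally have XY: "2 * ?X' + ?Y' \<le> C0 * ?A + C1 * K4 * ?L3"
      by (simp add: C0_def C1_def algebra_simps)
    \<comment> \<open>\<open>?A\<close> and \<open>?B\<close> are compared through the same mixed
      integral \<open>?Z'\<close>: this identity relates it to \<open>?A\<close>. The gradient term
      has the small coefficient \<open>s\<close>.\<close>
    have "\<bar>s * ?X' + 1 * ?Z' - ?A\<bar> \<le> s * ?X' + D3 * ?L2"
      unfolding D3_def by (rule V_identity) (use m s in auto)
    then have h3: "?A \<le> 2 * s * ?X' + ?Z' + D3 * ?L2" by (simp add: abs_le_iff)
    \<comment> \<open>For \<open>a = 1\<close> the identity itself has no gradient term, so
      \<open>?Y'\<close> enters only through Young's inequality, again with factor
      \<open>s\<close>.\<close>
    have "\<bar>0 * ?Y' + (1 + s) * ?Z' - ?B\<bar> \<le> s * ?Y' + D3 * ?L2"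
      unfolding D3_def by (rule U_identity[where b = "s - 1"]) (use m s in auto)
    then have "(1 + s) * ?Z' \<le> ?B + s * ?Y' + D3 * ?L2" by (simp add: abs_le_iff)
    moreover have "?Z' \<le> max 0 ((1 + s) * ?Z')"
    proof (cases "?Z' \<ge> 0")
      case True
      then have "1 * ?Z' \<le> (1 + s) * ?Z'" using s by (intro mult_right_mono) auto
      then show ?thesis by simp
    qed simp
    ultimately have "?Z' \<le> ?B + s * ?Y' + D3 * ?L2"
      using s K by (simp add: J_nonneg GU_nonneg max_def split: if_splits) (smt (verit) GU_nonneg J_nonneg mult_nonneg_nonneg)
    then have "?A \<le> ?B + s * (2 * ?X' + ?Y') + 2 * D3 * ?L2" using h3 by (simp add: algebra_simps)
    also have "\<dots> \<le> ?B + s * (C0 * ?A + C1 * K4 * ?L3) + 2 * D3 * ?L2"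
      using XY s by (simp add: mult_left_mono)
    finally have h4: "(1 - s * C0) * ?A \<le> ?B + (s * C1 * K4 * ?L3 + 2 * D3 * ?L2)"
      by (simp add: algebra_simps)
    have "p * q * ((1 - s * C0) * ?A) \<le> p * q * (?B + (s * C1 * K4 * ?L3 + 2 * D3 * ?L2))"
      using h4 exps by (intro mult_left_mono) auto
    also have "\<dots> = p * q * ?B + p * q * (s * C1 * K4 * ?L3 + 2 * D3 * ?L2)" by (simp add: algebra_simps)
    also have "\<dots> \<le> t * ?A + (E1 * ?L1 + E2 * ?G) + p * q * (s * C1 * K4 * ?L3 + 2 * D3 * ?L2)"
      using h1 by simp
    also have "E2 * ?G \<le> E2 * (2 * ?L2 + 2 * (D1 + D2) * ?L1)" using h2 K by (intro mult_left_mono) auto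
    finally have "(p * q * (1 - s * C0) - t) * ?A
        \<le> E1 * ?L1 + E2 * (2 * ?L2 + 2 * (D1 + D2) * ?L1) + p * q * (s * C1 * K4 * ?L3 + 2 * D3 * ?L2)"
      by (simp add: algebra_simps)
    also have "\<dots> \<le> F * (?L1 + ?L2 + ?L3)"
    proof -
      define z where "z = p * q * (s * C1 * K4)"
      define y where "y = p * q * (2 * D3)"
      define w where "w = E2 * (2 * (D1 + D2))"
      have nn: "z \<ge> 0" "y \<ge> 0" "w \<ge> 0" using K C1 s exps by (simp_all add: z_def y_def w_def)
      have "E1 * ?L1 + E2 * (2 * ?L2 + 2 * (D1 + D2) * ?L1) + p * q * (s * C1 * K4 * ?L3 + 2 * D3 * ?L2)
          = E1 * ?L1 + 2 * E2 * ?L2 + w * ?L1 + z * ?L3 + y * ?L2"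
        by (simp add: z_def y_def w_def algebra_simps)
      also have "\<dots> \<le> (E1 + 2 * E2 + w + z + y) * (?L1 + ?L2 + ?L3)"
      proof -
        have "x * L \<le> x * (?L1 + ?L2 + ?L3)" if "x \<ge> 0" "L = ?L1 \<or> L = ?L2 \<or> L = ?L3" for x L
          using that by (intro mult_left_mono) (auto simp: J_nonneg)
        from this[of E1 ?L1] this[of "2 * E2" ?L2] this[of w ?L1] this[of z ?L3] this[of y ?L2] K nn
        show ?thesis by (simp add: distrib_right)
      qed
      also have "E1 + 2 * E2 + w + z + y = F" by (simp add: F_def z_def y_def w_def algebra_simps)
      finally show ?thesis .
    qed
    finally have A: "?A \<le> K6 * (?L1 + ?L2 + ?L3)"
      using t by (simp add: K6_def field_simps)
    have "?W \<le> c powr \<kappa> * ?P1"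
      by (rule J_shift) (use m \<kappa> in \<open>auto simp: N_def a_def \<kappa>_def algebra_simps\<close>)
    also have "\<dots> \<le> c powr \<kappa> * (2 * (2 * c powr (p + 1/2) * ?A + K4 * ?L3))"
      using P1 by (intro mult_left_mono) auto
    also have "\<dots> \<le> c powr \<kappa> * (2 * (2 * c powr (p + 1/2) * (K6 * (?L1 + ?L2 + ?L3)) + K4 * (?L1 + ?L2 + ?L3)))"
      using A K by (intro mult_left_mono add_mono) (auto simp: J_nonneg)
    also have "\<dots> \<le> K5 * (?L1 + ?L2 + ?L3)"
      by (simp add: K5_def J_nonneg algebra_simps)
    finally have W: "?W \<le> K5 * (?L1 + ?L2 + ?L3)" .
    show ?thesis
      by (rule absorb_three[OF W K5 L1[unfolded \<delta>_def] L2[unfolded \<delta>_def] L3[unfolded \<delta>_def]])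
  qed
  moreover have "m > 0" using m by simp
  ultimately show ?thesis using N1 by blast
qed

subsection \<open>Metrizability and completeness of the local Lebesgue spaces\<close>

lemma powr_add_le:
  fixes x y r :: real
  assumes "0 \<le> x" "0 \<le> y" "r \<ge> 0"
  shows "(x + y) powr r \<le> 2 powr r * (x powr r + y powr r)"
proof -
  have "(x + y) powr r \<le> (2 * max x y) powr r" using assms by (intro powr_mono2) auto
  also have "\<dots> = 2 powr r * max x y powr r" using assms by (simp add: powr_mult)
  also have "\<dots> \<le> 2 powr r * (x powr r + y powr r)" by (intro mult_left_mono) (auto simp: max_def)
  finally show ?thesis .
qed

lemma integrable_powr_add:
  fixes f g :: "'a \<Rightarrow> real"
  assumes r: "r \<ge> 0" and m: "f \<in> borel_measurable M" "g \<in> borel_measurable M"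
    and i: "integrable M (\<lambda>x. \<bar>f x\<bar> powr r)" "integrable M (\<lambda>x. \<bar>g x\<bar> powr r)"
  shows "integrable M (\<lambda>x. \<bar>f x + g x\<bar> powr r)"
proof (rule Bochner_Integration.integrable_bound)
  show "integrable M (\<lambda>x. 2 powr r * (\<bar>f x\<bar> powr r + \<bar>g x\<bar> powr r))" using i by simp
  show "(\<lambda>x. \<bar>f x + g x\<bar> powr r) \<in> borel_measurable M" using m by measurable
  show "AE x in M. norm (\<bar>f x + g x\<bar> powr r) \<le> norm (2 powr r * (\<bar>f x\<bar> powr r + \<bar>g x\<bar> powr r))"
  proof (intro AE_I2)
    fix x
    have "\<bar>f x + g x\<bar> powr r \<le> (\<bar>f x\<bar> + \<bar>g x\<bar>) powr r" using r by (intro powr_mono2) auto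
    also have "\<dots> \<le> 2 powr r * (\<bar>f x\<bar> powr r + \<bar>g x\<bar> powr r)" using r by (intro powr_add_le) auto
    finally show "norm (\<bar>f x + g x\<bar> powr r) \<le> norm (2 powr r * (\<bar>f x\<bar> powr r + \<bar>g x\<bar> powr r))" by simp
  qed
qed

text \<open>Convexity of \<open>powr r\<close> at \<open>x / a\<close> and \<open>y / b\<close> with
  weights \<open>a / (a + b)\<close> and \<open>b / (a + b)\<close>. With norms for \<open>a\<close>
  and \<open>b\<close>, integration yields Minkowski's inequality.\<close>

lemma powr_convex_combination:
  fixes a b x y r :: real
  assumes "a > 0" "b > 0" "x \<ge> 0" "y \<ge> 0" "r \<ge> 1"
  shows "(x + y) powr r \<le> (a + b) powr r * (a / (a + b) * (x powr r / a powr r) + b / (a + b) * (y powr r / b powr r))"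
proof -
  define s where "s = a / (a + b)"
  have s: "0 < s" "s < 1" "b / (a + b) = 1 - s" using assms by (auto simp: s_def field_simps)
  have "(s * X + (1 - s) * Y) powr r \<le> s * X powr r + (1 - s) * Y powr r" if "X \<ge> 0" "Y \<ge> 0" for X Y
  proof -
    have "X = 0 \<or> Y = 0 \<or> (X > 0 \<and> Y > 0)" using that by linarith
    then consider "X = 0" | "Y = 0" | "X > 0" "Y > 0" by blast
    then show ?thesis
    proof cases
      case 1
      have "((1 - s) * Y) powr r = (1 - s) powr r * Y powr r" using s that by (simp add: powr_mult)
      also have "\<dots> \<le> (1 - s) powr 1 * Y powr r" using s assms by (intro mult_right_mono powr_mono') auto
      finally show ?thesis using 1 s assms by simp
    next
      case 2
      have "(s * X) powr r = s powr r * X powr r" using s that by (simp add: powr_mult)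
      also have "\<dots> \<le> s powr 1 * X powr r" using s assms by (intro mult_right_mono powr_mono') auto
      finally show ?thesis using 2 s assms by simp
    next
      case 3
      then show ?thesis
        using convex_onD[OF powr_convex[OF assms(5)], of "1 - s" X Y] s by (simp add: algebra_simps)
    qed
  qed
  from this[of "x / a" "y / b"]
  have "(s * (x / a) + (1 - s) * (y / b)) powr r \<le> s * (x / a) powr r + (1 - s) * (y / b) powr r"
    using assms by simp
  also have "s * (x / a) + (1 - s) * (y / b) = (x + y) / (a + b)"
  proof -
    have "s * (x / a) = x / (a + b)" using assms by (simp add: s_def)
    moreover have "(1 - s) * (y / b) = y / (a + b)" using assms unfolding s(3)[symmetric] by simp
    ultimately show ?thesis by (simp add: add_divide_distrib)
  qed
  finally have "((x + y) / (a + b)) powr r \<le> s * (x / a) powr r + (1 - s) * (y / b) powr r" .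
  then have "(x + y) powr r / (a + b) powr r \<le> s * (x powr r / a powr r) + (1 - s) * (y powr r / b powr r)"
    using assms by (simp add: powr_divide)
  then show ?thesis using assms unfolding s(3) s_def[symmetric] by (simp add: divide_le_eq mult.commute)
qed

text \<open>Each norm is enlarged by \<open>e / 2\<close>, so that the normalisation by
  \<open>a\<close> and \<open>b\<close> is legitimate even when a function vanishes almost
  everywhere.\<close>

lemma Minkowski_powr:
  fixes f g :: "'a \<Rightarrow> real"
  assumes r: "r \<ge> 1" and m: "f \<in> borel_measurable M" "g \<in> borel_measurable M"
    and i: "integrable M (\<lambda>x. \<bar>f x\<bar> powr r)" "integrable M (\<lambda>x. \<bar>g x\<bar> powr r)"
  shows "(\<integral>x. \<bar>f x + g x\<bar> powr r \<partial>M) powr (1 / r)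
    \<le> (\<integral>x. \<bar>f x\<bar> powr r \<partial>M) powr (1 / r) + (\<integral>x. \<bar>g x\<bar> powr r \<partial>M) powr (1 / r)"
proof (rule field_le_epsilon)
  fix e :: real assume e: "e > 0"
  let ?F = "\<integral>x. \<bar>f x\<bar> powr r \<partial>M" let ?G = "\<integral>x. \<bar>g x\<bar> powr r \<partial>M"
  define a where "a = ?F powr (1 / r) + e / 2"
  define b where "b = ?G powr (1 / r) + e / 2"
  have ab: "a > 0" "b > 0" using e by (auto simp: a_def b_def add_nonneg_pos)
  have nn: "0 \<le> ?F" "0 \<le> ?G" by simp_all
  have "?F = (?F powr (1 / r)) powr r" using r nn by (simp add: powr_powr)
  also have "\<dots> \<le> a powr r" using r e by (intro powr_mono2) (auto simp: a_def)
  finally have F: "?F / a powr r \<le> 1" using ab by simp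
  have "?G = (?G powr (1 / r)) powr r" using r nn by (simp add: powr_powr)
  also have "\<dots> \<le> b powr r" using r e by (intro powr_mono2) (auto simp: b_def)
  finally have G: "?G / b powr r \<le> 1" using ab by simp
  have "(\<integral>x. \<bar>f x + g x\<bar> powr r \<partial>M)
      \<le> (\<integral>x. (a + b) powr r * (a / (a + b) * (\<bar>f x\<bar> powr r / a powr r) + b / (a + b) * (\<bar>g x\<bar> powr r / b powr r)) \<partial>M)"
  proof (rule integral_mono)
    show "integrable M (\<lambda>x. \<bar>f x + g x\<bar> powr r)" using r by (intro integrable_powr_add m i) auto
    fix x
    have "\<bar>f x + g x\<bar> powr r \<le> (\<bar>f x\<bar> + \<bar>g x\<bar>) powr r" using r by (intro powr_mono2) auto
    also have "\<dots> \<le> (a + b) powr r * (a / (a + b) * (\<bar>f x\<bar> powr r / a powr r) + b / (a + b) * (\<bar>g x\<bar> powr r / b powr r))"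
      using ab r by (intro powr_convex_combination) auto
    finally show "\<bar>f x + g x\<bar> powr r \<le> (a + b) powr r * (a / (a + b) * (\<bar>f x\<bar> powr r / a powr r) + b / (a + b) * (\<bar>g x\<bar> powr r / b powr r))" .
  qed (use i in simp)
  also have "\<dots> = (a + b) powr r * (a / (a + b) * (?F / a powr r) + b / (a + b) * (?G / b powr r))"
    using i by simp
  also have "\<dots> \<le> (a + b) powr r * (a / (a + b) * 1 + b / (a + b) * 1)"
    using F G ab by (intro mult_left_mono add_mono) auto
  also have "\<dots> = (a + b) powr r" using ab by (simp add: add_divide_distrib[symmetric])
  finally have "(\<integral>x. \<bar>f x + g x\<bar> powr r \<partial>M) powr (1 / r) \<le> ((a + b) powr r) powr (1 / r)"
    using r by (intro powr_mono2) auto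
  also have "\<dots> = a + b" using ab r by (simp add: powr_powr)
  finally show "(\<integral>x. \<bar>f x + g x\<bar> powr r \<partial>M) powr (1 / r) \<le> ?F powr (1 / r) + ?G powr (1 / r) + e"
    by (simp add: a_def b_def)
qed

lemma AE_lebesgue_on_mono:
  assumes "AE x in lebesgue_on S. P x" "T \<subseteq> S" "S \<in> sets lebesgue" "T \<in> sets lebesgue"
  shows "AE x in lebesgue_on T. P x"
  using assms by (auto simp: AE_restrict_space_iff elim!: eventually_mono)

lemma Lloc_funD:
  assumes "f \<in> Lloc_fun S r" "compact K" "K \<subseteq> S"
  shows "f \<in> borel_measurable (lebesgue_on K)" "integrable (lebesgue_on K) (\<lambda>x. \<bar>f x\<bar> powr r)"
  using assms by (auto simp: Lloc_fun_def intro: measurable_restrict_mono)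

lemma Lloc_fun_diff:
  assumes "r \<ge> 0" "f \<in> Lloc_fun S r" "g \<in> Lloc_fun S r"
  shows "(\<lambda>x. f x - g x) \<in> Lloc_fun S r"
proof -
  have "integrable (lebesgue_on K) (\<lambda>x. \<bar>f x - g x\<bar> powr r)" if K: "compact K" "K \<subseteq> S" for K
    using integrable_powr_add[OF assms(1), of f "lebesgue_on K" "\<lambda>x. - g x"]
      Lloc_funD[OF assms(2) K] Lloc_funD[OF assms(3) K] by simp
  then show ?thesis using assms by (auto simp: Lloc_fun_def)
qed

lemma L_seminorm_minus: "L_seminorm K r (\<lambda>x. f x - g x) = L_seminorm K r (\<lambda>x. g x - f x)"
  by (simp add: L_seminorm_def abs_minus_commute)

lemma L_seminorm_nonneg: "0 \<le> L_seminorm K r f"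
  by (simp add: L_seminorm_def)

lemma L_seminorm_triangle:
  assumes r: "r \<ge> 1" and K: "compact K" "K \<subseteq> S"
    and f: "f \<in> Lloc_fun S r" "g \<in> Lloc_fun S r" "k \<in> Lloc_fun S r"
  shows "L_seminorm K r (\<lambda>x. f x - k x) \<le> L_seminorm K r (\<lambda>x. f x - g x) + L_seminorm K r (\<lambda>x. g x - k x)"
proof -
  have r0: "r \<ge> 0" using r by simp
  show ?thesis
    using Minkowski_powr[OF r Lloc_funD(1)[OF Lloc_fun_diff[OF r0 f(1,2)] K] Lloc_funD(1)[OF Lloc_fun_diff[OF r0 f(2,3)] K]
      Lloc_funD(2)[OF Lloc_fun_diff[OF r0 f(1,2)] K] Lloc_funD(2)[OF Lloc_fun_diff[OF r0 f(2,3)] K]]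
    by (simp add: L_seminorm_def)
qed

lemma L_seminorm_mono:
  assumes r: "r \<ge> 1" and K: "compact K" "K \<subseteq> K'" "compact K'" "K' \<subseteq> S" and f: "f \<in> Lloc_fun S r"
  shows "L_seminorm K r f \<le> L_seminorm K' r f"
proof -
  have s: "K \<inter> space lebesgue \<in> sets lebesgue" "K' \<inter> space lebesgue \<in> sets lebesgue"
    using K lmeasurable_compact fmeasurableD by auto
  have i: "integrable lebesgue (\<lambda>x. indicator K x *\<^sub>R (\<bar>f x\<bar> powr r))" "integrable lebesgue (\<lambda>x. indicator K' x *\<^sub>R (\<bar>f x\<bar> powr r))"
    using Lloc_funD(2)[OF f K(1)] Lloc_funD(2)[OF f K(3,4)] K s by (auto simp: integrable_restrict_space)
  have "(\<integral>x. \<bar>f x\<bar> powr r \<partial>lebesgue_on K) \<le> (\<integral>x. \<bar>f x\<bar> powr r \<partial>lebesgue_on K')"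
    unfolding integral_restrict_space[OF s(1)] integral_restrict_space[OF s(2)]
    by (intro integral_mono i) (use K in \<open>auto simp: indicator_def\<close>)
  then show ?thesis using r unfolding L_seminorm_def by (intro powr_mono2) auto
qed

lemma L_seminorm_cong_AE:
  assumes "AE x in lebesgue_on K. \<bar>f x\<bar> = \<bar>g x\<bar>" "f \<in> borel_measurable (lebesgue_on K)" "g \<in> borel_measurable (lebesgue_on K)"
  shows "L_seminorm K r f = L_seminorm K r g"
proof -
  have "(\<integral>x. \<bar>f x\<bar> powr r \<partial>lebesgue_on K) = (\<integral>x. \<bar>g x\<bar> powr r \<partial>lebesgue_on K)"
    by (rule integral_cong_AE) (use assms in \<open>auto elim!: eventually_mono\<close>)
  then show ?thesis by (simp add: L_seminorm_def)
qed

locale Lloc_exhaustion =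
  fixes \<Omega> :: "'a::euclidean_space set" and r :: real and K :: "nat \<Rightarrow> 'a set"
  assumes \<Omega>: "open \<Omega>" and r: "r \<ge> 1"
    and K: "\<And>n. compact (K n)" "\<And>n. K n \<subseteq> \<Omega>" "\<And>n. K n \<subseteq> K (Suc n)"
      "\<And>C. compact C \<Longrightarrow> C \<subseteq> \<Omega> \<Longrightarrow> \<exists>n. C \<subseteq> K n"
begin

definition rep where "rep c = (SOME f. f \<in> c)" for c :: "('a \<Rightarrow> real) set"

definition sn where "sn k f g = L_seminorm (K k) r (\<lambda>x. f x - g x)"

text \<open>The seminorms increase with \<open>k\<close>, and the \<open>k\<close>-th one is capped
  at \<open>1 / Suc k\<close>. Smallness of this supremum therefore amounts to smallness of a single
  seminorm, which an infinite sum would express less directly. Representatives are chosen, but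
  \<open>sn\<close> does not depend on them.\<close>

definition d where "d c c' = (SUP k. min (1 / real (Suc k)) (sn k (rep c) (rep c')))"

abbreviation "M \<equiv> Lloc_fun \<Omega> r // Lloc_rel \<Omega> r"

lemma r0: "r \<ge> 0" using r by simp

lemma K_mono: "i \<le> j \<Longrightarrow> K i \<subseteq> K j"
  using K(3) by (rule lift_Suc_mono_le)

lemma sn_nonneg: "0 \<le> sn k f g"
  by (simp add: sn_def L_seminorm_nonneg)

lemma sn_triangle:
  "f \<in> Lloc_fun \<Omega> r \<Longrightarrow> g \<in> Lloc_fun \<Omega> r \<Longrightarrow> h \<in> Lloc_fun \<Omega> r \<Longrightarrow> sn k f h \<le> sn k f g + sn k g h"
  unfolding sn_def by (rule L_seminorm_triangle[OF r K(1,2)])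

lemma sn_commute: "sn k f g = sn k g f"
  unfolding sn_def by (rule L_seminorm_minus)

lemma sn_mono: "f \<in> Lloc_fun \<Omega> r \<Longrightarrow> g \<in> Lloc_fun \<Omega> r \<Longrightarrow> i \<le> j \<Longrightarrow> sn i f g \<le> sn j f g"
  unfolding sn_def by (rule L_seminorm_mono[OF r K(1) K_mono K(1,2)]) (auto intro: Lloc_fun_diff r0)

lemma class_M: "f \<in> Lloc_fun \<Omega> r \<Longrightarrow> Lloc_class \<Omega> r f \<in> M"
  by (auto simp: Lloc_class_def quotient_def)

lemma rep:
  assumes "c \<in> M"
  shows "rep c \<in> Lloc_fun \<Omega> r" "Lloc_class \<Omega> r (rep c) = c"
proof -
  obtain f where f: "f \<in> Lloc_fun \<Omega> r" "c = Lloc_rel \<Omega> r `` {f}" using assms by (auto elim: quotientE)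
  have "f \<in> c" using f equiv_Lloc_rel equiv_class_self by metis
  then have "rep c \<in> c" unfolding rep_def by (rule someI[where P = "\<lambda>f. f \<in> c"])
  then have rel: "(f, rep c) \<in> Lloc_rel \<Omega> r" using f by simp
  then show "rep c \<in> Lloc_fun \<Omega> r" by (simp add: Lloc_rel_def)
  show "Lloc_class \<Omega> r (rep c) = c"
    unfolding Lloc_class_def using equiv_class_eq[OF equiv_Lloc_rel rel] f by simp
qed

lemma class_eq_iff:
  assumes "f \<in> Lloc_fun \<Omega> r" "g \<in> Lloc_fun \<Omega> r"
  shows "Lloc_class \<Omega> r f = Lloc_class \<Omega> r g \<longleftrightarrow> (AE x in lebesgue_on \<Omega>. f x = g x)"
  unfolding Lloc_class_def eq_equiv_class_iff[OF equiv_Lloc_rel assms]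
  using assms by (simp add: Lloc_rel_def)

lemma \<Omega>_sets: "\<Omega> \<in> sets lebesgue" "K n \<in> sets lebesgue" "compact C \<Longrightarrow> C \<in> sets lebesgue" for C :: "'a set"
  using \<Omega> K(1) lmeasurable_compact fmeasurableD by (auto simp: borel_open)

lemma rep_class:
  assumes "f \<in> Lloc_fun \<Omega> r"
  shows "AE x in lebesgue_on \<Omega>. rep (Lloc_class \<Omega> r f) x = f x"
  using rep[OF class_M[OF assms]] class_eq_iff[OF _ assms] by blast

lemma sn_AE_cong:
  assumes "AE x in lebesgue_on \<Omega>. f x = f' x" "f \<in> Lloc_fun \<Omega> r" "f' \<in> Lloc_fun \<Omega> r" "g \<in> Lloc_fun \<Omega> r"
  shows "sn k f g = sn k f' g"
  unfolding sn_def
proof (rule L_seminorm_cong_AE)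
  have "AE x in lebesgue_on (K k). f x = f' x"
    by (rule AE_lebesgue_on_mono[OF assms(1) K(2) \<Omega>_sets(1,2)])
  then show "AE x in lebesgue_on (K k). \<bar>f x - g x\<bar> = \<bar>f' x - g x\<bar>" by eventually_elim simp
qed (use assms in \<open>auto intro!: Lloc_funD(1)[OF Lloc_fun_diff[OF r0] K(1,2)]\<close>)

lemma sn_rep:
  assumes "f \<in> Lloc_fun \<Omega> r" "g \<in> Lloc_fun \<Omega> r"
  shows "sn k (rep (Lloc_class \<Omega> r f)) (rep (Lloc_class \<Omega> r g)) = sn k f g"
proof -
  note F = rep(1)[OF class_M[OF assms(1)]] note G = rep(1)[OF class_M[OF assms(2)]]
  show ?thesis
    using sn_AE_cong[OF rep_class[OF assms(1)] F assms(1) G, of k]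
      sn_AE_cong[OF rep_class[OF assms(2)] G assms(2) assms(1), of k] by (simp add: sn_commute)
qed

lemma bdd: "bdd_above (range (\<lambda>k. min (1 / real (Suc k)) (s k)))" for s :: "nat \<Rightarrow> real"
  by (intro bdd_aboveI[of _ 1]) (auto intro: min.coboundedI1)

lemma d_le: "(\<And>k. min (1 / real (Suc k)) (sn k (rep c) (rep c')) \<le> e) \<Longrightarrow> d c c' \<le> e"
  unfolding d_def by (intro cSUP_least) auto

lemma d_ge: "min (1 / real (Suc k)) (sn k (rep c) (rep c')) \<le> d c c'"
  unfolding d_def using bdd by (intro cSUP_upper) auto

lemma sn_less_of_d:
  assumes "d c c' < e" "e \<le> 1 / real (Suc k)"
  shows "sn k (rep c) (rep c') < e"
  using d_ge[of k c c'] assms by (auto simp: min_def split: if_splits)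

lemma d_le_of_sn:
  assumes "c \<in> M" "c' \<in> M" "sn k (rep c) (rep c') \<le> e" "1 / real (Suc k) \<le> e"
  shows "d c c' \<le> e"
proof (rule d_le)
  fix j
  show "min (1 / real (Suc j)) (sn j (rep c) (rep c')) \<le> e"
  proof (cases "j \<le> k")
    case True
    then show ?thesis using sn_mono[OF rep(1)[OF assms(1)] rep(1)[OF assms(2)] True] assms(3) by simp
  next
    case False
    then have "1 / real (Suc j) \<le> 1 / real (Suc k)" by (intro divide_left_mono) auto
    then show ?thesis using assms(4) by simp
  qed
qed

lemma d_nonneg: "0 \<le> d x y"
  using d_ge[of 0 x y] sn_nonneg[of 0 "rep x" "rep y"] by (auto simp: min_def split: if_splits)

lemma AE_\<Omega>I:
  assumes "\<And>k. AE x in lebesgue_on (K k). P x"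
  shows "AE x in lebesgue_on \<Omega>. P x"
proof -
  have "AE x in lebesgue. x \<in> K k \<longrightarrow> P x" for k
    using assms[of k] \<Omega>_sets(2)[of k] by (simp add: AE_restrict_space_iff)
  then have "AE x in lebesgue. \<forall>k. x \<in> K k \<longrightarrow> P x"
    unfolding AE_all_countable by blast
  then have "AE x in lebesgue. x \<in> \<Omega> \<longrightarrow> P x"
  proof eventually_elim
    case (elim x)
    show ?case
    proof
      assume "x \<in> \<Omega>"
      then obtain n where "{x} \<subseteq> K n" using K(4)[of "{x}"] by auto
      then show "P x" using elim by auto
    qed
  qed
  then show ?thesis using \<Omega>_sets by (simp add: AE_restrict_space_iff)
qed

sublocale Metric_space M d
proof
  fix x y z
  show "0 \<le> d x y" by (rule d_nonneg)
  show "d x y = d y x" unfolding d_def by (simp add: sn_commute)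
  show "d x y = 0 \<longleftrightarrow> x = y" if x: "x \<in> M" and y: "y \<in> M"
  proof
    assume "x = y"
    then have "d x y \<le> 0" by (intro d_le) (simp add: sn_def L_seminorm_def)
    then show "d x y = 0" using d_nonneg[of x y] by simp
  next
    assume d0: "d x y = 0"
    have "AE t in lebesgue_on (K k). rep x t = rep y t" for k
    proof -
      have "sn k (rep x) (rep y) = 0"
        using d_ge[of k x y] d0 sn_nonneg[of k "rep x" "rep y"] by (auto simp: min_def divide_simps split: if_splits)
      then have "(\<integral>t. \<bar>rep x t - rep y t\<bar> powr r \<partial>lebesgue_on (K k)) = 0" by (simp add: sn_def L_seminorm_def)
      then have "AE t in lebesgue_on (K k). \<bar>rep x t - rep y t\<bar> powr r = 0"
        using integral_nonneg_eq_0_iff_AE[OF Lloc_funD(2)[OF Lloc_fun_diff[OF r0 rep(1)[OF x] rep(1)[OF y]] K(1,2)]] by simp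
      then show ?thesis by eventually_elim simp
    qed
    then have "AE t in lebesgue_on \<Omega>. rep x t = rep y t" by (rule AE_\<Omega>I)
    then show "x = y" using class_eq_iff[OF rep(1)[OF x] rep(1)[OF y]] rep(2) x y by simp
  qed
  show "d x z \<le> d x y + d y z" if x: "x \<in> M" and y: "y \<in> M" and z: "z \<in> M"
  proof (rule d_le)
    fix k
    have "sn k (rep x) (rep z) \<le> sn k (rep x) (rep y) + sn k (rep y) (rep z)"
      by (intro sn_triangle rep(1) x y z)
    then show "min (1 / real (Suc k)) (sn k (rep x) (rep z)) \<le> d x y + d y z"
      using d_ge[of k x y] d_ge[of k y z] d_nonneg[of x y] d_nonneg[of y z]
      by (auto simp: min_def split: if_splits)
  qed
qed

text \<open>A metric ball contains a generator built on one \<open>K k\<close> with \<open>k\<close>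
  large. Conversely, a compact set lies in some \<open>K k\<close>, and the slack of a point inside
  a generator leaves room for a metric ball.\<close>

lemma mtopology_eq: "mtopology = Lloc \<Omega> r"
proof (rule topology_eq[THEN iffD2], intro allI iffI)
  fix U assume U: "openin mtopology U"
  show "openin (Lloc \<Omega> r) U"
  proof (subst openin_subopen, intro ballI)
    fix c assume c: "c \<in> U"
    obtain e where e: "e > 0" "mball c e \<subseteq> U" and cM: "c \<in> M"
      using U c unfolding openin_mtopology by blast
    obtain k where k: "1 / real (Suc k) < e / 2" using e nat_approx_posE[of "e / 2"] by auto
    let ?B = "Lloc_ball \<Omega> r (rep c) (K k) (e / 2)"
    have "openin (Lloc \<Omega> r) ?B"
      unfolding Lloc_def using e rep(1)[OF cM]
      by (intro topology_generated_by_Basis CollectI exI[of _ "rep c"] exI[of _ "K k"] exI[of _ "e / 2"])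
        (auto simp: K(1) K(2)[THEN subsetD])
    moreover have "c \<in> ?B"
    proof -
      have "c = Lloc_class \<Omega> r (rep c)" using rep(2)[OF cM] by simp
      moreover have "L_seminorm (K k) r (\<lambda>x. rep c x - rep c x) < e / 2" using e by (simp add: L_seminorm_def)
      ultimately show ?thesis unfolding Lloc_ball_def using rep(1)[OF cM] by blast
    qed
    moreover have "?B \<subseteq> U"
    proof
      fix c' assume "c' \<in> ?B"
      then obtain g where g: "g \<in> Lloc_fun \<Omega> r" "sn k g (rep c) < e / 2" "c' = Lloc_class \<Omega> r g"
        by (auto simp: Lloc_ball_def sn_def)
      have "sn k (rep c) (rep c') = sn k (rep c) g"
        using sn_rep[OF rep(1)[OF cM] g(1), of k] rep(2)[OF cM] g(3) by simp
      then have "d c c' \<le> e / 2"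
        using g k cM class_M[OF g(1)] by (intro d_le_of_sn[of _ _ k]) (auto simp: sn_commute)
      then show "c' \<in> U" using e cM class_M[OF g(1)] g(3) by (auto simp: in_mball)
    qed
    ultimately show "\<exists>T. openin (Lloc \<Omega> r) T \<and> c \<in> T \<and> T \<subseteq> U" by blast
  qed
next
  fix U assume "openin (Lloc \<Omega> r) U"
  then have "generate_topology_on {Lloc_ball \<Omega> r f K \<epsilon> | f K \<epsilon>. f \<in> Lloc_fun \<Omega> r \<and> compact K \<and> K \<subseteq> \<Omega> \<and> 0 < \<epsilon>} U"
    unfolding Lloc_def by (rule openin_topology_generated_by)
  then show "openin mtopology U"
  proof (rule generate_topology_on_coarsest[OF istopology_openin, rotated])
    fix B assume "B \<in> {Lloc_ball \<Omega> r f K \<epsilon> | f K \<epsilon>. f \<in> Lloc_fun \<Omega> r \<and> compact K \<and> K \<subseteq> \<Omega> \<and> 0 < \<epsilon>}"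
    then obtain f C e where B: "B = Lloc_ball \<Omega> r f C e" "f \<in> Lloc_fun \<Omega> r" "compact C" "C \<subseteq> \<Omega>" "0 < e" by auto
    obtain k where k: "C \<subseteq> K k" using K(4) B by blast
    show "openin mtopology B" unfolding openin_mtopology
    proof (intro conjI allI impI)
      show "B \<subseteq> M" using class_M by (auto simp: B Lloc_ball_def)
      fix c assume "c \<in> B"
      then obtain g where g: "g \<in> Lloc_fun \<Omega> r" "L_seminorm C r (\<lambda>x. g x - f x) < e" "c = Lloc_class \<Omega> r g"
        by (auto simp: B Lloc_ball_def)
      \<comment> \<open>Staying below the cap \<open>1 / Suc k\<close> lets the distance control the
        \<open>k\<close>-th seminorm; the other entry is the slack.\<close>
      define \<delta> where "\<delta> = min (1 / real (Suc k)) (e - L_seminorm C r (\<lambda>x. g x - f x))"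
      have "\<delta> > 0" using g by (simp add: \<delta>_def)
      moreover have "mball c \<delta> \<subseteq> B"
      proof
        fix c' assume "c' \<in> mball c \<delta>"
        then have c': "c' \<in> M" "d c' c < \<delta>" by (auto simp: in_mball commute)
        have "sn k (rep c') g = sn k (rep c') (rep c)"
          using sn_rep[OF rep(1)[OF c'(1)] g(1), of k] rep(2)[OF c'(1)] g(3) by simp
        also have "\<dots> < \<delta>" using c' by (intro sn_less_of_d) (auto simp: \<delta>_def)
        finally have "L_seminorm C r (\<lambda>x. rep c' x - g x) < \<delta>"
          unfolding sn_def
          using L_seminorm_mono[OF r B(3) k K(1,2) Lloc_fun_diff[OF r0 rep(1)[OF c'(1)] g(1)]] by simp
        then have "L_seminorm C r (\<lambda>x. rep c' x - f x) < e"
          using L_seminorm_triangle[OF r B(3,4) rep(1)[OF c'(1)] g(1) B(2)] by (simp add: \<delta>_def)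
        then show "c' \<in> B" using rep[OF c'(1)] unfolding B(1) Lloc_ball_def by blast
      qed
      ultimately show "\<exists>\<delta>>0. mball c \<delta> \<subseteq> B" by blast
    qed
  qed
qed

text \<open>The Riesz-Fischer argument. A rapidly Cauchy subsequence has summable increments in
  \<open>L1\<close> of each \<open>K k\<close>, so it converges almost everywhere to one function
  \<open>l\<close>; Fatou's lemma then gives the rate in the \<open>k\<close>-th seminorm.\<close>

lemma mcomplete: mcomplete
  unfolding mcomplete_def
proof (intro allI impI)
  fix \<sigma> assume \<sigma>: "MCauchy \<sigma>"
  have \<sigma>M: "\<sigma> n \<in> M" for n using \<sigma> by (auto simp: MCauchy_def)
  define f where "f n = rep (\<sigma> n)" for n
  have fL: "f n \<in> Lloc_fun \<Omega> r" for n unfolding f_def by (rule rep(1)[OF \<sigma>M])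
  have "\<forall>j. \<exists>N. \<forall>n n'. N \<le> n \<longrightarrow> N \<le> n' \<longrightarrow> d (\<sigma> n) (\<sigma> n') < (1/2) ^ j"
    using \<sigma> unfolding MCauchy_def by simp
  then obtain N where N: "\<And>j n n'. N j \<le> n \<Longrightarrow> N j \<le> n' \<Longrightarrow> d (\<sigma> n) (\<sigma> n') < (1/2) ^ j" by metis
  \<comment> \<open>Partial sums dominate every earlier \<open>N i\<close>, whether or not
    \<open>N\<close> is monotone.\<close>
  define \<phi> where "\<phi> j = (\<Sum>i\<le>j. N i)" for j
  have \<phi>: "N j \<le> \<phi> j'" if "j \<le> j'" for j j'
    unfolding \<phi>_def using that member_le_sum[of j "{..j'}" N] by simp
  have half: "(1/2::real) ^ j \<le> 1 / real (Suc k)" if "k \<le> j" for j k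
  proof -
    have "Suc k \<le> 2 ^ j" using that less_exp[of j] by linarith
    then have "real (Suc k) \<le> real (2 ^ j)" by (rule of_nat_mono)
    then have "1 / real (2 ^ j) \<le> 1 / real (Suc k)" by (intro divide_left_mono) auto
    then show ?thesis by (simp add: power_divide)
  qed
  have fsn: "sn k (f n) (f n') < (1/2) ^ j" if "k \<le> j" "N j \<le> n" "N j \<le> n'" for k j n n'
    unfolding f_def by (rule sn_less_of_d[OF N half]) (use that in auto)
  define g where "g j = f (\<phi> j)" for j
  have gL: "g j \<in> Lloc_fun \<Omega> r" for j unfolding g_def by (rule fL)
  have int: "(\<integral>x. \<bar>f n x - f n' x\<bar> powr r \<partial>lebesgue_on (K k)) \<le> ((1/2) ^ j) powr r"
    if "k \<le> j" "N j \<le> n" "N j \<le> n'" for k j n n'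
  proof -
    let ?I = "\<integral>x. \<bar>f n x - f n' x\<bar> powr r \<partial>lebesgue_on (K k)"
    have "?I = (sn k (f n) (f n')) powr r" using r by (simp add: sn_def L_seminorm_def powr_powr)
    also have "\<dots> \<le> ((1/2) ^ j) powr r" using fsn[OF that] r sn_nonneg by (intro powr_mono2) auto
    finally show ?thesis .
  qed
  define l where "l x = lim (\<lambda>j. g j x)" for x
  have gm: "g j \<in> borel_measurable (lebesgue_on \<Omega>)" for j using gL by (simp add: Lloc_fun_def)
  have lm: "l \<in> borel_measurable (lebesgue_on \<Omega>)" unfolding l_def using gm by measurable
  have conv: "AE x in lebesgue_on (K k). (\<lambda>j. g j x) \<longlonglongrightarrow> l x" for k
  proof -
    let ?\<mu> = "lebesgue_on (K k)"
    have gmk: "g j \<in> borel_measurable ?\<mu>" for j by (rule Lloc_funD(1)[OF gL K(1,2)])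
    have "emeasure lebesgue (K k) \<noteq> \<infinity>"
      using fmeasurableD2[OF lmeasurable_compact[OF K(1)]] by simp
    then have fin: "finite_measure ?\<mu>"
      by (intro finite_measureI) (simp add: emeasure_restrict_space \<Omega>_sets space_restrict_space)
    define B where "B = measure ?\<mu> (space ?\<mu>) + 1"
    define s where "s j x = \<bar>g (Suc (j + k)) x - g (j + k) x\<bar>" for j x
    have sm: "(\<lambda>x. ennreal (s j x)) \<in> borel_measurable ?\<mu>" for j unfolding s_def using gmk by measurable
    have si: "(\<integral>\<^sup>+x. ennreal (s j x) \<partial>?\<mu>) \<le> ennreal ((1/2) ^ (j + k) * B)" for j
    proof -
      define e where "e = (1/2::real) ^ (j + k)"
      have e: "e > 0" by (simp add: e_def)
      have i1: "integrable ?\<mu> (\<lambda>x. \<bar>g (Suc (j + k)) x - g (j + k) x\<bar> powr r)"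
        by (rule Lloc_funD(2)[OF Lloc_fun_diff[OF r0 gL gL] K(1,2)])
      have pt: "s j x \<le> e + e powr (1 - r) * \<bar>g (Suc (j + k)) x - g (j + k) x\<bar> powr r" for x
      proof (cases "s j x \<le> e")
        case True
        then show ?thesis by (simp add: add_increasing2)
      next
        case False
        have "s j x = s j x powr (1 - r) * s j x powr r" using False e by (simp add: powr_add[symmetric])
        also have "\<dots> \<le> e powr (1 - r) * s j x powr r"
          using False e r by (intro mult_right_mono powr_mono2') auto
        finally show ?thesis using e by (simp add: s_def)
      qed
      have ic: "integrable ?\<mu> (\<lambda>x. e + e powr (1 - r) * \<bar>g (Suc (j + k)) x - g (j + k) x\<bar> powr r)"
        using i1 fin by (simp add: finite_measure.integrable_const)
      have "(\<integral>\<^sup>+x. ennreal (s j x) \<partial>?\<mu>) \<le> (\<integral>\<^sup>+x. ennreal (e + e powr (1 - r) * \<bar>g (Suc (j + k)) x - g (j + k) x\<bar> powr r) \<partial>?\<mu>)"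
        by (intro nn_integral_mono ennreal_leI pt)
      also have "\<dots> = ennreal (\<integral>x. e + e powr (1 - r) * \<bar>g (Suc (j + k)) x - g (j + k) x\<bar> powr r \<partial>?\<mu>)"
        using e by (intro nn_integral_eq_integral ic) auto
      also have "(\<integral>x. e + e powr (1 - r) * \<bar>g (Suc (j + k)) x - g (j + k) x\<bar> powr r \<partial>?\<mu>)
          = e * measure ?\<mu> (space ?\<mu>) + e powr (1 - r) * (\<integral>x. \<bar>g (Suc (j + k)) x - g (j + k) x\<bar> powr r \<partial>?\<mu>)"
        using i1 fin by (simp add: finite_measure.integrable_const)
      also have "\<dots> \<le> e * measure ?\<mu> (space ?\<mu>) + e powr (1 - r) * e powr r"
        unfolding g_def e_def using \<phi> by (intro add_left_mono mult_left_mono int) auto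
      also have "\<dots> = e * B" using e by (simp add: powr_add[symmetric] B_def algebra_simps)
      finally show ?thesis by (simp add: e_def ennreal_leI)
    qed
    have "(\<integral>\<^sup>+x. (\<Sum>j. ennreal (s j x)) \<partial>?\<mu>) = (\<Sum>j. \<integral>\<^sup>+x. ennreal (s j x) \<partial>?\<mu>)"
      by (rule nn_integral_suminf[OF sm])
    also have "\<dots> \<le> (\<Sum>j. ennreal ((1/2) ^ (j + k) * B))" by (intro suminf_le si) auto
    also have "\<dots> < \<infinity>"
    proof -
      have "summable (\<lambda>j. (1/2::real) ^ (j + k) * B)"
        by (intro summable_mult2 summable_ignore_initial_segment summable_geometric) simp
      then show ?thesis by (subst suminf_ennreal2) (auto simp: B_def intro!: mult_nonneg_nonneg add_nonneg_nonneg)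
    qed
    finally have "AE x in ?\<mu>. (\<Sum>j. ennreal (s j x)) \<noteq> \<infinity>"
      by (intro nn_integral_PInf_AE borel_measurable_suminf_order sm) auto
    then show ?thesis
    proof eventually_elim
      case (elim x)
      have "summable (\<lambda>j. s j x)"
        by (rule summable_suminf_not_top) (use elim in \<open>auto simp: s_def\<close>)
      then have "summable (\<lambda>j. g (Suc (j + k)) x - g (j + k) x)"
        unfolding s_def by (rule summable_rabs_cancel)
      then have "convergent (\<lambda>n. \<Sum>j<n. g (Suc (j + k)) x - g (j + k) x)"
        by (simp add: summable_iff_convergent)
      moreover have "(\<Sum>j<n. g (Suc (j + k)) x - g (j + k) x) = g (n + k) x - g k x" for n
        using sum_lessThan_telescope[of "\<lambda>j. g (j + k) x" n] by simp
      ultimately have "convergent (\<lambda>n. g (n + k) x - g k x)" by simp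
      then have "convergent (\<lambda>n. g (n + k) x - g k x + g k x)"
        by (intro convergent_add convergent_const)
      then obtain L where "(\<lambda>n. g (n + k) x) \<longlonglongrightarrow> L" by (auto simp: convergent_def)
      then have "(\<lambda>n. g n x) \<longlonglongrightarrow> L" by (rule LIMSEQ_offset)
      then have "convergent (\<lambda>n. g n x)" by (auto simp: convergent_def)
      then show "(\<lambda>j. g j x) \<longlonglongrightarrow> l x" by (simp add: l_def convergent_LIMSEQ_iff)
    qed
  qed
  have lmk: "l \<in> borel_measurable (lebesgue_on C)" if "C \<subseteq> \<Omega>" for C
    by (rule measurable_restrict_mono[OF lm that])
  have fatou: "(\<integral>\<^sup>+x. ennreal (\<bar>l x - g j x\<bar> powr r) \<partial>lebesgue_on (K k)) \<le> ennreal (((1/2) ^ j) powr r)"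
    if kj: "k \<le> j" for k j
  proof -
    let ?\<mu> = "lebesgue_on (K k)"
    have gmk: "g j \<in> borel_measurable ?\<mu>" for j by (rule Lloc_funD(1)[OF gL K(1,2)])
    have "(\<integral>\<^sup>+x. ennreal (\<bar>l x - g j x\<bar> powr r) \<partial>?\<mu>) = (\<integral>\<^sup>+x. liminf (\<lambda>i. ennreal (\<bar>g i x - g j x\<bar> powr r)) \<partial>?\<mu>)"
    proof (rule nn_integral_cong_AE)
      show "AE x in ?\<mu>. ennreal (\<bar>l x - g j x\<bar> powr r) = liminf (\<lambda>i. ennreal (\<bar>g i x - g j x\<bar> powr r))"
        using conv[of k]
      proof eventually_elim
        case (elim x)
        have "(\<lambda>i. \<bar>g i x - g j x\<bar> powr r) \<longlonglongrightarrow> \<bar>l x - g j x\<bar> powr r"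
          using r by (intro tendsto_powr' tendsto_intros elim) auto
        then have "(\<lambda>i. ennreal (\<bar>g i x - g j x\<bar> powr r)) \<longlonglongrightarrow> ennreal (\<bar>l x - g j x\<bar> powr r)"
          by (rule tendsto_ennrealI)
        then show ?case by (rule lim_imp_Liminf[OF trivial_limit_sequentially, symmetric])
      qed
    qed
    also have "\<dots> \<le> liminf (\<lambda>i. \<integral>\<^sup>+x. ennreal (\<bar>g i x - g j x\<bar> powr r) \<partial>?\<mu>)"
      using gmk by (intro nn_integral_liminf) measurable
    also have "\<dots> \<le> liminf (\<lambda>i::nat. ennreal (((1/2) ^ j) powr r))"
    proof (rule Liminf_mono, rule eventually_sequentiallyI[of j])
      fix i assume i: "j \<le> i"
      have "(\<integral>\<^sup>+x. ennreal (\<bar>g i x - g j x\<bar> powr r) \<partial>?\<mu>) = ennreal (\<integral>x. \<bar>g i x - g j x\<bar> powr r \<partial>?\<mu>)"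
        by (intro nn_integral_eq_integral Lloc_funD(2)[OF Lloc_fun_diff[OF r0 gL gL] K(1,2)]) auto
      also have "\<dots> \<le> ennreal (((1/2) ^ j) powr r)"
        unfolding g_def using \<phi> i kj by (intro ennreal_leI int) auto
      finally show "(\<integral>\<^sup>+x. ennreal (\<bar>g i x - g j x\<bar> powr r) \<partial>?\<mu>) \<le> ennreal (((1/2) ^ j) powr r)" .
    qed
    also have "\<dots> = ennreal (((1/2) ^ j) powr r)" by (simp add: Liminf_const)
    finally show ?thesis .
  qed
  have li: "integrable (lebesgue_on (K k)) (\<lambda>x. \<bar>l x - g j x\<bar> powr r)" if "k \<le> j" for k j
  proof (rule integrableI_nonneg)
    show "(\<lambda>x. \<bar>l x - g j x\<bar> powr r) \<in> borel_measurable (lebesgue_on (K k))"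
      using lmk[OF K(2)] Lloc_funD(1)[OF gL K(1,2)] by measurable
    show "(\<integral>\<^sup>+x. ennreal (\<bar>l x - g j x\<bar> powr r) \<partial>lebesgue_on (K k)) < \<infinity>"
      using fatou[OF that] by (rule le_less_trans) simp
  qed simp
  have lL: "l \<in> Lloc_fun \<Omega> r"
    unfolding Lloc_fun_def
  proof (intro CollectI conjI allI impI lm)
    fix C assume C: "compact C \<and> C \<subseteq> \<Omega>"
    then obtain k where k: "C \<subseteq> K k" using K(4) by blast
    have "integrable (lebesgue_on (K k)) (\<lambda>x. \<bar>(l x - g k x) + g k x\<bar> powr r)"
      using lmk[OF K(2)] Lloc_funD[OF gL K(1,2)] by (intro integrable_powr_add r0 li) auto
    then have "integrable lebesgue (\<lambda>x. indicator (K k) x *\<^sub>R (\<bar>l x\<bar> powr r))"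
      using \<Omega>_sets by (simp add: integrable_restrict_space)
    then have "integrable lebesgue (\<lambda>x. indicator C x *\<^sub>R (indicator (K k) x *\<^sub>R (\<bar>l x\<bar> powr r)))"
      by (rule integrable_mult_indicator[rotated]) (use C in \<open>blast intro: fmeasurableD lmeasurable_compact\<close>)
    also have "(\<lambda>x. indicator C x *\<^sub>R (indicator (K k) x *\<^sub>R (\<bar>l x\<bar> powr r))) = (\<lambda>x. indicator C x *\<^sub>R (\<bar>l x\<bar> powr r))"
      using k by (auto simp: indicator_def fun_eq_iff)
    finally show "integrable (lebesgue_on C) (\<lambda>x. \<bar>l x\<bar> powr r)"
      using \<Omega>_sets(3)[of C] C by (simp add: integrable_restrict_space)
  qed
  have snl: "sn k (g j) l \<le> (1/2) ^ j" if "k \<le> j" for k j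
  proof -
    have "(\<integral>x. \<bar>l x - g j x\<bar> powr r \<partial>lebesgue_on (K k)) \<le> ((1/2) ^ j) powr r"
      by (rule integral_real_bounded[OF _ fatou[OF that]]) simp
    then have "(\<integral>x. \<bar>l x - g j x\<bar> powr r \<partial>lebesgue_on (K k)) powr (1 / r) \<le> (((1/2) ^ j) powr r) powr (1 / r)"
      using r by (intro powr_mono2) auto
    then have "sn k l (g j) \<le> (1/2) ^ j" using r by (simp add: sn_def L_seminorm_def powr_powr)
    then show ?thesis by (simp add: sn_commute)
  qed
  have "limitin mtopology \<sigma> (Lloc_class \<Omega> r l) sequentially"
    unfolding limit_metric_sequentially
  proof (intro conjI allI impI class_M lL)
    fix e :: real assume e: "e > 0"
    obtain k where k: "1 / real (Suc k) < e / 2" using e nat_approx_posE[of "e / 2"] by auto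
    obtain j0 where j0: "(1/2::real) ^ j0 < e / 4" using e real_arch_pow_inv[of "e / 4" "1/2"] by auto
    define j where "j = max j0 k"
    have "(1/2::real) ^ j \<le> (1/2) ^ j0" unfolding j_def by (intro power_decreasing) auto
    with j0 have "(1/2::real) ^ j < e / 4" by linarith
    moreover have "k \<le> j" by (simp add: j_def)
    ultimately have j: "(1/2::real) ^ j < e / 4" "k \<le> j" .
    show "\<exists>N. \<forall>n\<ge>N. \<sigma> n \<in> M \<and> d (\<sigma> n) (Lloc_class \<Omega> r l) < e"
    proof (intro exI[of _ "N j"] allI impI conjI \<sigma>M)
      fix n assume n: "N j \<le> n"
      have "sn k (f n) l \<le> sn k (f n) (g j) + sn k (g j) l" by (intro sn_triangle fL gL lL)
      also have "sn k (f n) (g j) < (1/2) ^ j" unfolding g_def by (rule fsn) (use j n \<phi> in auto)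
      also have "sn k (g j) l \<le> (1/2) ^ j" by (rule snl[OF j(2)])
      finally have "sn k (f n) l \<le> e / 2" using j by simp
      moreover have "sn k (f n) l = sn k (rep (\<sigma> n)) (rep (Lloc_class \<Omega> r l))"
        using sn_rep[OF fL lL, of k n] rep(2)[OF \<sigma>M[of n]] by (simp add: f_def)
      ultimately have "d (\<sigma> n) (Lloc_class \<Omega> r l) \<le> e / 2"
        using k by (intro d_le_of_sn[OF \<sigma>M class_M[OF lL], of k]) auto
      then show "d (\<sigma> n) (Lloc_class \<Omega> r l) < e" using e by simp
    qed
  qed
  then show "\<exists>x. limitin mtopology \<sigma> x sequentially" by blast
qed

end

text \<open>Finite nets for each seminorm, with centres in the family, make its image totally
  bounded in the metric; completeness turns this into compactness of the closure.\<close>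

lemma Lloc_relatively_compactI:
  fixes \<Omega> :: "'a::euclidean_space set" and f :: "'i \<Rightarrow> 'a \<Rightarrow> real"
  assumes "open \<Omega>" "r \<ge> 1" and f: "\<And>i. i \<in> I \<Longrightarrow> f i \<in> Lloc_fun \<Omega> r"
    and net: "\<And>K e. compact K \<Longrightarrow> K \<subseteq> \<Omega> \<Longrightarrow> e > 0 \<Longrightarrow>
      \<exists>F. finite F \<and> F \<subseteq> I \<and> (\<forall>i\<in>I. \<exists>j\<in>F. L_seminorm K r (\<lambda>x. f i x - f j x) < e)"
  shows "relatively_compact_in (Lloc \<Omega> r) ((\<lambda>i. Lloc_class \<Omega> r (f i)) ` I)"
proof -
  obtain C where C: "\<And>n. compact (C n)" "\<And>n. C n \<subseteq> \<Omega>" "\<And>n. C n \<subseteq> interior (C (Suc n))"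
    "\<And>K. compact K \<Longrightarrow> K \<subseteq> \<Omega> \<Longrightarrow> \<exists>N. \<forall>n\<ge>N. K \<subseteq> C n"
    using open_Union_compact_subsets[OF assms(1)] by metis
  interpret Lloc_exhaustion \<Omega> r C
  proof
    show "C n \<subseteq> C (Suc n)" for n using C(3)[of n] interior_subset by blast
    show "\<exists>n. K \<subseteq> C n" if "compact K" "K \<subseteq> \<Omega>" for K using C(4)[OF that] by blast
  qed (use assms C in auto)
  have "mtotally_bounded ((\<lambda>i. Lloc_class \<Omega> r (f i)) ` I)"
    unfolding mtotally_bounded_def
  proof (intro allI impI)
    fix e :: real assume e: "e > 0"
    obtain k where k: "1 / real (Suc k) < e / 2" using e nat_approx_posE[of "e / 2"] by auto
    obtain F where F: "finite F" "F \<subseteq> I" "\<forall>i\<in>I. \<exists>j\<in>F. L_seminorm (C k) r (\<lambda>x. f i x - f j x) < e / 2"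
      using net[OF C(1,2), of "e / 2" k] e by (metis half_gt_zero)
    show "\<exists>L. finite L \<and> L \<subseteq> (\<lambda>i. Lloc_class \<Omega> r (f i)) ` I \<and>
        (\<lambda>i. Lloc_class \<Omega> r (f i)) ` I \<subseteq> (\<Union>x\<in>L. mball x e)"
    proof (intro exI[of _ "(\<lambda>i. Lloc_class \<Omega> r (f i)) ` F"] conjI)
      show "(\<lambda>i. Lloc_class \<Omega> r (f i)) ` I \<subseteq> (\<Union>x\<in>(\<lambda>i. Lloc_class \<Omega> r (f i)) ` F. mball x e)"
      proof
        fix c assume "c \<in> (\<lambda>i. Lloc_class \<Omega> r (f i)) ` I"
        then obtain i where i: "i \<in> I" "c = Lloc_class \<Omega> r (f i)" by blast
        then obtain j where j: "j \<in> F" "sn k (f i) (f j) < e / 2" using F(3) unfolding sn_def by blast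
        have jI: "j \<in> I" using j F by auto
        have "d (Lloc_class \<Omega> r (f j)) c \<le> e / 2"
          unfolding i(2)
        proof (rule d_le_of_sn[OF class_M[OF f[OF jI]] class_M[OF f[OF i(1)]], of k])
          show "sn k (rep (Lloc_class \<Omega> r (f j))) (rep (Lloc_class \<Omega> r (f i))) \<le> e / 2"
            unfolding sn_rep[OF f[OF jI] f[OF i(1)]] using j(2) by (simp add: sn_commute)
        qed (use k in simp)
        then have "c \<in> mball (Lloc_class \<Omega> r (f j)) e"
          using e class_M[OF f[OF jI]] class_M[OF f[OF i(1)]] i(2) unfolding in_mball by simp
        then show "c \<in> (\<Union>x\<in>(\<lambda>i. Lloc_class \<Omega> r (f i)) ` F. mball x e)"
          by (rule UN_I[OF imageI[OF j(1)]])
      qed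
      show "finite ((\<lambda>i. Lloc_class \<Omega> r (f i)) ` F)" by (rule finite_imageI[OF F(1)])
      show "(\<lambda>i. Lloc_class \<Omega> r (f i)) ` F \<subseteq> (\<lambda>i. Lloc_class \<Omega> r (f i)) ` I" by (rule image_mono[OF F(2)])
    qed
  qed
  from mtotally_bounded_eq_compact_closure_of[OF mcomplete, THEN iffD1, OF this]
  show ?thesis
    unfolding relatively_compact_in_def topspace_Lloc mtopology_eq .
qed

lemma relatively_compact_in_prod:
  assumes "relatively_compact_in X A" "relatively_compact_in Y B" "S \<subseteq> A \<times> B"
  shows "relatively_compact_in (prod_topology X Y) S"
  unfolding relatively_compact_in_def
proof
  show "S \<subseteq> topspace (prod_topology X Y)"
    using assms by (auto simp: relatively_compact_in_def)
  have "compactin (prod_topology X Y) ((X closure_of A) \<times> (Y closure_of B))"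
    using assms by (simp add: relatively_compact_in_def compactin_Times)
  moreover have "prod_topology X Y closure_of S \<subseteq> (X closure_of A) \<times> (Y closure_of B)"
    using closure_of_mono[OF assms(3), of "prod_topology X Y"] by (simp add: closure_of_Times)
  ultimately show "compactin (prod_topology X Y) (prod_topology X Y closure_of S)"
    by (rule closed_compactin) simp
qed

subsection \<open>Compactness from gradient bounds\<close>

text \<open>A normalised tent. Its Lipschitz constant is what gives all mollified functions one
  modulus of continuity.\<close>

lemma tent_kernel:
  assumes "\<delta> > 0"
  obtains k :: "'a::euclidean_space \<Rightarrow> real" and L where "continuous_on UNIV k" "\<And>y. 0 \<le> k y" "\<And>y. norm y > \<delta> \<Longrightarrow> k y = 0"
    "(\<integral>y. k y \<partial>lborel) = 1" "L > 0" "\<And>y z. \<bar>k y - k z\<bar> \<le> L * norm (y - z)"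
proof -
  define k0 where "k0 y = max 0 (\<delta> - norm y)" for y :: 'a
  have c: "continuous_on UNIV k0" unfolding k0_def by (intro continuous_intros)
  have s: "k0 y = 0" if "y \<notin> cball 0 \<delta>" for y using that by (simp add: k0_def)
  have i: "integrable lborel k0" by (rule integrable_compact_support[OF c compact_cball s])
  define I where "I = (\<integral>y. k0 y \<partial>lborel)"
  have "I > 0"
  proof -
    have "measure lborel (ball (0::'a) (\<delta> / 2)) * (\<delta> / 2) = (\<integral>y. indicator (ball (0::'a) (\<delta> / 2)) y * (\<delta> / 2) \<partial>lborel)"
      by simp
    also have "\<dots> \<le> I" unfolding I_def
    proof (rule integral_mono[OF _ i])
      show "integrable lborel (\<lambda>y. indicator (ball (0::'a) (\<delta> / 2)) y * (\<delta> / 2))"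
        using emeasure_bounded_finite[OF bounded_ball[of "0::'a" "\<delta> / 2"]]
        by (intro integrable_mult_left integrable_real_indicator) auto
      show "indicator (ball (0::'a) (\<delta> / 2)) y * (\<delta> / 2) \<le> k0 y" for y
        using assms by (auto simp: indicator_def k0_def)
    qed
    finally have "measure lborel (ball (0::'a) (\<delta> / 2)) * (\<delta> / 2) \<le> I" .
    moreover have "measure lborel (ball (0::'a) (\<delta> / 2)) > 0"
      using content_ball_pos[of "\<delta> / 2" "0::'a"] assms by simp
    ultimately show ?thesis using assms by (smt (verit) half_gt_zero mult_pos_pos)
  qed
  show ?thesis
  proof (rule that[of "\<lambda>y. k0 y / I" "1 / I"])
    show "continuous_on UNIV (\<lambda>y. k0 y / I)" using c \<open>I > 0\<close> by (intro continuous_intros) auto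
    show "(\<integral>y. k0 y / I \<partial>lborel) = 1" using \<open>I > 0\<close> by (simp add: I_def)
    show "0 \<le> k0 y / I" for y using \<open>I > 0\<close> by (simp add: k0_def)
    show "k0 y / I = 0" if "norm y > \<delta>" for y using that by (simp add: k0_def)
    show "\<bar>k0 y / I - k0 z / I\<bar> \<le> 1 / I * norm (y - z)" for y z
    proof -
      have "\<bar>norm y - norm z\<bar> \<le> norm (y - z)" by (rule norm_triangle_ineq3)
      then have "\<bar>k0 y - k0 z\<bar> \<le> norm (y - z)" by (auto simp: k0_def max_def)
      then show ?thesis using \<open>I > 0\<close> by (simp add: diff_divide_distrib[symmetric] abs_divide divide_right_mono)
    qed
  qed (use \<open>I > 0\<close> in simp)
qed

text \<open>Gradient bounds make the mollifications \<open>m i\<close> uniformly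
  \<open>L1\<close>-close to \<open>g i\<close>. The \<open>m i\<close> are equibounded and
  equi-Lipschitz on one compact set, so finitely many rounded values on a finite net of points
  classify them up to a small error.\<close>

lemma L1_finite_net:
  fixes g :: "'i \<Rightarrow> 'a::euclidean_space \<Rightarrow> real"
  assumes der: "\<And>i x. i \<in> I \<Longrightarrow> (g i has_derivative (\<lambda>h. G i x \<bullet> h)) (at x)"
    and Gc: "\<And>i. i \<in> I \<Longrightarrow> continuous_on UNIV (G i)"
    and C: "compact C" "\<And>i x. i \<in> I \<Longrightarrow> x \<notin> C \<Longrightarrow> g i x = 0" "\<And>i x. i \<in> I \<Longrightarrow> x \<notin> C \<Longrightarrow> G i x = 0"
    and A: "\<And>i. i \<in> I \<Longrightarrow> (\<integral>x. \<bar>g i x\<bar> \<partial>lborel) \<le> A" "\<And>i. i \<in> I \<Longrightarrow> (\<integral>x. norm (G i x) \<partial>lborel) \<le> A"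
    and e: "e > 0"
  shows "\<exists>F. finite F \<and> F \<subseteq> I \<and> (\<forall>i\<in>I. \<exists>j\<in>F. (\<integral>x. \<bar>g i x - g j x\<bar> \<partial>lborel) < e)"
proof (cases "I = {}")
  case False
  then obtain i0 where "i0 \<in> I" by blast
  moreover have "0 \<le> (\<integral>x. \<bar>g i0 x\<bar> \<partial>lborel)" by simp
  ultimately have A0: "0 \<le> A" using A(1)[of i0] by linarith
  \<comment> \<open>Each mollification costs at most \<open>\<delta> * A \<le> e / 8\<close>; the
    mollified functions will differ by at most \<open>3 * e / 8\<close>, in total less than
    \<open>e\<close>.\<close>
  define \<delta> where "\<delta> = min 1 (e / (8 * (A + 1)))"
  have \<delta>: "\<delta> > 0" "\<delta> * A \<le> e / 8"
  proof -
    show "\<delta> > 0" using e A0 by (simp add: \<delta>_def)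
    have "\<delta> * A \<le> e / (8 * (A + 1)) * (A + 1)" using A0 e by (intro mult_mono) (auto simp: \<delta>_def)
    moreover have "e / (8 * B) * B = e / 8" if "B > 0" for B using that by simp
    ultimately show "\<delta> * A \<le> e / 8" using A0 by (metis add.commute add_pos_nonneg zero_less_one)
  qed
  obtain k :: "'a \<Rightarrow> real" and L where k: "continuous_on UNIV k" "\<And>y. 0 \<le> k y" "\<And>y. norm y > \<delta> \<Longrightarrow> k y = 0"
    "(\<integral>y. k y \<partial>lborel) = 1" and L: "L > 0" "\<And>y z. \<bar>k y - k z\<bar> \<le> L * norm (y - z)"
    using tent_kernel[OF \<delta>(1)] by metis
  have k0: "k y = 0" if "y \<notin> cball 0 \<delta>" for y using k(3) that by simp
  have ki: "integrable lborel k" by (rule integrable_compact_support[OF k(1) compact_cball k0])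
  obtain kM where kM: "kM \<ge> 0" "\<And>y. \<bar>k y\<bar> \<le> kM"
    using bounded_compact_support[OF k(1) compact_cball k0] by metis
  define C' where "C' = {x + y | x y. x \<in> C \<and> y \<in> cball 0 \<delta>}"
  have C': "compact C'" unfolding C'_def by (rule thickening_compact[OF C(1)])
  have CC': "C \<subseteq> C'" unfolding C'_def using \<delta> by (force intro: exI[of _ 0])
  have C'0: "g i (x + y) = 0" if "i \<in> I" "x \<notin> C'" "y \<in> cball 0 \<delta>" for i x y
  proof (rule C(2)[OF that(1)], rule)
    assume "x + y \<in> C"
    then have "(x + y) + (- y) \<in> C'" unfolding C'_def using that(3) by (intro CollectI exI[of _ "x + y"] exI[of _ "- y"]) auto
    then show False using that by simp
  qed
  have gc: "continuous_on UNIV (g i)" if "i \<in> I" for i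
    by (rule has_derivative_imp_continuous_on[OF der[OF that]])
  have gi: "integrable lborel (g i)" if "i \<in> I" for i
    by (rule integrable_compact_support[OF gc C(1) C(2)]) (use that in auto)
  define m where "m i x = (\<integral>y. k y * g i (x + y) \<partial>lborel)" for i x
  have kg: "integrable lborel (\<lambda>y. k y * g i (x + y))" if "i \<in> I" for i x
    by (rule integrable_compact_support[OF _ compact_cball[of 0 \<delta>]])
      (use k0 in \<open>auto intro!: continuous_intros k(1) continuous_on_compose2[OF gc[OF that]]\<close>)
  have m0: "m i x = 0" if "i \<in> I" "x \<notin> C'" for i x
  proof -
    have "k y * g i (x + y) = 0" for y using k0[of y] C'0[OF that, of y] by (cases "y \<in> cball 0 \<delta>") auto
    then have "(\<lambda>y. k y * g i (x + y)) = (\<lambda>_. 0)" by (rule ext)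
    then show ?thesis unfolding m_def by (simp only: lebesgue_integral_const scaleR_zero_right)
  qed
  have m_eq: "m i x = (\<integral>z. k (z - x) * g i z \<partial>lborel)" and m_int: "integrable lborel (\<lambda>z. k (z - x) * g i z)"
    if "i \<in> I" for i x
    using integrable_translate[OF kg[OF that, of x], of "- x"] by (simp_all add: m_def)
  have m_lip: "\<bar>m i x - m i x'\<bar> \<le> L * norm (x - x') * A" if "i \<in> I" for i x x'
  proof -
    have "m i x - m i x' = (\<integral>z. k (z - x) * g i z - k (z - x') * g i z \<partial>lborel)"
      unfolding m_eq[OF that] by (rule Bochner_Integration.integral_diff[symmetric]) (rule m_int[OF that])+
    then have "\<bar>m i x - m i x'\<bar> \<le> (\<integral>z. \<bar>k (z - x) * g i z - k (z - x') * g i z\<bar> \<partial>lborel)"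
      using integral_abs_bound by metis
    also have "\<dots> \<le> (\<integral>z. L * norm (x - x') * \<bar>g i z\<bar> \<partial>lborel)"
    proof (rule integral_mono')
      show "integrable lborel (\<lambda>z. L * norm (x - x') * \<bar>g i z\<bar>)" using gi[OF that] by simp
      fix z
      have "\<bar>k (z - x) * g i z - k (z - x') * g i z\<bar> = \<bar>k (z - x) - k (z - x')\<bar> * \<bar>g i z\<bar>"
        by (simp add: left_diff_distrib[symmetric] abs_mult)
      also have "\<dots> \<le> L * norm (x - x') * \<bar>g i z\<bar>"
        using L(2)[of "z - x" "z - x'"] by (intro mult_right_mono) (auto simp: norm_minus_commute)
      finally show "\<bar>k (z - x) * g i z - k (z - x') * g i z\<bar> \<le> L * norm (x - x') * \<bar>g i z\<bar>" .
    qed (use L in simp)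
    also have "\<dots> \<le> L * norm (x - x') * A" using A(1)[OF that] L by (simp add: mult_left_mono)
    finally show ?thesis .
  qed
  have m_bound: "\<bar>m i x\<bar> \<le> kM * A" if "i \<in> I" for i x
  proof -
    have "\<bar>m i x\<bar> \<le> (\<integral>z. \<bar>k (z - x) * g i z\<bar> \<partial>lborel)" unfolding m_eq[OF that] by (rule integral_abs_bound)
    also have "\<dots> \<le> (\<integral>z. kM * \<bar>g i z\<bar> \<partial>lborel)"
      using gi[OF that] kM by (intro integral_mono') (auto simp: abs_mult intro!: mult_right_mono)
    also have "\<dots> \<le> kM * A" using A(1)[OF that] kM by (simp add: mult_left_mono)
    finally show ?thesis .
  qed
  have mc: "continuous_on UNIV (m i)" if "i \<in> I" for i
  proof (rule lipschitz_on_continuous_on[OF lipschitz_onI])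
    show "dist (m i x) (m i y) \<le> L * A * dist x y" for x y
      using m_lip[OF that, of x y] by (simp add: dist_norm mult_ac)
    show "0 \<le> L * A" using L A0 by simp
  qed
  have mi: "integrable lborel (m i)" if "i \<in> I" for i
    by (rule integrable_compact_support[OF mc[OF that] C' m0[OF that]])
  have gm: "(\<integral>x. \<bar>g i x - m i x\<bar> \<partial>lborel) \<le> \<delta> * A" if i: "i \<in> I" for i
  proof -
    let ?f = "\<lambda>(x, y). k y * \<bar>g i (x + y) - g i x\<bar>"
    have "integrable lborel ?f"
    proof (rule integrable_compact_support[OF _ compact_Times[OF C' compact_cball[of 0 \<delta>]]])
      show "continuous_on UNIV ?f" unfolding case_prod_beta
        by (intro continuous_intros continuous_on_compose2[OF gc[OF i]] continuous_on_compose2[OF k(1)]) auto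
      show "?f z = 0" if "z \<notin> C' \<times> cball 0 \<delta>" for z
      proof (cases z)
        case (Pair x y)
        then have "y \<notin> cball 0 \<delta> \<or> (y \<in> cball 0 \<delta> \<and> x \<notin> C')" using that by auto
        then show ?thesis
        proof
          assume "y \<in> cball 0 \<delta> \<and> x \<notin> C'"
          then show ?thesis using C'0[OF i, of x y] C(2)[OF i, of x] CC' Pair by auto
        qed (use k0 Pair in auto)
      qed
    qed
    then have fi: "integrable (lborel \<Otimes>\<^sub>M lborel) ?f" by (simp add: lborel_prod)
    have "(\<integral>x. \<bar>g i x - m i x\<bar> \<partial>lborel) \<le> (\<integral>x. (\<integral>y. k y * \<bar>g i (x + y) - g i x\<bar> \<partial>lborel) \<partial>lborel)"
    proof (rule integral_mono')
      show "integrable lborel (\<lambda>x. \<integral>y. k y * \<bar>g i (x + y) - g i x\<bar> \<partial>lborel)"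
        using lborel_pair.integrable_fst'[OF fi] by simp
      fix x
      have "m i x - g i x = (\<integral>y. k y * g i (x + y) \<partial>lborel) - (\<integral>y. k y * g i x \<partial>lborel)"
        using k(4) by (simp add: m_def)
      also have "\<dots> = (\<integral>y. k y * g i (x + y) - k y * g i x \<partial>lborel)"
        by (rule Bochner_Integration.integral_diff[symmetric, OF kg[OF i]]) (use ki in simp)
      also have "\<bar>\<dots>\<bar> \<le> (\<integral>y. \<bar>k y * g i (x + y) - k y * g i x\<bar> \<partial>lborel)" by (rule integral_abs_bound)
      also have "(\<lambda>y. \<bar>k y * g i (x + y) - k y * g i x\<bar>) = (\<lambda>y. k y * \<bar>g i (x + y) - g i x\<bar>)"
        using k(2) by (auto simp: right_diff_distrib[symmetric] abs_mult)
      finally show "\<bar>g i x - m i x\<bar> \<le> (\<integral>y. k y * \<bar>g i (x + y) - g i x\<bar> \<partial>lborel)"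
        by (simp add: abs_minus_commute)
      show "0 \<le> (\<integral>y. k y * \<bar>g i (x + y) - g i x\<bar> \<partial>lborel)"
        using k(2) by (intro integral_nonneg_AE AE_I2 mult_nonneg_nonneg) auto
    qed
    also have "\<dots> = (\<integral>y. (\<integral>x. k y * \<bar>g i (x + y) - g i x\<bar> \<partial>lborel) \<partial>lborel)"
      using lborel_pair.Fubini_integral[of "\<lambda>x y. k y * \<bar>g i (x + y) - g i x\<bar>"] fi by simp
    also have "\<dots> \<le> (\<integral>y. k y * (\<delta> * A) \<partial>lborel)"
    proof (rule integral_mono')
      fix y
      show "(\<integral>x. k y * \<bar>g i (x + y) - g i x\<bar> \<partial>lborel) \<le> k y * (\<delta> * A)"
      proof (cases "norm y \<le> \<delta>")
        case True
        have Gn: "integrable lborel (\<lambda>x. norm (G i x))"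
          by (rule integrable_compact_support[OF _ C(1)]) (use C(3)[OF i] in \<open>auto intro!: continuous_intros Gc[OF i]\<close>)
        \<comment> \<open>The gradient bound enters here: a translation by \<open>y\<close> costs at
          most \<open>norm y\<close> times the \<open>L1\<close> norm of the gradient.\<close>
        have "(\<integral>x. \<bar>g i (x + y) - g i x\<bar> \<partial>lborel) \<le> (\<integral>x. \<bar>G i x \<bullet> y\<bar> \<partial>lborel)"
          by (rule integral_translate_diff_le[OF der[OF i] _ C(1) C(2)[OF i]])
            (auto intro!: continuous_intros Gc[OF i])
        also have "\<dots> \<le> (\<integral>x. norm (G i x) * norm y \<partial>lborel)"
          using Gn by (intro integral_mono') (auto simp: Cauchy_Schwarz_ineq2)
        also have "\<dots> = (\<integral>x. norm (G i x) \<partial>lborel) * norm y" by simp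
        also have "\<dots> \<le> A * \<delta>" using A(2)[OF i] True A0 by (intro mult_mono) auto
        finally show ?thesis using k(2) by (simp add: mult_left_mono mult.commute)
      qed (simp add: k(3))
    qed (use ki k \<delta> A0 in auto)
    also have "\<dots> = \<delta> * A" using k(4) by simp
    finally show ?thesis .
  qed
  define V where "V = measure lborel C' + 1"
  have V: "V > 0" by (simp add: V_def add_nonneg_pos)
  define \<eta> where "\<eta> = e / (8 * V)"
  have \<eta>: "\<eta> > 0" using e V by (simp add: \<eta>_def)
  define \<eta>1 where "\<eta>1 = \<eta> / (L * (A + 1))"
  have \<eta>1: "\<eta>1 > 0" using \<eta> L A0 by (simp add: \<eta>1_def)
  obtain P where P: "finite P" "C' \<subseteq> (\<Union>x\<in>P. ball x \<eta>1)"
    using C'[unfolded compact_eq_totally_bounded, THEN conjunct2, rule_format, OF \<eta>1] by blast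
  \<comment> \<open>The values at the net points in units of \<open>\<eta>\<close>, rounded down: a
    vector of integers from a bounded box, hence finitely many possibilities.\<close>
  define \<Phi> where "\<Phi> i = restrict (\<lambda>x. \<lfloor>m i x / \<eta>\<rfloor>) P" for i
  define T where "T = \<lceil>kM * A / \<eta>\<rceil> + 1"
  have "\<Phi> ` I \<subseteq> PiE P (\<lambda>_. {- T..T})"
  proof
    fix w assume "w \<in> \<Phi> ` I"
    then obtain i where i: "i \<in> I" "w = \<Phi> i" by blast
    have "\<lfloor>m i x / \<eta>\<rfloor> \<in> {- T..T}" for x
    proof -
      have "\<bar>m i x / \<eta>\<bar> \<le> kM * A / \<eta>"
        using m_bound[OF i(1), of x] \<eta> by (simp add: abs_divide divide_right_mono)
      also have "\<dots> \<le> real_of_int (\<lceil>kM * A / \<eta>\<rceil>)" by simp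
      finally have "\<bar>m i x / \<eta>\<bar> \<le> real_of_int (T - 1)" by (simp add: T_def)
      then have "m i x / \<eta> \<le> real_of_int T - 1" "- (m i x / \<eta>) \<le> real_of_int T - 1"
        unfolding abs_le_iff of_int_diff of_int_1 by blast+
      then have "- real_of_int T \<le> m i x / \<eta>" "m i x / \<eta> \<le> real_of_int T" by linarith+
      then show ?thesis by (simp add: le_floor_iff floor_le_iff)
    qed
    then show "w \<in> PiE P (\<lambda>_. {- T..T})" by (simp add: i(2) \<Phi>_def)
  qed
  moreover have "finite (PiE P (\<lambda>_. {- T..T}))" using P by (intro finite_PiE) auto
  ultimately have "finite (\<Phi> ` I)" by (rule finite_subset)
  then obtain F where F: "F \<subseteq> I" "finite F" "\<Phi> ` I = \<Phi> ` F"
    using finite_subset_image[of "\<Phi> ` I" \<Phi> I] by blast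
  have "\<exists>j\<in>F. (\<integral>x. \<bar>g i x - g j x\<bar> \<partial>lborel) < e" if i: "i \<in> I" for i
  proof -
    have "\<Phi> i \<in> \<Phi> ` F" using F(3) i by blast
    then obtain j where j: "j \<in> F" "\<Phi> i = \<Phi> j" by blast
    have jI: "j \<in> I" using F j by blast
    \<comment> \<open>One \<open>\<eta>\<close> for the rounding, and one for moving each of the two
      functions to a net point.\<close>
    have close: "\<bar>m i x - m j x\<bar> \<le> 3 * \<eta>" if x: "x \<in> C'" for x
    proof -
      obtain y where y: "y \<in> P" "dist y x < \<eta>1" using P(2) x by auto
      have "\<lfloor>m i y / \<eta>\<rfloor> = \<lfloor>m j y / \<eta>\<rfloor>" using j(2) y(1) unfolding \<Phi>_def by (metis restrict_apply')
      then have "\<bar>m i y / \<eta> - m j y / \<eta>\<bar> \<le> 1" by linarith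
      then have 1: "\<bar>m i y - m j y\<bar> \<le> \<eta>"
        using \<eta> by (simp add: diff_divide_distrib[symmetric] abs_divide)
      have 2: "\<bar>m l x - m l y\<bar> \<le> \<eta>" if "l \<in> I" for l
      proof -
        have "\<bar>m l x - m l y\<bar> \<le> L * norm (x - y) * A" by (rule m_lip[OF that])
        also have "\<dots> \<le> L * \<eta>1 * (A + 1)"
          using y L A0 \<eta>1 by (intro mult_mono) (auto simp: dist_norm norm_minus_commute)
        also have "\<dots> = \<eta>" using L A0 by (simp add: \<eta>1_def)
        finally show ?thesis .
      qed
      show ?thesis using 1 2[OF i] 2[OF jI] by linarith
    qed
    have C'i: "integrable lborel (indicator C' :: 'a \<Rightarrow> real)"
      using borel_integrable_compact[OF C', of "\<lambda>x. 1::real"] by simp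
    have "(\<integral>x. \<bar>m i x - m j x\<bar> \<partial>lborel) \<le> (\<integral>x. 3 * \<eta> * indicator C' x \<partial>lborel)"
    proof (rule integral_mono')
      show "\<bar>m i x - m j x\<bar> \<le> 3 * \<eta> * indicator C' x" for x
        using close[of x] m0[OF i, of x] m0[OF jI, of x] by (cases "x \<in> C'") auto
    qed (use C'i \<eta> in auto)
    also have "\<dots> = 3 * \<eta> * measure lborel C'" by simp
    also have "\<dots> \<le> 3 * \<eta> * V" using \<eta> by (simp add: V_def)
    also have "\<dots> = 3 * e / 8" using V by (simp add: \<eta>_def)
    finally have mm: "(\<integral>x. \<bar>m i x - m j x\<bar> \<partial>lborel) \<le> 3 * e / 8" .
    have "(\<integral>x. \<bar>g i x - g j x\<bar> \<partial>lborel)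
        \<le> (\<integral>x. \<bar>g i x - m i x\<bar> + \<bar>m i x - m j x\<bar> + \<bar>g j x - m j x\<bar> \<partial>lborel)"
      by (rule integral_mono) (use gi[OF i] gi[OF jI] mi[OF i] mi[OF jI] in auto)
    also have "\<dots> = (\<integral>x. \<bar>g i x - m i x\<bar> \<partial>lborel) + (\<integral>x. \<bar>m i x - m j x\<bar> \<partial>lborel) + (\<integral>x. \<bar>g j x - m j x\<bar> \<partial>lborel)"
      using gi[OF i] gi[OF jI] mi[OF i] mi[OF jI] by simp
    also have "\<dots> \<le> \<delta> * A + 3 * e / 8 + \<delta> * A" using gm[OF i] gm[OF jI] mm by linarith
    also have "\<dots> < e" using \<delta> e by linarith
    finally show ?thesis using j(1) by blast
  qed
  then show ?thesis using F by blast
qed auto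

section \<open>Gradient bounds and finite nets for superharmonic functions\<close>

context cutoff
begin

text \<open>Green's identity for \<open>f powr (a - 1) * H ^ 3 * gf\<close>. Superharmonicity makes
  the Laplacian term favourable, so the weighted integral of
  \<open>f powr (a - 2) * norm (gf)^2\<close> is bounded by that of \<open>f powr a\<close>. The
  arithmetic-geometric inequality splits \<open>norm gf\<close> into this density and
  \<open>f powr (2 - a)\<close>.\<close>

lemma superharmonic_gradient_bound:
  assumes f: "has_laplacian UNIV f gf lf" "\<And>x. f x > 0" "\<And>x. lf x \<le> 0" and a: "0 < a" "a < 1"
  shows "(\<integral>x. norm (gf x) * H x ^ 3 \<partial>lborel)
    \<le> ((3 * M) / (1 - a))\<^sup>2 * (\<integral>x. f x powr a * H x \<partial>lborel) + (\<integral>x. f x powr (2 - a) * H x ^ 3 \<partial>lborel)"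
proof -
  note fD = has_laplacianD[OF f(1)]
  have fnz: "f x \<noteq> 0" for x using f(2)[of x] by simp
  let ?X = "\<integral>x. f x powr 0 * f x powr (a - 2) * (norm (gf x))\<^sup>2 * H x ^ 3 \<partial>lborel"
  let ?Y = "\<integral>x. f x powr 0 * f x powr (a - 2 + 1) * lf x * H x ^ 3 \<partial>lborel"
  let ?L = "\<integral>x. f x powr 0 * f x powr (a - 2 + 2) * H x ^ (3 - 2) \<partial>lborel"
  have "\<bar>(a - 2 + 1) * ?X + 0 * (\<integral>x. f x powr (0 - 1) * f x powr (a - 2 + 1) * (gf x \<bullet> gf x) * H x ^ 3 \<partial>lborel) + ?Y\<bar>
      \<le> (1 - a) / 2 * ?X + (real 3 * M)\<^sup>2 / (4 * ((1 - a) / 2)) * ?L"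
    using a by (intro mixed_identity[OF f(1,2) f(1,2)]) auto
  moreover have "?Y \<le> 0"
  proof -
    have "0 \<le> (\<integral>x. - (f x powr 0 * f x powr (a - 2 + 1) * lf x * H x ^ 3) \<partial>lborel)"
      using f(3) H_bounds
      by (intro integral_nonneg_AE AE_I2) (simp add: mult_nonneg_nonpos mult_nonpos_nonneg)
    then show ?thesis unfolding Bochner_Integration.integral_minus by simp
  qed
  moreover have "?X \<ge> 0" using H_bounds by (intro integral_nonneg_AE AE_I2) auto
  ultimately have "(1 - a) * ?X \<le> (1 - a) / 2 * ?X + (real 3 * M)\<^sup>2 / (4 * ((1 - a) / 2)) * ?L"
    by (simp add: abs_le_iff algebra_simps)
  moreover have "(1 - a) * ?X = (1 - a) / 2 * ?X + (1 - a) / 2 * ?X" by (simp add: field_simps)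
  ultimately have 0: "(1 - a) / 2 * ?X \<le> (real 3 * M)\<^sup>2 / (4 * ((1 - a) / 2)) * ?L" by linarith
  have gen: "X \<le> ((3 * M) / b)\<^sup>2 * L" if "b / 2 * X \<le> (real 3 * M)\<^sup>2 / (4 * (b / 2)) * L" "b > 0" for b X L
    using that by (simp add: field_simps power2_eq_square)
  have X: "?X \<le> ((3 * M) / (1 - a))\<^sup>2 * ?L"
    by (rule gen[OF 0]) (use a in simp)
  have L: "?L = (\<integral>x. f x powr a * H x \<partial>lborel)" using fnz by simp
  have "(\<integral>x. norm (gf x) * H x ^ 3 \<partial>lborel)
      \<le> (\<integral>x. f x powr 0 * f x powr (a - 2) * (norm (gf x))\<^sup>2 * H x ^ 3 + f x powr (2 - a) * H x ^ 3 \<partial>lborel)"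
  proof (rule integral_mono)
    show "integrable lborel (\<lambda>x. norm (gf x) * H x ^ 3)"
      by (intro integrable_H continuous_intros fD) simp
    show "integrable lborel (\<lambda>x. f x powr 0 * f x powr (a - 2) * (norm (gf x))\<^sup>2 * H x ^ 3 + f x powr (2 - a) * H x ^ 3)"
      by (intro Bochner_Integration.integrable_add integrable_H continuous_intros fD) (use fnz in auto)
    fix x
    define s where "s = f x powr (a - 2)"
    have s: "s > 0" "f x powr (2 - a) = 1 / s"
      using f(2)[of x] powr_minus_divide[of "f x" "a - 2"] by (auto simp: s_def)
    define n where "n = norm (gf x)"
    have "0 \<le> (s * n - 1)\<^sup>2 / s" using s by simp
    then have "2 * n \<le> s * n\<^sup>2 + 1 / s" using s by (simp add: power2_eq_square field_simps)
    then have "n \<le> s * n\<^sup>2 + 1 / s" using s by (smt (verit) norm_ge_zero n_def)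
    then have "n * H x ^ 3 \<le> (s * n\<^sup>2 + 1 / s) * H x ^ 3" using H_bounds by (intro mult_right_mono) auto
    then show "norm (gf x) * H x ^ 3 \<le> f x powr 0 * f x powr (a - 2) * (norm (gf x))\<^sup>2 * H x ^ 3 + f x powr (2 - a) * H x ^ 3"
      using fnz[of x] by (simp add: s(2) s_def[symmetric] n_def distrib_right)
  qed
  also have "\<dots> = ?X + (\<integral>x. f x powr (2 - a) * H x ^ 3 \<partial>lborel)"
    by (intro Bochner_Integration.integral_add integrable_H continuous_intros fD) (use fnz in auto)
  finally show ?thesis using X unfolding L by linarith
qed

lemma superharmonic_L1_net:
  fixes f :: "'i \<Rightarrow> 'a \<Rightarrow> real"
  assumes f: "\<And>i. i \<in> I \<Longrightarrow> has_laplacian UNIV (f i) (gf i) (lf i)" "\<And>i x. i \<in> I \<Longrightarrow> f i x > 0" "\<And>i x. i \<in> I \<Longrightarrow> lf i x \<le> 0"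
    and P: "P > 1" and A: "\<And>i. i \<in> I \<Longrightarrow> (\<integral>x. indicator C x * f i x powr P \<partial>lborel) \<le> A" and e: "e > 0"
  shows "\<exists>F. finite F \<and> F \<subseteq> I \<and> (\<forall>i\<in>I. \<exists>j\<in>F. (\<integral>x. \<bar>f i x - f j x\<bar> * H x ^ 3 \<partial>lborel) < e)"
proof -
  \<comment> \<open>Any integrability \<open>P > 1\<close> suffices: for \<open>a\<close> close
    enough to 1, still below it, the exponent \<open>2 - a\<close> does not exceed
    \<open>P\<close>.\<close>
  define a where "a = max (1/2) (2 - P)"
  have a: "0 < a" "a < 1" "2 - a \<le> P" using P by (auto simp: a_def)
  define V where "V = measure lborel C + A"
  have iC: "integrable lborel (indicator C :: 'a \<Rightarrow> real)"
    using borel_integrable_compact[OF C(1), of "\<lambda>x. 1::real"] by simp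
  have pw: "(\<integral>x. f i x powr b * H x ^ k \<partial>lborel) \<le> M ^ k * V" if i: "i \<in> I" and b: "0 \<le> b" "b \<le> P" and k: "k > 0" for i b k
  proof -
    have fc: "continuous_on UNIV (f i)" by (rule has_laplacianD[OF f(1)[OF i]])
    have iP: "integrable lborel (\<lambda>x. indicator C x * f i x powr P)"
      using borel_integrable_compact[OF C(1), of "\<lambda>x. f i x powr P"] f(2)[OF i]
      by (simp add: continuous_on_powr continuous_on_subset[OF fc] less_imp_neq[symmetric])
    have "(\<integral>x. f i x powr b * H x ^ k \<partial>lborel) \<le> (\<integral>x. M ^ k * (indicator C x + indicator C x * f i x powr P) \<partial>lborel)"
    proof (rule integral_mono')
      show "integrable lborel (\<lambda>x. M ^ k * (indicator C x + indicator C x * f i x powr P))"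
        using iC iP by simp
      fix x
      show "f i x powr b * H x ^ k \<le> M ^ k * (indicator C x + indicator C x * f i x powr P)"
      proof (cases "x \<in> C")
        case True
        have "f i x powr b \<le> 1 + f i x powr P"
        proof (cases "f i x \<le> 1")
          case True
          then have "f i x powr b \<le> 1" using f(2)[OF i, of x] b by (simp add: powr_le1)
          then show ?thesis by (simp add: add_increasing2)
        next
          case False
          then have "f i x powr b \<le> f i x powr P" using b by (intro powr_mono) auto
          then show ?thesis by simp
        qed
        moreover have "H x ^ k \<le> M ^ k" using H_bounds by (intro power_mono) auto
        ultimately have "f i x powr b * H x ^ k \<le> (1 + f i x powr P) * M ^ k"
          using H_bounds by (intro mult_mono) (auto simp: add_nonneg_nonneg)
        then show ?thesis using True by (simp add: mult.commute)
      qed (use k in \<open>simp add: H_outside power_0_left\<close>)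
      show "0 \<le> M ^ k * (indicator C x + indicator C x * f i x powr P)" using M(1) by simp
    qed
    also have "\<dots> = M ^ k * (measure lborel C + (\<integral>x. indicator C x * f i x powr P \<partial>lborel))"
      using iC iP C(1) by (simp add: borel_compact)
    also have "\<dots> \<le> M ^ k * V" using A[OF i] M(1) by (intro mult_left_mono) (auto simp: V_def)
    finally show ?thesis .
  qed
  define B where "B = ((3 * M) / (1 - a))\<^sup>2 * (M ^ 1 * V) + M ^ 3 * V"
  have gb: "(\<integral>x. norm (gf i x) * H x ^ 3 \<partial>lborel) \<le> B" if i: "i \<in> I" for i
  proof -
    have "(\<integral>x. f i x powr a * H x ^ 1 \<partial>lborel) \<le> M ^ 1 * V" by (rule pw[OF i]) (use a P in auto)
    then have "((3 * M) / (1 - a))\<^sup>2 * (\<integral>x. f i x powr a * H x \<partial>lborel) \<le> ((3 * M) / (1 - a))\<^sup>2 * (M ^ 1 * V)"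
      by (intro mult_left_mono) auto
    moreover have "(\<integral>x. f i x powr (2 - a) * H x ^ 3 \<partial>lborel) \<le> M ^ 3 * V" by (rule pw[OF i]) (use a in auto)
    ultimately show ?thesis
      using superharmonic_gradient_bound[OF f(1)[OF i] f(2)[OF i] f(3)[OF i] a(1,2)] unfolding B_def by linarith
  qed
  define g where "g i x = f i x * H x ^ 3" for i x
  define G where "G i x = f i x *\<^sub>R gH 3 x + H x ^ 3 *\<^sub>R gf i x" for i x
  have H3: "has_laplacian UNIV (\<lambda>x. H x ^ 3) (gH 3) (lH 3)" by (rule H_laplacian) simp
  define A' where "A' = max (M ^ 3 * V) (3 * M * (M ^ 2 * V) + B)"
  have "\<exists>F. finite F \<and> F \<subseteq> I \<and> (\<forall>i\<in>I. \<exists>j\<in>F. (\<integral>x. \<bar>g i x - g j x\<bar> \<partial>lborel) < e)"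
  proof (rule L1_finite_net[where G = G and C = C and A = A'])
    fix i assume i: "i \<in> I"
    note fD = has_laplacianD[OF f(1)[OF i]]
    note mD = has_laplacianD[OF has_laplacian_mult[OF f(1)[OF i] H3]]
    show "(g i has_derivative (\<lambda>h. G i x \<bullet> h)) (at x)" for x
      using mD(1)[of x] by (simp add: g_def[abs_def] G_def)
    show "continuous_on UNIV (G i)" using mD(3) by (simp add: G_def[abs_def])
    show "g i x = 0" "G i x = 0" if "x \<notin> C" for x
      using H_outside[OF that] by (auto simp: g_def G_def gH_def)
    have f1: "(\<integral>x. f i x * H x ^ k \<partial>lborel) \<le> M ^ k * V" if "k > 0" for k
    proof -
      have "(\<lambda>x. f i x powr 1 * H x ^ k) = (\<lambda>x. f i x * H x ^ k)" using f(2)[OF i] by (auto simp: less_imp_le)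
      then show ?thesis using pw[OF i, of 1 k] P that by simp
    qed
    have "\<bar>g i x\<bar> = f i x * H x ^ 3" for x using f(2)[OF i, of x] H_bounds(1)[of x] by (simp add: g_def)
    then show "(\<integral>x. \<bar>g i x\<bar> \<partial>lborel) \<le> A'" using f1[of 3] by (simp add: A'_def)
    have "(\<integral>x. norm (G i x) \<partial>lborel) \<le> (\<integral>x. 3 * M * (f i x * H x ^ 2) + norm (gf i x) * H x ^ 3 \<partial>lborel)"
    proof (rule integral_mono')
      show "integrable lborel (\<lambda>x. 3 * M * (f i x * H x ^ 2) + norm (gf i x) * H x ^ 3)"
        by (intro Bochner_Integration.integrable_add integrable_mult_right integrable_H continuous_intros fD) auto
      fix x
      have "norm (G i x) \<le> f i x * norm (gH 3 x) + H x ^ 3 * norm (gf i x)"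
        unfolding G_def using f(2)[OF i, of x] H_bounds(1)[of x]
        by (intro order_trans[OF norm_triangle_ineq]) simp
      also have "f i x * norm (gH 3 x) \<le> f i x * (real 3 * M * H x ^ (3 - 1))"
        using f(2)[OF i, of x] by (intro mult_left_mono gH_bound) auto
      finally show "norm (G i x) \<le> 3 * M * (f i x * H x ^ 2) + norm (gf i x) * H x ^ 3"
        by (simp add: mult_ac)
      show "0 \<le> 3 * M * (f i x * H x ^ 2) + norm (gf i x) * H x ^ 3"
        using M(1) f(2)[OF i, of x] H_bounds(1)[of x] by (intro add_nonneg_nonneg mult_nonneg_nonneg) auto
    qed
    also have "\<dots> = 3 * M * (\<integral>x. f i x * H x ^ 2 \<partial>lborel) + (\<integral>x. norm (gf i x) * H x ^ 3 \<partial>lborel)"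
      by (subst Bochner_Integration.integral_add)
        (auto intro!: integrable_mult_right integrable_H continuous_intros fD)
    also have "\<dots> \<le> 3 * M * (M ^ 2 * V) + B"
      using f1[of 2] gb[OF i] M(1) by (intro add_mono mult_left_mono) auto
    finally show "(\<integral>x. norm (G i x) \<partial>lborel) \<le> A'" by (simp add: A'_def)
  qed (rule C(1), rule e)
  moreover have "\<bar>g i x - g j x\<bar> = \<bar>f i x - f j x\<bar> * H x ^ 3" for i j x
    using H_bounds(1)[of x] by (simp add: g_def left_diff_distrib[symmetric] abs_mult)
  ultimately show ?thesis by simp
qed

end

section \<open>From annuli to the punctured space\<close>

lemma lebesgue_on_compact:
  fixes f :: "'a::euclidean_space \<Rightarrow> real"
  assumes "compact K" "continuous_on K f"
  shows "integrable (lebesgue_on K) f" "(\<integral>x. f x \<partial>lebesgue_on K) = (\<integral>x. indicator K x * f x \<partial>lborel)"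
    "integrable lborel (\<lambda>x. indicator K x * f x)"
proof -
  have s: "K \<inter> space lebesgue \<in> sets lebesgue" using assms(1) lmeasurable_compact fmeasurableD by auto
  show i: "integrable lborel (\<lambda>x. indicator K x * f x)"
    using borel_integrable_compact[OF assms] by simp
  then have "integrable lebesgue (\<lambda>x. indicator K x *\<^sub>R f x)"
    by (simp add: integrable_completion borel_measurable_integrable)
  then show "integrable (lebesgue_on K) f" by (simp add: integrable_restrict_space[OF s])
  show "(\<integral>x. f x \<partial>lebesgue_on K) = (\<integral>x. indicator K x * f x \<partial>lborel)"
    using i unfolding integral_restrict_space[OF s] by (simp add: integral_completion borel_measurable_integrable)
qed

definition annulus :: "real \<Rightarrow> real \<Rightarrow> 'a::euclidean_space set" where
  "annulus a b = {x. a \<le> (norm x)\<^sup>2 \<and> (norm x)\<^sup>2 \<le> b}"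

text \<open>A polynomial in the squared norm, hence twice differentiable also at the origin; for
  \<open>a \<le> b\<close> it is nonpositive outside the annulus.\<close>

definition annulus_fun :: "real \<Rightarrow> real \<Rightarrow> 'a::euclidean_space \<Rightarrow> real" where
  "annulus_fun a b x = ((norm x)\<^sup>2 - a) * (b - (norm x)\<^sup>2)"

lemma compact_annulus: "compact (annulus a b)"
proof -
  have "closed (annulus a b)" unfolding annulus_def Collect_conj_eq
    by (intro closed_Int closed_Collect_le continuous_intros)
  moreover have "annulus a b \<subseteq> cball 0 (sqrt b)"
    unfolding annulus_def by (auto intro: real_le_rsqrt)
  ultimately show ?thesis using bounded_subset[OF bounded_cball] compact_eq_bounded_closed by blast
qed

lemma annulus_cutoff:
  assumes "a \<le> b"
  obtains gh lh M where "cutoff (annulus_fun a b :: 'a::euclidean_space \<Rightarrow> real) gh lh (annulus a b) M"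
proof -
  define \<theta> \<theta>1 \<theta>2 where "\<theta> t = (t - a) * (b - t)" and "\<theta>1 t = a + b - 2 * t" and "\<theta>2 t = (- 2 :: real)" for t
  obtain gh lh where h: "has_laplacian UNIV (annulus_fun a b :: 'a \<Rightarrow> real) gh lh"
  proof -
    have "has_laplacian UNIV (\<lambda>x::'a. \<theta> ((norm (x - 0))\<^sup>2)) (\<lambda>x. \<theta>1 ((norm (x - 0))\<^sup>2) *\<^sub>R (2 *\<^sub>R (x - 0)))
       (\<lambda>x. \<theta>1 ((norm (x - 0))\<^sup>2) * (2 * real DIM('a)) + \<theta>2 ((norm (x - 0))\<^sup>2) * (norm (2 *\<^sub>R (x - 0)))\<^sup>2)"
      by (rule has_laplacian_compose[OF has_laplacian_norm_square])
        (auto simp: \<theta>_def \<theta>1_def \<theta>2_def intro!: derivative_eq_intros)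
    then show ?thesis using that by (simp add: \<theta>_def annulus_fun_def[abs_def])
  qed
  note hD = has_laplacianD[OF h]
  have out: "annulus_fun a b x \<le> 0" if "x \<notin> annulus a b" for x :: 'a
    using that assms by (auto simp: annulus_def annulus_fun_def mult_le_0_iff)
  have "compact ((\<lambda>x. \<bar>annulus_fun a b x\<bar> + norm (gh x) + \<bar>lh x\<bar>) ` (annulus a b :: 'a set))"
    by (intro compact_continuous_image compact_annulus continuous_intros continuous_on_subset[OF hD(2)]
        continuous_on_subset[OF hD(3)] continuous_on_subset[OF hD(4)]) auto
  then obtain M0 where M0: "\<forall>y\<in>(\<lambda>x. \<bar>annulus_fun a b x\<bar> + norm (gh x) + \<bar>lh x\<bar>) ` (annulus a b :: 'a set). \<bar>y\<bar> \<le> M0"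
    using compact_imp_bounded bounded_real by metis
  define M where "M = max 1 M0"
  have M: "\<bar>annulus_fun a b x\<bar> + norm (gh x) + \<bar>lh x\<bar> \<le> M" if "annulus_fun a b x > 0" for x
  proof -
    have "x \<in> annulus a b" using out[of x] that by (cases "x \<in> annulus a b") auto
    then have "\<bar>\<bar>annulus_fun a b x\<bar> + norm (gh x) + \<bar>lh x\<bar>\<bar> \<le> M0" using M0 by blast
    then show ?thesis unfolding M_def by linarith
  qed
  have "cutoff (annulus_fun a b :: 'a \<Rightarrow> real) gh lh (annulus a b) M"
  proof
    fix x :: 'a
    assume pos: "annulus_fun a b x > 0"
    show "annulus_fun a b x \<le> M" "norm (gh x) \<le> M" "\<bar>lh x\<bar> \<le> M"
      using M[OF pos] norm_ge_zero[of "gh x"] by linarith+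
  qed (use h compact_annulus out in \<open>auto simp: M_def\<close>)
  then show ?thesis by (rule that)
qed

lemma compact_subset_annulus:
  fixes K :: "'a::euclidean_space set"
  assumes "compact K" "K \<subseteq> - {0}"
  obtains a b \<kappa> where "0 < a" "a \<le> b" "annulus a b \<subseteq> - {0 :: 'a}" "0 < \<kappa>" "\<And>x. x \<in> K \<Longrightarrow> x \<in> annulus a b" "\<And>x. x \<in> K \<Longrightarrow> \<kappa> \<le> annulus_fun a b x"
proof (cases "K = {}")
  case True
  show ?thesis by (rule that[of 1 1 1]) (auto simp: True annulus_def)
next
  case False
  have c: "continuous_on K norm" by (intro continuous_intros)
  obtain x0 where x0: "x0 \<in> K" "\<And>x. x \<in> K \<Longrightarrow> norm x0 \<le> norm x"
    using continuous_attains_inf[OF assms(1) False c] by blast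
  obtain x1 where x1: "x1 \<in> K" "\<And>x. x \<in> K \<Longrightarrow> norm x \<le> norm x1"
    using continuous_attains_sup[OF assms(1) False c] by blast
  have n0: "norm x0 > 0" using x0 assms(2) by auto
  define a where "a = (norm x0)\<^sup>2 / 2"
  define b where "b = (norm x1)\<^sup>2 + 1"
  have a: "a > 0" using n0 by (simp add: a_def)
  have l: "a \<le> (norm x)\<^sup>2 - a" if "x \<in> K" for x
    using power_mono[OF x0(2)[OF that] norm_ge_zero, of 2] by (simp add: a_def)
  have u: "1 \<le> b - (norm x)\<^sup>2" if "x \<in> K" for x
    using power_mono[OF x1(2)[OF that] norm_ge_zero, of 2] by (simp add: b_def)
  show ?thesis
  proof (rule that[of a b "a * 1"])
    show "annulus a b \<subseteq> - {0 :: 'a}" using a by (auto simp: annulus_def)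
    show "a \<le> b" using l[OF x0(1)] u[OF x0(1)] a by linarith
    show "x \<in> annulus a b" if "x \<in> K" for x using l[OF that] u[OF that] a by (simp add: annulus_def)
    show "a * 1 \<le> annulus_fun a b x" if "x \<in> K" for x
      unfolding annulus_fun_def using l[OF that] u[OF that] a by (intro mult_mono) auto
  qed (use a in auto)
qed

text \<open>An \<open>L1\<close> net becomes an \<open>L^r\<close> net by splitting the differences
  \<open>y\<close> at a level \<open>T\<close>: \<open>y powr r \<le> T powr (r - 1) * y\<close>
  below it and \<open>y powr r \<le> T powr (r - P) * y powr P\<close> above it. The spare
  integrability \<open>P > r\<close> makes the second part small uniformly.\<close>

lemma superharmonic_family_relatively_compact:
  fixes f :: "'i \<Rightarrow> 'a::euclidean_space \<Rightarrow> real"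
  assumes r: "r \<ge> 1"
    and f: "\<And>i. i \<in> I \<Longrightarrow> has_laplacian UNIV (f i) (gf i) (lf i)" "\<And>i x. i \<in> I \<Longrightarrow> f i x > 0" "\<And>i x. i \<in> I \<Longrightarrow> lf i x \<le> 0"
    and bound: "\<And>K. compact K \<Longrightarrow> K \<subseteq> - {0} \<Longrightarrow>
      \<exists>P>r. \<exists>A. \<forall>i\<in>I. (\<integral>x. indicator K x * f i x powr P \<partial>lborel) \<le> A"
  shows "relatively_compact_in (Lloc (- {0}) r) ((\<lambda>i. Lloc_class (- {0}) r (f i)) ` I)"
proof (rule Lloc_relatively_compactI)
  show "open (- {0 :: 'a})" by (rule open_Compl) simp
  have fc: "continuous_on S (f i)" if "i \<in> I" for i S
    by (rule continuous_on_subset[OF has_laplacianD(2)[OF f(1)[OF that]]]) simp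
  have fnz: "f i x \<noteq> 0" if "i \<in> I" for i x using f(2)[OF that, of x] by simp
  show "f i \<in> Lloc_fun (- {0}) r" if i: "i \<in> I" for i
    unfolding Lloc_fun_def
  proof (intro CollectI conjI allI impI)
    have "f i \<in> borel_measurable borel" by (rule borel_measurable_continuous_onI[OF fc[OF i]])
    then show "f i \<in> borel_measurable (lebesgue_on (- {0}))"
      by (intro measurable_restrict_space1 measurable_completion) simp
    fix K assume K: "compact K \<and> K \<subseteq> - {0 :: 'a}"
    have "continuous_on K (\<lambda>x. \<bar>f i x\<bar> powr r)"
      using fnz[OF i] by (intro continuous_intros fc[OF i]) auto
    then show "integrable (lebesgue_on K) (\<lambda>x. \<bar>f i x\<bar> powr r)"
      using K by (intro lebesgue_on_compact(1)) auto
  qed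
  fix K :: "'a set" and e :: real
  assume K: "compact K" "K \<subseteq> - {0}" and e: "e > 0"
  obtain a b \<kappa> where ab: "0 < a" "a \<le> b" "annulus a b \<subseteq> - {0 :: 'a}" "0 < \<kappa>" "\<And>x. x \<in> K \<Longrightarrow> x \<in> annulus a b"
    "\<And>x. x \<in> K \<Longrightarrow> \<kappa> \<le> annulus_fun a b x"
    using compact_subset_annulus[OF K] by metis
  obtain P A where P: "P > r" and A: "\<And>i. i \<in> I \<Longrightarrow> (\<integral>x. indicator (annulus a b) x * f i x powr P \<partial>lborel) \<le> A"
    using bound[OF compact_annulus ab(3)] by blast
  obtain gh lh M where cut: "cutoff (annulus_fun a b :: 'a \<Rightarrow> real) gh lh (annulus a b) M"
    using annulus_cutoff[OF ab(2)] by metis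
  interpret cutoff "annulus_fun a b :: 'a \<Rightarrow> real" gh lh "annulus a b" M by (rule cut)
  define B where "B = 2 powr P * (A + A)"
  define \<epsilon> where "\<epsilon> = e powr r / 2"
  have \<epsilon>: "\<epsilon> > 0" using e by (simp add: \<epsilon>_def)
  \<comment> \<open>The level is fixed by the uniform \<open>L^P\<close> bound, before the
    \<open>L1\<close> accuracy \<open>e'\<close>, which has to compensate for
    \<open>T powr (r - 1)\<close> and for the lower bound \<open>\<kappa>\<close> of the cut-off on
    \<open>K\<close>.\<close>
  define T where "T = (\<epsilon> / (\<bar>B\<bar> + 1)) powr (1 / (r - P))"
  have T: "T > 0" "T powr (r - P) = \<epsilon> / (\<bar>B\<bar> + 1)" using \<epsilon> P by (auto simp: T_def powr_powr)
  have TB: "T powr (r - P) * B \<le> \<epsilon>"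
  proof -
    have "\<epsilon> / (\<bar>B\<bar> + 1) * B \<le> \<epsilon> / (\<bar>B\<bar> + 1) * (\<bar>B\<bar> + 1)" using \<epsilon> by (intro mult_left_mono) auto
    also have "\<dots> = \<epsilon>" by simp
    finally show ?thesis by (simp add: T)
  qed
  define e' where "e' = \<epsilon> * \<kappa> ^ 3 / T powr (r - 1)"
  have e': "e' > 0" using \<epsilon> ab T by (simp add: e'_def)
  have P1: "P > 1" using P r by simp
  obtain F where F0: "finite F \<and> F \<subseteq> I \<and> (\<forall>i\<in>I. \<exists>j\<in>F. (\<integral>x. \<bar>f i x - f j x\<bar> * H x ^ 3 \<partial>lborel) < e')"
    by (rule exE[OF superharmonic_L1_net[OF f P1 A e']])
  note F = F0[THEN conjunct1] F0[THEN conjunct2, THEN conjunct1] F0[THEN conjunct2, THEN conjunct2, rule_format]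
  have close: "L_seminorm K r (\<lambda>x. f i x - f j x) < e"
    if i: "i \<in> I" and j: "j \<in> I" and d: "(\<integral>x. \<bar>f i x - f j x\<bar> * H x ^ 3 \<partial>lborel) < e'" for i j
  proof -
    have HK: "\<kappa> \<le> H x" if "x \<in> K" for x using ab(6)[OF that] by (simp add: H_def)
    have iP: "integrable lborel (\<lambda>x. indicator (annulus a b) x * f l x powr P)" if "l \<in> I" for l
      using fnz[OF that] by (intro lebesgue_on_compact(3) compact_annulus continuous_intros fc[OF that]) auto
    have iH: "integrable lborel (\<lambda>x. \<bar>f i x - f j x\<bar> * H x ^ 3)"
      by (intro integrable_H continuous_intros fc i j) simp
    have c: "continuous_on K (\<lambda>x. \<bar>f i x - f j x\<bar> powr r)"
      using r by (intro continuous_on_powr' continuous_intros fc i j) auto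
    have "(\<integral>x. \<bar>f i x - f j x\<bar> powr r \<partial>lebesgue_on K) = (\<integral>x. indicator K x * \<bar>f i x - f j x\<bar> powr r \<partial>lborel)"
      by (rule lebesgue_on_compact(2)[OF K(1) c])
    also have "\<dots> \<le> (\<integral>x. T powr (r - 1) / \<kappa> ^ 3 * (\<bar>f i x - f j x\<bar> * H x ^ 3) + T powr (r - P) * (2 powr P *
        (indicator (annulus a b) x * f i x powr P + indicator (annulus a b) x * f j x powr P)) \<partial>lborel)"
    proof (rule integral_mono[OF lebesgue_on_compact(3)[OF K(1) c]])
      show "integrable lborel (\<lambda>x. T powr (r - 1) / \<kappa> ^ 3 * (\<bar>f i x - f j x\<bar> * H x ^ 3) + T powr (r - P) * (2 powr P *
        (indicator (annulus a b) x * f i x powr P + indicator (annulus a b) x * f j x powr P)))"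
        by (intro Bochner_Integration.integrable_add integrable_mult_right iH iP i j)
      fix x
      let ?R = "T powr (r - 1) / \<kappa> ^ 3 * (\<bar>f i x - f j x\<bar> * H x ^ 3) + T powr (r - P) * (2 powr P *
        (indicator (annulus a b) x * f i x powr P + indicator (annulus a b) x * f j x powr P))"
      show "indicator K x * \<bar>f i x - f j x\<bar> powr r \<le> ?R"
      proof (cases "x \<in> K")
        case True
        define y where "y = \<bar>f i x - f j x\<bar>"
        have y: "y \<ge> 0" by (simp add: y_def)
        have t1: "0 \<le> T powr (r - P) * (2 powr P * (f i x powr P + f j x powr P))" by simp
        have t2: "0 \<le> T powr (r - 1) / \<kappa> ^ 3 * (y * H x ^ 3)" using y ab H_bounds by simp
        have "y powr r \<le> T powr (r - 1) / \<kappa> ^ 3 * (y * H x ^ 3) + T powr (r - P) * (2 powr P * (f i x powr P + f j x powr P))"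
        proof (cases "y \<le> T")
          case yT: True
          show ?thesis
          proof (cases "y = 0")
            case False
            have "y powr r = y powr (r - 1) * y" using False y powr_add[of y "r - 1" 1] by simp
            also have "\<dots> \<le> T powr (r - 1) * y" using yT y r by (intro mult_right_mono powr_mono2) auto
            also have "\<dots> = T powr (r - 1) / \<kappa> ^ 3 * (y * \<kappa> ^ 3)" using ab by simp
            also have "\<dots> \<le> T powr (r - 1) / \<kappa> ^ 3 * (y * H x ^ 3)"
              using ab HK[OF True] y by (intro mult_left_mono power_mono) auto
            finally show ?thesis using t1 by linarith
          qed (use t1 t2 in auto)
        next
          case False
          have "y powr r = y powr (r - P) * y powr P" by (simp add: powr_add[symmetric])
          also have "\<dots> \<le> T powr (r - P) * y powr P"
            using False T P by (intro mult_right_mono powr_mono2') auto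
          also have "\<dots> \<le> T powr (r - P) * (2 powr P * (f i x powr P + f j x powr P))"
          proof (rule mult_left_mono)
            have "y \<le> f i x + f j x" using f(2)[OF i, of x] f(2)[OF j, of x] by (auto simp: y_def abs_if)
            then have "y powr P \<le> (f i x + f j x) powr P" using y P r by (intro powr_mono2) auto
            also have "\<dots> \<le> 2 powr P * (f i x powr P + f j x powr P)"
              using f(2)[OF i, of x] f(2)[OF j, of x] P r by (intro powr_add_le) auto
            finally show "y powr P \<le> 2 powr P * (f i x powr P + f j x powr P)" .
          qed simp
          finally show ?thesis using t2 by linarith
        qed
        then show ?thesis using True ab(5)[OF True] by (simp add: y_def)
      next
        case False
        have "0 \<le> ?R" using ab H_bounds[of x] by (intro add_nonneg_nonneg mult_nonneg_nonneg) auto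
        then show ?thesis using False by simp
      qed
    qed
    also have "\<dots> = T powr (r - 1) / \<kappa> ^ 3 * (\<integral>x. \<bar>f i x - f j x\<bar> * H x ^ 3 \<partial>lborel)
        + T powr (r - P) * (2 powr P * ((\<integral>x. indicator (annulus a b) x * f i x powr P \<partial>lborel)
          + (\<integral>x. indicator (annulus a b) x * f j x powr P \<partial>lborel)))"
    proof -
      have lin: "(\<integral>x. s * f x + t * (w * (g x + k x)) \<partial>lborel)
         = s * integral\<^sup>L lborel f + t * (w * (integral\<^sup>L lborel g + integral\<^sup>L lborel k))"
        if "integrable lborel f" "integrable lborel g" "integrable lborel k" for s t w :: real and f g k :: "'a \<Rightarrow> real"
        using that by simp
      show ?thesis by (rule lin[OF iH iP[OF i] iP[OF j]])
    qed
    also have "\<dots> < T powr (r - 1) / \<kappa> ^ 3 * e' + T powr (r - P) * B"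
      unfolding B_def using A[OF i] A[OF j] d T(1) ab
      by (intro add_less_le_mono mult_left_mono mult_strict_left_mono add_mono) auto
    also have "\<dots> \<le> \<epsilon> + \<epsilon>" using TB T ab by (simp add: e'_def)
    also have "\<dots> = e powr r" by (simp add: \<epsilon>_def)
    finally have "(\<integral>x. \<bar>f i x - f j x\<bar> powr r \<partial>lebesgue_on K) powr (1 / r) < (e powr r) powr (1 / r)"
      using r by (intro powr_less_mono2) auto
    also have "\<dots> = e" using e r by (simp add: powr_powr)
    finally show ?thesis by (simp add: L_seminorm_def)
  qed
  show "\<exists>F. finite F \<and> F \<subseteq> I \<and> (\<forall>i\<in>I. \<exists>j\<in>F. L_seminorm K r (\<lambda>x. f i x - f j x) < e)"
  proof (intro exI[of _ F] conjI ballI F(1,2))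
    fix i assume i: "i \<in> I"
    obtain j where j: "j \<in> F" "(\<integral>x. \<bar>f i x - f j x\<bar> * H x ^ 3 \<partial>lborel) < e'"
      by (rule bexE[OF F(3)[OF i]])
    show "\<exists>j\<in>F. L_seminorm K r (\<lambda>x. f i x - f j x) < e"
      by (rule bexI[where x = j]) (rule close[OF i subsetD[OF F(2) j(1)] j(2)], rule j(1))
  qed
qed (rule r)

subsection \<open>The rescaled family\<close>

lemma abs_powr_pos: "t > 0 \<Longrightarrow> abs_powr t s = t powr s"
  by (simp add: abs_powr_def)

lemma abs_powr_mult_self: "t \<ge> 0 \<Longrightarrow> abs_powr t (s - 1) * t = t powr s"
  using powr_add[of t "s - 1" 1] by (cases "t = 0") (auto simp: abs_powr_def)

lemma laplacian_zero: "laplacian (\<lambda>_. 0) x = 0"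
proof -
  have "partial_deriv b (\<lambda>_. 0 :: real) = (\<lambda>_. 0)" for b :: 'a
    by (simp add: partial_deriv_def fun_eq_iff frechet_derivative_const)
  then show ?thesis by (simp add: laplacian_def)
qed

text \<open>Two derivatives produce the factor \<open>R^2\<close>; the relation
  \<open>b * s = a + 2\<close> matches it to the scaling of the source term. \<open>\<alpha>\<close>
  and \<open>\<beta>\<close> are the solution of the two such relations.\<close>

lemma has_laplacian_rescaled:
  assumes "has_laplacian UNIV f gf (\<lambda>x. - (w x powr s))" "\<And>x. w x \<ge> 0" "R \<ge> 1" "b * s = a + 2"
  shows "has_laplacian UNIV (\<lambda>x. R powr a * f (R *\<^sub>R x)) (\<lambda>x. (R powr a * R) *\<^sub>R gf (R *\<^sub>R x))
    (\<lambda>x. - ((R powr b * w (R *\<^sub>R x)) powr s))"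
proof -
  have "(R powr b * w (R *\<^sub>R x)) powr s = R powr a * R\<^sup>2 * w (R *\<^sub>R x) powr s" for x
    using assms(2-4) by (simp add: powr_mult powr_powr powr_add)
  then show ?thesis using has_laplacian_scale[OF assms(1), of R "R powr a"] by simp
qed

text \<open>For large \<open>R\<close> the rescaled pair is stable on a neighbourhood of the annulus, and the local
  estimate applies; the remaining \<open>R\<close> form a compact interval.\<close>
lemma rescaled_bound:
  fixes u v :: "'a::euclidean_space \<Rightarrow> real"
  assumes pq: "p > 1" "p \<ge> q" "q > 0" "p * q > 1"
    and \<alpha>: "\<alpha> = 2 * (p + 1) / (p * q - 1)" and \<beta>: "\<beta> = 2 * (q + 1) / (p * q - 1)"
    and \<sigma>: "\<sigma> = (q + 1) / (p + 1)" and c: "c = \<sigma> powr (- 1 / (p + 1))"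
    and u: "has_laplacian UNIV u gu (\<lambda>x. - (v x powr p))" and v: "has_laplacian UNIV v gv (\<lambda>x. - (u x powr q))"
    and pos: "\<And>x. u x > 0" "\<And>x. v x > 0"
    and stable: "stable_outside_compact p q u v"
    and K: "compact K" "K \<subseteq> - {0}"
  shows "\<exists>N>q + 1. \<exists>A. \<forall>R\<ge>1. (\<integral>x. indicator K x * (R powr \<alpha> * u (R *\<^sub>R x)) powr N \<partial>lborel) \<le> A"
proof -
  have nonneg: "u x \<ge> 0" "v x \<ge> 0" for x using pos[of x] by auto
  have uc: "continuous_on UNIV u" by (rule has_laplacianD[OF u])
  have \<sigma>0: "\<sigma> > 0" using pq by (simp add: \<sigma>)
  have c0: "c > 0" "c powr (p + 1) = 1 / \<sigma>"
  proof -
    show "c > 0" using \<sigma>0 by (simp add: c)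
    have "c powr (p + 1) = \<sigma> powr (-1)" using pq by (simp add: c powr_powr)
    then show "c powr (p + 1) = 1 / \<sigma>" using \<sigma>0 by (simp add: powr_minus divide_simps)
  qed
  have \<alpha>\<beta>: "\<beta> * p = \<alpha> + 2" "\<alpha> * q = \<beta> + 2" using pq by (simp_all add: \<alpha> \<beta> field_simps)
  obtain a b \<kappa> where ab: "0 < a" "a \<le> b" "annulus a b \<subseteq> - {0 :: 'a}" "0 < \<kappa>" "\<And>x. x \<in> K \<Longrightarrow> x \<in> annulus a b"
    "\<And>x. x \<in> K \<Longrightarrow> \<kappa> \<le> annulus_fun a b x"
    using compact_subset_annulus[OF K] by metis
  obtain gh lh M where cut: "cutoff (annulus_fun a b :: 'a \<Rightarrow> real) gh lh (annulus a b) M"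
    using annulus_cutoff[OF ab(2)] by metis
  \<comment> \<open>The bound is quantified over all pairs on this annulus. It is obtained before
    \<open>R\<close> is fixed and therefore serves every large \<open>R\<close>.\<close>
  have "\<exists>N>q + 1. \<exists>m>0. \<exists>B. \<forall>u v gu gv.
    lane_emden (annulus_fun a b :: 'a \<Rightarrow> real) gh lh (annulus a b) M p q \<sigma> c u v gu gv \<longrightarrow>
    lane_emden.J (annulus_fun a b) u v N 0 m \<le> B"
  proof (cases "q \<ge> 1")
    case True
    show ?thesis by (rule higher_integrability_ge1[OF _ _ _ \<sigma> c0 cut]) (use True pq in auto)
  next
    case False
    show ?thesis by (rule higher_integrability_le1[OF _ _ _ _ \<sigma> c0(1) cut]) (use False pq in auto)
  qed
  then obtain N m B where N: "N > q + 1" and m: "m > 0"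
    and B: "\<And>u v gu gv. lane_emden (annulus_fun a b :: 'a \<Rightarrow> real) gh lh (annulus a b) M p q \<sigma> c u v gu gv \<Longrightarrow>
    lane_emden.J (annulus_fun a b) u v N 0 m \<le> B" by blast
  interpret cutoff "annulus_fun a b :: 'a \<Rightarrow> real" gh lh "annulus a b" M by (rule cut)
  define U where "U R x = R powr \<alpha> * u (R *\<^sub>R x)" for R x
  define V where "V R x = R powr \<beta> * v (R *\<^sub>R x)" for R x
  have Upos: "U R x > 0" and Vpos: "V R x > 0" if "R \<ge> 1" for R x
    using pos that by (auto simp: U_def V_def)
  have UL: "has_laplacian UNIV (U R) (\<lambda>x. (R powr \<alpha> * R) *\<^sub>R gu (R *\<^sub>R x)) (\<lambda>x. - (V R x powr p))" if "R \<ge> 1" for R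
    unfolding U_def V_def using that nonneg(2) \<alpha>\<beta>(1) by (intro has_laplacian_rescaled u) auto
  have VL: "has_laplacian UNIV (V R) (\<lambda>x. (R powr \<beta> * R) *\<^sub>R gv (R *\<^sub>R x)) (\<lambda>x. - (U R x powr q))" if "R \<ge> 1" for R
    unfolding U_def V_def using that nonneg(1) \<alpha>\<beta>(2) by (intro has_laplacian_rescaled v) auto
  have Uc: "continuous_on S (U R)" if "R \<ge> 1" for R S
    by (rule continuous_on_subset[OF has_laplacianD(2)[OF UL[OF that]]]) simp
  obtain K' \<phi> \<psi> where K': "compact K'" "C2_on (- K') \<phi>" "C2_on (- K') \<psi>"
    and st: "\<And>x. x \<in> - K' \<Longrightarrow> \<phi> x > 0 \<and> \<psi> x > 0 \<and> - laplacian \<phi> x \<ge> p * abs_powr (v x) (p - 1) * \<psi> x \<and>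
        - laplacian \<psi> x \<ge> q * abs_powr (u x) (q - 1) * \<phi> x"
    using stable unfolding stable_outside_compact_def by blast
  have oK': "open (- K')" using K' by (simp add: compact_imp_closed open_Compl)
  obtain \<rho> where \<rho>: "\<rho> > 0" "\<And>x. x \<in> K' \<Longrightarrow> norm x \<le> \<rho>"
    using compact_imp_bounded[OF K'(1)] bounded_pos by metis
  \<comment> \<open>Points of the annulus have norm at least \<open>sqrt a\<close>, so for
    \<open>R \<ge> R0\<close> their dilations leave the ball of radius \<open>\<rho>\<close> that
    contains \<open>K'\<close>.\<close>
  define R0 where "R0 = max 1 (\<rho> / sqrt a + 1)"
  have large: "(\<integral>x. indicator K x * U R x powr N \<partial>lborel) \<le> B / \<kappa> ^ m" if R: "R \<ge> R0" for R
  proof -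
    have R1: "R \<ge> 1" using R by (simp add: R0_def)
    obtain g\<phi> where \<phi>L: "has_laplacian (- K') \<phi> g\<phi> (laplacian \<phi>)" using C2_on_has_laplacian[OF oK' K'(2)] by blast
    obtain g\<psi> where \<psi>L: "has_laplacian (- K') \<psi> g\<psi> (laplacian \<psi>)" using C2_on_has_laplacian[OF oK' K'(3)] by blast
    define S where "S = {x. R *\<^sub>R x \<in> - K'}"
    have S: "open S"
    proof -
      have "S = (\<lambda>x. R *\<^sub>R x) -` (- K')" by (auto simp: S_def)
      then show ?thesis using oK' by (simp add: open_vimage continuous_intros)
    qed
    have AS: "annulus a b \<subseteq> S"
    proof
      fix x :: 'a assume "x \<in> annulus a b"
      then have "sqrt a \<le> norm x" using ab(1) by (simp add: annulus_def real_le_lsqrt)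
      moreover have "\<rho> / sqrt a < R" using R by (simp add: R0_def)
      ultimately have "\<rho> < R * norm x"
        using ab(1) R1 by (smt (verit) divide_less_eq mult_left_mono real_sqrt_gt_zero)
      then show "x \<in> S" using \<rho>(2)[of "R *\<^sub>R x"] R1 by (auto simp: S_def)
    qed
    \<comment> \<open>The components of the supersolution scale differently. The first inequality
      forces this weight on \<open>\<psi>\<close>, and
      \<open>\<alpha> * (q - 1) = 4 - \<beta> * (p - 1)\<close> makes the second one hold with
      it.\<close>
    define k where "k = R powr (2 - \<beta> * (p - 1))"
    have k: "k > 0" using R1 by (simp add: k_def)
    have L1: "has_laplacian S (\<lambda>x. 1 * \<phi> (R *\<^sub>R x)) (\<lambda>x. (1 * R) *\<^sub>R g\<phi> (R *\<^sub>R x)) (\<lambda>x. 1 * R\<^sup>2 * laplacian \<phi> (R *\<^sub>R x))"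
      unfolding S_def by (rule has_laplacian_scale[OF \<phi>L])
    have L2: "has_laplacian S (\<lambda>x. k * \<psi> (R *\<^sub>R x)) (\<lambda>x. (k * R) *\<^sub>R g\<psi> (R *\<^sub>R x)) (\<lambda>x. k * R\<^sup>2 * laplacian \<psi> (R *\<^sub>R x))"
      unfolding S_def by (rule has_laplacian_scale[OF \<psi>L])
    have s1: "p * V R x powr (p - 1) * (k * \<psi> (R *\<^sub>R x)) \<le> - (1 * R\<^sup>2 * laplacian \<phi> (R *\<^sub>R x))" if "x \<in> S" for x
    proof -
      have x: "R *\<^sub>R x \<in> - K'" using that by (simp add: S_def)
      have "V R x powr (p - 1) * k = R powr (\<beta> * (p - 1)) * R powr (2 - \<beta> * (p - 1)) * v (R *\<^sub>R x) powr (p - 1)"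
        using R1 nonneg by (simp add: V_def k_def powr_mult powr_powr)
      also have "R powr (\<beta> * (p - 1)) * R powr (2 - \<beta> * (p - 1)) = R\<^sup>2" using R1 by (simp add: powr_add[symmetric])
      finally have "p * V R x powr (p - 1) * (k * \<psi> (R *\<^sub>R x)) = R\<^sup>2 * (p * v (R *\<^sub>R x) powr (p - 1) * \<psi> (R *\<^sub>R x))"
        by (simp add: mult_ac)
      also have "\<dots> \<le> R\<^sup>2 * - laplacian \<phi> (R *\<^sub>R x)"
        using st[OF x] pos by (intro mult_left_mono) (auto simp: abs_powr_pos)
      finally show ?thesis by simp
    qed
    have s2: "q * U R x powr (q - 1) * (1 * \<phi> (R *\<^sub>R x)) \<le> - (k * R\<^sup>2 * laplacian \<psi> (R *\<^sub>R x))" if "x \<in> S" for x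
    proof -
      have x: "R *\<^sub>R x \<in> - K'" using that by (simp add: S_def)
      have e: "\<alpha> * (q - 1) = (2 - \<beta> * (p - 1)) + 2" using \<alpha>\<beta> by (simp add: algebra_simps)
      have "R powr (\<alpha> * (q - 1)) = k * R\<^sup>2"
        unfolding e k_def using R1 by (simp only: powr_add) simp
      then have "U R x powr (q - 1) = k * R\<^sup>2 * u (R *\<^sub>R x) powr (q - 1)"
        using R1 nonneg by (simp add: U_def powr_mult powr_powr)
      then have "q * U R x powr (q - 1) * (1 * \<phi> (R *\<^sub>R x)) = k * R\<^sup>2 * (q * u (R *\<^sub>R x) powr (q - 1) * \<phi> (R *\<^sub>R x))"
        by (simp add: mult_ac)
      also have "\<dots> \<le> k * R\<^sup>2 * - laplacian \<psi> (R *\<^sub>R x)"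
        using st[OF x] pos k by (intro mult_left_mono) (auto simp: abs_powr_pos)
      finally show ?thesis by simp
    qed
    have LE: "lane_emden (annulus_fun a b :: 'a \<Rightarrow> real) gh lh (annulus a b) M p q \<sigma> c (U R) (V R)
        (\<lambda>x. (R powr \<alpha> * R) *\<^sub>R gu (R *\<^sub>R x)) (\<lambda>x. (R powr \<beta> * R) *\<^sub>R gv (R *\<^sub>R x))"
    proof (intro lane_emden.intro lane_emden_axioms.intro cut)
      show "V R x \<le> c * U R x powr \<sigma>" for x
        unfolding c by (rule lane_emden_comparison[OF pq(2,3,4) UL[OF R1] VL[OF R1] _ _ \<sigma>])
          (use Upos[OF R1] Vpos[OF R1] in \<open>auto intro: less_imp_le\<close>)
      fix \<eta> :: "'a \<Rightarrow> real" and g\<eta> l\<eta> E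
      assume \<eta>: "has_laplacian UNIV \<eta> g\<eta> l\<eta>" "\<And>x. 0 \<le> \<eta> x" "\<And>x. x \<notin> annulus a b \<Longrightarrow> \<eta> x = 0"
        "\<And>x. x \<notin> annulus a b \<Longrightarrow> g\<eta> x = 0" "continuous_on UNIV E" "\<And>x. x \<notin> annulus a b \<Longrightarrow> E x = 0" "\<And>x. - l\<eta> x \<le> E x"
      show "p * (\<integral>x. V R x powr (p - 1) * (\<eta> x)\<^sup>2 \<partial>lborel) \<le> 1 / q * (\<integral>x. U R x powr (1 - q) * (E x)\<^sup>2 \<partial>lborel)"
        by (rule stability_inequality[OF S compact_annulus AS L1 L2 _ _ s1 s2 has_laplacianD(2)[OF UL[OF R1]]
            has_laplacianD(2)[OF VL[OF R1]] Upos[OF R1] Vpos[OF R1] pq(3) \<eta>])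
          (use st k in \<open>auto simp: S_def\<close>)
    qed (use pq \<sigma> c0 UL[OF R1] VL[OF R1] Upos[OF R1] Vpos[OF R1] in auto)
    interpret lane_emden "annulus_fun a b :: 'a \<Rightarrow> real" gh lh "annulus a b" M p q \<sigma> c "U R" "V R"
        "\<lambda>x. (R powr \<alpha> * R) *\<^sub>R gu (R *\<^sub>R x)" "\<lambda>x. (R powr \<beta> * R) *\<^sub>R gv (R *\<^sub>R x)" by (rule LE)
    have JB: "J N 0 m \<le> B" by (rule B[OF LE])
    have "continuous_on UNIV (\<lambda>x. U R x powr N)" using nz by (intro continuous_intros Uc[OF R1]) auto
    then have iK: "integrable lborel (\<lambda>x. indicator K x * U R x powr N)"
      using K by (intro lebesgue_on_compact(3)) (auto intro: continuous_on_subset)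
    have iH: "integrable lborel (\<lambda>x. U R x powr N * V R x powr 0 * H x ^ m / \<kappa> ^ m)"
      by (rule integrable_divide_zero) (rule J_integrable[OF m])
    have "(\<integral>x. indicator K x * U R x powr N \<partial>lborel) \<le> (\<integral>x. U R x powr N * V R x powr 0 * H x ^ m / \<kappa> ^ m \<partial>lborel)"
    proof (rule integral_mono[OF iK iH])
      fix x
      show "indicator K x * U R x powr N \<le> U R x powr N * V R x powr 0 * H x ^ m / \<kappa> ^ m"
      proof (cases "x \<in> K")
        case True
        have "\<kappa> ^ m \<le> H x ^ m" using ab(4) ab(6)[OF True] by (intro power_mono) (auto simp: H_def)
        then have "U R x powr N * \<kappa> ^ m \<le> U R x powr N * H x ^ m" by (intro mult_left_mono) auto
        then show ?thesis using True ab(4) nz by (simp add: field_simps)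
      next
        case False
        then show ?thesis using ab(4) H_bounds(1)[of x] by simp
      qed
    qed
    also have "\<dots> = J N 0 m / \<kappa> ^ m" by (simp add: J_def)
    also have "\<dots> \<le> B / \<kappa> ^ m" using JB ab(4) by (intro divide_right_mono) auto
    finally show ?thesis .
  qed
  have c1: "continuous_on ({1..R0} \<times> K) (\<lambda>z. fst z powr \<alpha>)"
    by (rule continuous_on_powr[OF continuous_on_fst[OF continuous_on_id] continuous_on_const]) auto
  have c2: "continuous_on ({1..R0} \<times> K) (\<lambda>z. u (fst z *\<^sub>R snd z))"
    by (rule continuous_on_compose2[OF uc continuous_on_scaleR[OF continuous_on_fst[OF continuous_on_id]
          continuous_on_snd[OF continuous_on_id]]]) simp
  have "compact ((\<lambda>z. fst z powr \<alpha> * u (fst z *\<^sub>R snd z)) ` ({1..R0} \<times> K))"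
    by (rule compact_continuous_image[OF continuous_on_mult[OF c1 c2] compact_Times[OF compact_Icc K(1)]])
  from compact_imp_bounded[OF this]
  obtain D where D: "\<forall>y\<in>(\<lambda>z. fst z powr \<alpha> * u (fst z *\<^sub>R snd z)) ` ({1..R0} \<times> K). \<bar>y\<bar> \<le> D"
    unfolding bounded_real by (rule exE)
  have small: "(\<integral>x. indicator K x * U R x powr N \<partial>lborel) \<le> \<bar>D\<bar> powr N * measure lborel K" if R: "1 \<le> R" "R \<le> R0" for R
  proof -
    have iK: "integrable lborel (indicator K :: 'a \<Rightarrow> real)"
      using borel_integrable_compact[OF K(1), of "\<lambda>x. 1::real"] by simp
    have "(\<integral>x. indicator K x * U R x powr N \<partial>lborel) \<le> (\<integral>x. \<bar>D\<bar> powr N * indicator K x \<partial>lborel)"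
    proof (rule integral_mono')
      fix x
      show "indicator K x * U R x powr N \<le> \<bar>D\<bar> powr N * indicator K x"
      proof (cases "x \<in> K")
        case True
        then have "(R, x) \<in> {1..R0} \<times> K" using R by simp
        then have "\<bar>fst (R, x) powr \<alpha> * u (fst (R, x) *\<^sub>R snd (R, x))\<bar> \<le> D" using D by blast
        then have "\<bar>U R x\<bar> \<le> D" by (simp add: U_def)
        then have "U R x powr N \<le> \<bar>D\<bar> powr N" using Upos[OF R(1), of x] N pq by (intro powr_mono2) auto
        then show ?thesis using True by simp
      qed simp
    qed (use iK in auto)
    also have "\<dots> = \<bar>D\<bar> powr N * measure lborel K" using K(1) by (simp add: borel_compact)
    finally show ?thesis .
  qed
  have "(\<integral>x. indicator K x * (R powr \<alpha> * u (R *\<^sub>R x)) powr N \<partial>lborel) \<le> max (B / \<kappa> ^ m) (\<bar>D\<bar> powr N * measure lborel K)"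
    if "R \<ge> 1" for R
    using large[of R] small[of R] that unfolding U_def by (cases "R \<ge> R0") auto
  then show ?thesis using N by blast
qed

theorem theorem3:
  fixes u v :: "real ^ 'd \<Rightarrow> real" and p q \<alpha> \<beta> :: real
  assumes "CARD('d) \<ge> 2"
    and "p \<ge> q" and "q > 0" and "p * q > 1"
    and "\<alpha> = 2 * (p + 1) / (p * q - 1)" and "\<beta> = 2 * (q + 1) / (p * q - 1)"
    and "\<And>x. u x \<ge> 0" and "\<And>x. v x \<ge> 0"
    and "lane_emden_solution p q u v"
    and "stable_outside_compact p q u v"
  shows "relatively_compact_in
    (prod_topology (Lloc (- {0}) (q + 1)) (Lloc (- {0}) (p + 1)))
    {(Lloc_class (- {0}) (q + 1) (\<lambda>x. R powr \<alpha> * u (R *\<^sub>R x)),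
      Lloc_class (- {0}) (p + 1) (\<lambda>x. R powr \<beta> * v (R *\<^sub>R x))) | R. R \<ge> 1}"
proof -
  note pq = assms(2-4) and nonneg = assms(7,8)
  have p1: "p > 1"
  proof (rule ccontr)
    assume "\<not> p > 1"
    then have "p * q \<le> 1 * 1" using pq by (intro mult_mono) auto
    then show False using pq by simp
  qed
  define \<sigma> where "\<sigma> = (q + 1) / (p + 1)"
  define c where "c = \<sigma> powr (- 1 / (p + 1))"
  have \<sigma>0: "\<sigma> > 0" using pq p1 by (simp add: \<sigma>_def)
  have c0: "c > 0" using \<sigma>0 by (simp add: c_def)
  have "C2_on UNIV u \<and> C2_on UNIV v \<and> (\<forall>x. - laplacian u x = v x powr p) \<and> (\<forall>x. - laplacian v x = u x powr q)"
    using assms(9) nonneg unfolding lane_emden_solution_def by (simp add: abs_powr_mult_self)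
  then have C2: "C2_on UNIV u" "C2_on UNIV v"
    and eqs: "- laplacian u x = v x powr p" "- laplacian v x = u x powr q" for x by blast+
  have sol: "laplacian u x = - (v x powr p)" "laplacian v x = - (u x powr q)" for x
    using eqs[of x] by linarith+
  obtain gu where u: "has_laplacian UNIV u gu (\<lambda>x. - (v x powr p))"
    using has_laplacian_cong[OF C2_on_has_laplacian[OF open_UNIV C2(1)] sol(1)] by (rule that)
  obtain gv where v: "has_laplacian UNIV v gv (\<lambda>x. - (u x powr q))"
    using has_laplacian_cong[OF C2_on_has_laplacian[OF open_UNIV C2(2)] sol(2)] by (rule that)
  have q\<sigma>: "q + 1 = \<sigma> * (p + 1)" using p1 by (simp add: \<sigma>_def)
  then have \<beta>\<sigma>: "\<beta> = \<alpha> * \<sigma>" by (simp add: assms(5,6) mult_ac)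
  have comparison: "v x \<le> c * u x powr \<sigma>" for x
    unfolding c_def by (rule lane_emden_comparison[OF pq u v nonneg \<sigma>_def])
  let ?A = "(\<lambda>R. Lloc_class (- {0}) (q + 1) (\<lambda>x. R powr \<alpha> * u (R *\<^sub>R x))) ` {1..}"
  let ?B = "(\<lambda>R. Lloc_class (- {0}) (p + 1) (\<lambda>x. R powr \<beta> * v (R *\<^sub>R x))) ` {1..}"
  have "relatively_compact_in (Lloc (- {0}) (q + 1)) ?A \<and> relatively_compact_in (Lloc (- {0}) (p + 1)) ?B"
  \<comment> \<open>By the strong minimum principle a nonnegative solution is either positive in
    both components or zero. The integral estimates need positivity because of their negative
    exponents.\<close>
  proof (cases "\<exists>x. v x > 0")
    case True
    then obtain x1 where x1: "v x1 > 0" by blast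
    have vpos: "v x > 0" for x by (rule superharmonic_pos[OF v nonneg(2) _ x1]) simp
    have "u x1 > 0"
    \<comment> \<open>Since \<open>0 powr \<sigma> = 0\<close>, the comparison would force
      \<open>v x1\<close> to vanish too.\<close>
    proof (rule ccontr)
      assume "\<not> u x1 > 0"
      then have "u x1 = 0" using nonneg(1)[of x1] by simp
      then show False using comparison[of x1] x1 by simp
    qed
    have upos: "u x > 0" for x by (rule superharmonic_pos[OF u nonneg(1) _ \<open>u x1 > 0\<close>]) simp
    note bound = rescaled_bound[OF p1 pq assms(5,6) \<sigma>_def c_def u v upos vpos assms(10)]
    have "relatively_compact_in (Lloc (- {0}) (q + 1)) ?A"
    proof (rule superharmonic_family_relatively_compact)
      fix R :: real assume R: "R \<in> {1..}"
      show "has_laplacian UNIV (\<lambda>x. R powr \<alpha> * u (R *\<^sub>R x)) (\<lambda>x. (R powr \<alpha> * R) *\<^sub>R gu (R *\<^sub>R x))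
          (\<lambda>x. R powr \<alpha> * R\<^sup>2 * - (v (R *\<^sub>R x) powr p))"
        using has_laplacian_scale[OF u, of R "R powr \<alpha>"] by simp
      show "R powr \<alpha> * u (R *\<^sub>R x) > 0" for x using R upos by simp
    next
      fix K :: "(real ^ 'd) set" assume K: "compact K" "K \<subseteq> - {0}"
      obtain N A where N: "N > q + 1" and A: "\<forall>R\<ge>1. (\<integral>x. indicator K x * (R powr \<alpha> * u (R *\<^sub>R x)) powr N \<partial>lborel) \<le> A"
        using bound[OF K] by blast
      show "\<exists>P>q + 1. \<exists>A. \<forall>R\<in>{1..}. (\<integral>x. indicator K x * (R powr \<alpha> * u (R *\<^sub>R x)) powr P \<partial>lborel) \<le> A"
        using N A by auto
    qed (use pq in auto)
    moreover have "relatively_compact_in (Lloc (- {0}) (p + 1)) ?B"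
    proof (rule superharmonic_family_relatively_compact)
      fix R :: real assume R: "R \<in> {1..}"
      show "has_laplacian UNIV (\<lambda>x. R powr \<beta> * v (R *\<^sub>R x)) (\<lambda>x. (R powr \<beta> * R) *\<^sub>R gv (R *\<^sub>R x))
          (\<lambda>x. R powr \<beta> * R\<^sup>2 * - (u (R *\<^sub>R x) powr q))"
        using has_laplacian_scale[OF v, of R "R powr \<beta>"] by simp
      show "R powr \<beta> * v (R *\<^sub>R x) > 0" for x using R vpos by simp
    next
      fix K :: "(real ^ 'd) set" assume K: "compact K" "K \<subseteq> - {0}"
      obtain N A where N: "N > q + 1" and A: "\<forall>R\<ge>1. (\<integral>x. indicator K x * (R powr \<alpha> * u (R *\<^sub>R x)) powr N \<partial>lborel) \<le> A"
        using bound[OF K] by blast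
      \<comment> \<open>The comparison bounds the power \<open>N / \<sigma>\<close> of the rescaled
        \<open>v\<close> by the power \<open>N\<close> of the rescaled \<open>u\<close>, and
        \<open>q + 1 = \<sigma> * (p + 1)\<close> turns \<open>N > q + 1\<close> into this.\<close>
      have P: "N / \<sigma> > p + 1" using N \<sigma>0 unfolding q\<sigma> by (simp add: less_divide_eq mult.commute)
      have uc: "continuous_on UNIV u" by (rule has_laplacianD[OF u])
      have "(\<integral>x. indicator K x * (R powr \<beta> * v (R *\<^sub>R x)) powr (N / \<sigma>) \<partial>lborel) \<le> c powr (N / \<sigma>) * A" if R: "R \<ge> 1" for R
      proof -
        have i: "integrable lborel (\<lambda>x. indicator K x * (R powr \<alpha> * u (R *\<^sub>R x)) powr N)"
        proof (rule lebesgue_on_compact(3)[OF K(1)])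
          show "continuous_on K (\<lambda>x. (R powr \<alpha> * u (R *\<^sub>R x)) powr N)"
            using R upos by (intro continuous_intros continuous_on_compose2[OF uc]) (auto simp: less_imp_neq[symmetric])
        qed
        have "(\<integral>x. indicator K x * (R powr \<beta> * v (R *\<^sub>R x)) powr (N / \<sigma>) \<partial>lborel)
            \<le> (\<integral>x. c powr (N / \<sigma>) * (indicator K x * (R powr \<alpha> * u (R *\<^sub>R x)) powr N) \<partial>lborel)"
        proof (rule integral_mono'[OF integrable_mult_right[OF i]])
          fix x
          have "R powr \<beta> * v (R *\<^sub>R x) \<le> R powr \<beta> * (c * u (R *\<^sub>R x) powr \<sigma>)"
            using comparison by (intro mult_left_mono) auto
          also have "\<dots> = c * (R powr \<alpha> * u (R *\<^sub>R x)) powr \<sigma>"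
            using R upos[of "R *\<^sub>R x"] by (simp add: powr_mult powr_powr \<beta>\<sigma>)
          finally have "(R powr \<beta> * v (R *\<^sub>R x)) powr (N / \<sigma>) \<le> (c * (R powr \<alpha> * u (R *\<^sub>R x)) powr \<sigma>) powr (N / \<sigma>)"
            using R vpos[of "R *\<^sub>R x"] P p1 by (intro powr_mono2) auto
          also have "\<dots> = c powr (N / \<sigma>) * (R powr \<alpha> * u (R *\<^sub>R x)) powr N"
            using c0 \<sigma>0 by (simp add: powr_mult powr_powr)
          finally show "indicator K x * (R powr \<beta> * v (R *\<^sub>R x)) powr (N / \<sigma>)
              \<le> c powr (N / \<sigma>) * (indicator K x * (R powr \<alpha> * u (R *\<^sub>R x)) powr N)"
            by (auto simp: indicator_def)
        qed simp
        also have "\<dots> \<le> c powr (N / \<sigma>) * A" using A R by (simp add: mult_left_mono)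
        finally show ?thesis .
      qed
      then show "\<exists>P>p + 1. \<exists>A. \<forall>R\<in>{1..}. (\<integral>x. indicator K x * (R powr \<beta> * v (R *\<^sub>R x)) powr P \<partial>lborel) \<le> A"
        using P by auto
    qed (use p1 in auto)
    ultimately show ?thesis by blast
  next
    case False
    then have v0: "v x = 0" for x using nonneg(2)[of x] by (simp add: not_less antisym)
    then have "v = (\<lambda>_. 0)" by auto
    \<comment> \<open>The second equation gives \<open>u powr q = 0\<close>. Both families are then
      constant, and one member is a net.\<close>
    then have u0: "u x = 0" for x using sol(2)[of x] by (simp add: laplacian_zero)
    have zero: "relatively_compact_in (Lloc (- {0}) r) ((\<lambda>R. Lloc_class (- {0}) r (\<lambda>x::real ^ 'd. 0)) ` {1::real..})" if "r \<ge> 1" for r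
    proof (rule Lloc_relatively_compactI)
      show "open (- {0 :: real ^ 'd})" by (rule open_Compl) simp
      fix K :: "(real ^ 'd) set" and e :: real assume "e > 0"
      then show "\<exists>F. finite F \<and> F \<subseteq> {1::real..} \<and> (\<forall>i\<in>{1..}. \<exists>j\<in>F. L_seminorm K r (\<lambda>x. 0 - 0) < e)"
        by (intro exI[of _ "{1}"]) (auto simp: L_seminorm_def)
    qed (use that in \<open>auto simp: Lloc_fun_def\<close>)
    show ?thesis using zero[of "q + 1"] zero[of "p + 1"] pq p1 by (simp add: u0 v0)
  qed
  then show ?thesis
    by (intro relatively_compact_in_prod[of _ ?A _ ?B]) auto
qed

end
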